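(* Let $U\subseteq\mathbb{H}^n$ be open, $T\in N_{\mathbb{H},k}(U)$, $f\in Lip(U,\mathbb{R})$ and $t\in\mathbb{R}$. Then: (0) $(\mu_T+\mu_{\partial T})(\{f=t\})=0$ for all $t$ but at most countably many. (1) $\langle T,f,t+\rangle=\langle T,f,t-\rangle$ for all $t$ but at most countably many. (2) $\operatorname{spt}\langle T,f,t+\rangle\subseteq f^{-1}\{t\}\cap\operatorname{spt}T$. (3) $\partial\langle T,f,t+\rangle=-\langle\partial T,f,t+\rangle$.
   Context: **Heisenberg group.** For $n\ge 1$, $\mathbb{H}^n=(\mathbb{R}^{2n+1},* )$ with coordinates $(x,y,\tau)$, $x,y\in\mathbb{R}^n$, $\tau\in\mathbb{R}$, and $(x,y,\tau)*(x',y',\tau')=(x+x',y+y',\tau+\tau'+\frac12\sum_j(x_jy_j'-y_jx_j'))$. Distance $d_{\mathbb{H}}(p,q)=\|q^{-1}*p\|_{\mathbb{H}}$, $\|(x,y,\tau)\|_{\mathbb{H}}=(|(x,y)|^4+16\tau^2)^{1/4}$; $Lip(U,\mathbb{R})$ is the set of functions Lipschitz with respect to $d_{\mathbb{H}}$. Left invariant fields: $W_j=\partial_{x_j}-\frac12y_j\partial_\tau$, $W_{n+j}=\partial_{y_j}+\frac12x_j\partial_\tau$ ($1\le j\le n$), $W_{2n+1}=\partial_\tau$, declared orthonormal; they span the Lie algebra $\mathfrak{h}$, and $\mathfrak{h}_1=\operatorname{span}\{W_1,\dots,W_{2n}\}$. Dual basis: $dw_j=dx_j$, $dw_{n+j}=dy_j$,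 $dw_{2n+1}=\theta:=d\tau-\frac12\sum_j(x_jdy_j-y_jdx_j)$. $\langle\omega|v\rangle$ is the pairing of covectors and multivectors; $*$ is also the Hodge operator on multivectors of $\mathfrak{h}$. **Rumin forms and currents.** $\Omega^k$: smooth $k$-forms; $I^k=\{\alpha\wedge\theta+\beta\wedge d\theta:\alpha\in\Omega^{k-1},\beta\in\Omega^{k-2}\}$; $J^k=\{\alpha\in\Omega^k:\alpha\wedge\theta=0,\alpha\wedge d\theta=0\}$. $\mathcal{D}^k_{\mathbb{H}}(U)$: compactly supported smooth sections on $U$ of $\Omega^k/I^k$ if $k\le n$ (for $k=0$: $C_c^\infty(U)$), of $J^k$ if $n+1\le k\le2n+1$. $\mathcal{D}_{\mathbb{H},k}(U)$: continuous linear functionals on $\mathcal{D}^k_{\mathbb{H}}(U)$. Rumin differential $d_c$: $d_c[\alpha]_{I^k}=[d\alpha]_{I^{k+1}}$ for $k<n$; $d_c=d$ on $J^k$ for $k\ge n+1$; for $k=n$, $d_c[\alpha]_{I^n}=d(\alpha+\mathcal{L}(\alpha)\wedge\theta)$, where $\mathcal{L}(\alpha)=L^{-1}(-(d\alpha)_{|\bigwedge^{n+1}\mathfrak{h}_1})$, $L:\bigwedge^{n-1}\mathfrak{h}_1\to\bigwedge^{n+1}\mathfrak{h}_1$ is the isomorphism $\beta\mapsto d\theta\wedge\beta$ and $(\cdot)_{|\bigwedge^{n+1}\mathfrak{h}_1}$ is the component not containing $\theta$. For $T\in\mathcal{D}_{\mathbb{H},k}(U)$, $1\le k\le 2n+1$,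 the boundary is $\partial T(\omega)=T(d_c\omega)$, $\omega\in\mathcal{D}^{k-1}_{\mathbb{H}}(U)$; $\partial T=0$ for $0$-currents. $\operatorname{spt}T$ is the complement in $U$ of the union of all open $V\subseteq U$ such that $T(\omega)=0$ whenever $\operatorname{spt}\omega\subseteq V$. **Mass.** For $k\le n$, a simple $v=v_1\wedge\dots\wedge v_k\in\bigwedge_k\mathfrak{h}_1$ is integrable if the distribution spanned by the left invariant fields $v_1,\dots,v_k$ is integrable; for $k\ge n+1$ a $k$-vector is called simple integrable here if it is $*v$ with $v\in\bigwedge_{2n+1-k}\mathfrak{h}_1$ simple and integrable. ${}_H\bigwedge_k$ is the linear span of the simple integrable $k$-vectors (${}_H\bigwedge_0=\mathbb{R}$; for $k\le n$ they annihilate $I^k$, so the pairing with $\Omega^k/I^k$ is well defined). $\|\omega(p)\|^*=\sup\{\langle\omega(p)|v\rangle: v\text{ a unit simple integrable }k\text{-vector}\}$, $M(T)=\sup\{T(\omega):\omega\in\mathcal{D}^k_{\mathbb{H}}(U),\|\omega(p)\|^*\le1\ \forall p\}$. $T$ is representable by integration, $T=\overrightarrow{T}\wedge\mu_T$, if there are a Radon measure $\mu_T$ on $U$ and a $\mu_T$-measurable $\overrightarrow{T}:U\to{}_H\bigwedge_k$ with $\|\overrightarrow{T}\|=1$ $\mu_T$-a.e. (norm dual to the comass) and $T(\omega)=\int\langle\omega|\overrightarrow{T}\rangle d\mu_T$ for all $\omega\in\mathcal D^k_{\mathbb H}(U)$. Currents of finite mass are representable by integration with $\mu_T(U)=M(T)$.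 **Spaces, restriction, slices.** $N_{\mathbb{H},k}(U)$ is the set of $T\in\mathcal{D}_{\mathbb{H},k}(U)$ with compact support and $M(T)+M(\partial T)<\infty$. For a Borel set $A$ and a current $S=\overrightarrow{S}\wedge\mu_S$, $(S\llcorner A)(\omega)=\int_{U\cap A}\langle\omega|\overrightarrow{S}\rangle d\mu_S$. Slices: $\langle T,f,t+\rangle=(\partial T)\llcorner\{f>t\}-\partial(T\llcorner\{f>t\})$ and $\langle T,f,t-\rangle=\partial(T\llcorner\{f<t\})-(\partial T)\llcorner\{f<t\}$.
   Formalization: In degree n the Rumin differential is taken as d(α + θ∧L(α)) instead of d(α + L(α)∧θ); the two agree for odd n, while for even n the stated formula does not land in J^{n+1}, so the boundary of an (n+1)-current would be undefined. *)

theory Defs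
  imports "HOL-Analysis.Analysis"
begin

section \<open>The Heisenberg group\<close>

text \<open>\<open>n\<close> is \<open>CARD('n)\<close>; the linear order on \<open>'n\<close> numbers the coordinates and only fixes signs
  in the exterior algebra. The topology of the product type is also the one induced by the
  Heisenberg distance.\<close>

type_synonym 'n hpoint = "(real ^ 'n) \<times> (real ^ 'n) \<times> real"

definition heis_mult :: "'n::finite hpoint \<Rightarrow> 'n hpoint \<Rightarrow> 'n hpoint" where
  "heis_mult = (\<lambda>(x, y, \<tau>) (x', y', \<tau>').
     (x + x', y + y', \<tau> + \<tau>' + (1/2) * (\<Sum>j\<in>UNIV. x $ j * y' $ j - y $ j * x' $ j)))"

definition heis_inv :: "'n::finite hpoint \<Rightarrow> 'n hpoint" where
  "heis_inv = (\<lambda>(x, y, \<tau>). (- x, - y, - \<tau>))"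

definition heis_norm :: "'n::finite hpoint \<Rightarrow> real" where
  "heis_norm = (\<lambda>(x, y, \<tau>). root 4 (norm (x, y) ^ 4 + 16 * \<tau>\<^sup>2))"

definition heis_dist :: "'n::finite hpoint \<Rightarrow> 'n hpoint \<Rightarrow> real" where
  "heis_dist p q = heis_norm (heis_mult (heis_inv q) p)"

definition heis_Lip :: "'n::finite hpoint set \<Rightarrow> ('n hpoint \<Rightarrow> real) set" where
  "heis_Lip U = {f. \<exists>L. \<forall>p\<in>U. \<forall>q\<in>U. \<bar>f p - f q\<bar> \<le> L * heis_dist p q}"

text \<open>Indices of the left invariant frame in the order
  \<open>W\<^sub>1, \<dots>, W\<^sub>n, W\<^sub>n\<^sub>+\<^sub>1, \<dots>, W\<^sub>2\<^sub>n, W\<^sub>2\<^sub>n\<^sub>+\<^sub>1\<close>.\<close>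

datatype 'n hidx = Ix 'n | Iy 'n | It

instance hidx :: (finite) finite
proof
  have "x \<in> range Ix \<union> range Iy \<union> {It}" for x :: "'a hidx"
    by (cases x) auto
  then have "(UNIV :: 'a hidx set) = range Ix \<union> range Iy \<union> {It}"
    by blast
  then show "finite (UNIV :: 'a hidx set)"
    by (metis finite.emptyI finite_UnI finite_imageI finite_insert finite)
qed

instantiation hidx :: (linorder) linorder
begin

fun less_eq_hidx :: "'a hidx \<Rightarrow> 'a hidx \<Rightarrow> bool" where
  "less_eq_hidx (Ix i) (Ix j) = (i \<le> j)"
| "less_eq_hidx (Ix i) (Iy j) = True"
| "less_eq_hidx (Iy i) (Ix j) = False"
| "less_eq_hidx (Iy i) (Iy j) = (i \<le> j)"
| "less_eq_hidx It (Ix j) = False"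
| "less_eq_hidx It (Iy j) = False"
| "less_eq_hidx i It = True"

definition less_hidx :: "'a hidx \<Rightarrow> 'a hidx \<Rightarrow> bool" where
  "less_hidx i j \<longleftrightarrow> i \<le> j \<and> \<not> j \<le> i"

instance
proof
  fix i j k :: "'a hidx"
  show "i < j \<longleftrightarrow> i \<le> j \<and> \<not> j \<le> i" by (rule less_hidx_def)
  show "i \<le> i" by (cases i) auto
  show "i \<le> j \<Longrightarrow> j \<le> k \<Longrightarrow> i \<le> k" by (cases i; cases j; cases k) auto
  show "i \<le> j \<Longrightarrow> j \<le> i \<Longrightarrow> i = j" by (cases i; cases j) auto
  show "i \<le> j \<or> j \<le> i" by (cases i; cases j) auto
qed

end

fun frame :: "'n::finite hidx \<Rightarrow> 'n hpoint \<Rightarrow> 'n hpoint" where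
  "frame (Ix j) (x, y, \<tau>) = (axis j 1, 0, - (y $ j) / 2)"
| "frame (Iy j) (x, y, \<tau>) = (0, axis j 1, x $ j / 2)"
| "frame It (x, y, \<tau>) = (0, 0, 1)"

text \<open>Elements of the Lie algebra are given by their coordinates in the frame.\<close>

type_synonym 'n lie = "real ^ 'n hidx"

definition left_inv_field :: "'n::finite lie \<Rightarrow> 'n hpoint \<Rightarrow> 'n hpoint" where
  "left_inv_field v p = (\<Sum>i\<in>UNIV. v $ i *\<^sub>R frame i p)"

definition lie1 :: "'n::finite lie set" where
  "lie1 = {v. v $ It = 0}"


section \<open>Exterior algebra\<close>

text \<open>A multivector of the Lie algebra is its family of coefficients in the basis
  \<open>W\<^sub>S = W\<^bsub>i\<^sub>1\<^esub> \<and> \<dots> \<and> W\<^bsub>i\<^sub>k\<^esub>\<close>, \<open>S = {i\<^sub>1 < \<dots> < i\<^sub>k}\<close>; a covector is its family of coefficients in the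
  dual basis \<open>dw\<^sub>S\<close>. Both have the type below. The library norm is the Euclidean norm for which
  the \<open>W\<^sub>S\<close> are orthonormal, and the pairing of covectors and multivectors is the library
  inner product \<open>\<omega> \<bullet> v\<close>.\<close>

type_synonym 'n ext = "real ^ 'n hidx set"

definition shuffle_sign :: "'i::linorder set \<Rightarrow> 'i set \<Rightarrow> real" where
  "shuffle_sign A B = (- 1) ^ card {(i, j). i \<in> A \<and> j \<in> B \<and> j < i}"

definition wedge :: "'n::{finite,linorder} ext \<Rightarrow> 'n ext \<Rightarrow> 'n ext"  (infixl \<open>\<^bold>\<and>\<close> 70) where
  "a \<^bold>\<and> b = (\<chi> S. \<Sum>A\<in>Pow S. shuffle_sign A (S - A) * a $ A * b $ (S - A))"

abbreviation basis_ext :: "'n::finite hidx set \<Rightarrow> 'n ext" where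
  "basis_ext S \<equiv> axis S 1"

definition ext_of_lie :: "'n::finite lie \<Rightarrow> 'n ext" where
  "ext_of_lie v = (\<Sum>i\<in>UNIV. v $ i *\<^sub>R basis_ext {i})"

definition wedge_list :: "'n::{finite,linorder} lie list \<Rightarrow> 'n ext" where
  "wedge_list vs = foldr (\<lambda>v w. ext_of_lie v \<^bold>\<and> w) vs (basis_ext {})"

definition hodge :: "'n::{finite,linorder} ext \<Rightarrow> 'n ext" where
  "hodge v = (\<Sum>S\<in>UNIV. v $ S *\<^sub>R (shuffle_sign S (- S) *\<^sub>R basis_ext (- S)))"

definition graded :: "nat \<Rightarrow> 'n::finite ext set" where
  "graded k = {a. \<forall>S. a $ S \<noteq> 0 \<longrightarrow> card S = k}"

definition horizontal_graded :: "nat \<Rightarrow> 'n::finite ext set" where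
  "horizontal_graded k = {a \<in> graded k. \<forall>S. It \<in> S \<longrightarrow> a $ S = 0}"

definition horizontal_part :: "'n::finite ext \<Rightarrow> 'n ext" where
  "horizontal_part a = (\<chi> S. if It \<in> S then 0 else a $ S)"

definition theta :: "'n::finite ext" where
  "theta = basis_ext {It}"

definition dtheta :: "'n::{finite,linorder} ext" where
  "dtheta = - (\<Sum>j\<in>UNIV. basis_ext {Ix j} \<^bold>\<and> basis_ext {Iy j})"


section \<open>Smooth forms and the Rumin complex\<close>

fun iter_deriv :: "'a::real_normed_vector list \<Rightarrow> ('a \<Rightarrow> 'b::real_normed_vector) \<Rightarrow> 'a \<Rightarrow> 'b" where
  "iter_deriv [] g = g"
| "iter_deriv (v # vs) g = (\<lambda>p. frechet_derivative (iter_deriv vs g) (at p) v)"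

text \<open>Meaningful for open sets only.\<close>

definition smooth_on :: "'a::real_normed_vector set \<Rightarrow> ('a \<Rightarrow> 'b::real_normed_vector) \<Rightarrow> bool" where
  "smooth_on V g \<longleftrightarrow> (\<forall>vs. \<forall>p\<in>V. iter_deriv vs g differentiable (at p))"

text \<open>Differential forms are given by their coefficients in the left invariant coframe \<open>dw\<^sub>S\<close>.\<close>

type_synonym 'n form = "'n hpoint \<Rightarrow> 'n ext"

text \<open>\<open>d(dw\<^sub>S)\<close>: the \<open>dx\<^sub>j\<close> and \<open>dy\<^sub>j\<close> are closed and \<open>dw\<^sub>S = dw\<^bsub>S - {It}\<^esub> \<and> \<theta>\<close> if \<open>It \<in> S\<close>.\<close>

definition d_basis :: "'n::{finite,linorder} hidx set \<Rightarrow> 'n ext" where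
  "d_basis S = (if It \<in> S
     then (- 1) ^ card (S - {It}) *\<^sub>R (basis_ext (S - {It}) \<^bold>\<and> dtheta) else 0)"

text \<open>\<open>d(\<Sum>\<^sub>S \<omega>\<^sub>S dw\<^sub>S) = \<Sum>\<^sub>S (\<Sum>\<^sub>i (W\<^sub>i \<omega>\<^sub>S) dw\<^sub>i \<and> dw\<^sub>S + \<omega>\<^sub>S d(dw\<^sub>S))\<close>\<close>

definition ext_d :: "'n::{finite,linorder} form \<Rightarrow> 'n form" where
  "ext_d \<omega> p =
     (\<Sum>i\<in>UNIV. basis_ext {i} \<^bold>\<and> frechet_derivative \<omega> (at p) (frame i p))
     + (\<Sum>S\<in>UNIV. \<omega> p $ S *\<^sub>R d_basis S)"

text \<open>The fibres of \<open>I\<^sup>k\<close> and \<open>J\<^sup>k\<close>; they do not depend on the point, since coefficients are taken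
  in the left invariant coframe.\<close>

definition fibre_I :: "nat \<Rightarrow> 'n::{finite,linorder} ext set" where
  "fibre_I k = {a \<^bold>\<and> theta + b \<^bold>\<and> dtheta | a b.
     (\<forall>S. a $ S \<noteq> 0 \<longrightarrow> card S + 1 = k) \<and> (\<forall>S. b $ S \<noteq> 0 \<longrightarrow> card S + 2 = k)}"

definition fibre_J :: "nat \<Rightarrow> 'n::{finite,linorder} ext set" where
  "fibre_J k = {a \<in> graded k. a \<^bold>\<and> theta = 0 \<and> a \<^bold>\<and> dtheta = 0}"

text \<open>A Rumin covector of degree \<open>k\<close> is an element of \<open>rumin_fibre k\<close> modulo \<open>rumin_null k\<close>.\<close>

definition rumin_fibre :: "nat \<Rightarrow> 'n::{finite,linorder} ext set" where
  "rumin_fibre k = (if k \<le> CARD('n) then graded k else fibre_J k)"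

definition rumin_null :: "nat \<Rightarrow> 'n::{finite,linorder} ext set" where
  "rumin_null k = (if k \<le> CARD('n) then fibre_I k else {0})"

definition form_support :: "'n::finite form \<Rightarrow> 'n hpoint set" where
  "form_support \<omega> = closure {p. \<omega> p \<noteq> 0}"

text \<open>Elements of \<open>rumin_test k U\<close> are compactly supported representatives of the Rumin test
  forms; for \<open>k \<le> n\<close> two of them are the same test form if their difference is everywhere in
  \<open>rumin_null k\<close>. Accordingly, \<open>rumin_support\<close> is the support of the section of the quotient.\<close>

definition rumin_test :: "nat \<Rightarrow> 'n::{finite,linorder} hpoint set \<Rightarrow> 'n form set" where
  "rumin_test k U = {\<omega>. smooth_on UNIV \<omega> \<and> (\<forall>p. \<omega> p \<in> rumin_fibre k) \<and>
     compact (form_support \<omega>) \<and> form_support \<omega> \<subseteq> U}"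

definition rumin_equiv :: "nat \<Rightarrow> 'n::{finite,linorder} form \<Rightarrow> 'n form \<Rightarrow> bool" where
  "rumin_equiv k \<omega> \<eta> \<longleftrightarrow> (\<forall>p. \<omega> p - \<eta> p \<in> rumin_null k)"

definition rumin_support :: "nat \<Rightarrow> 'n::{finite,linorder} form \<Rightarrow> 'n hpoint set" where
  "rumin_support k \<omega> = closure {p. \<omega> p \<notin> rumin_null k}"

definition lefschetz_inv :: "'n::{finite,linorder} ext \<Rightarrow> 'n ext" where
  "lefschetz_inv = inv_into (horizontal_graded (CARD('n) - 1)) (\<lambda>\<beta>. dtheta \<^bold>\<and> \<beta>)"

definition rumin_L :: "'n::{finite,linorder} form \<Rightarrow> 'n form" where
  "rumin_L \<alpha> p = lefschetz_inv (- horizontal_part (ext_d \<alpha> p))"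

text \<open>In degree \<open>n\<close>, \<open>\<theta>\<close> is put on the left of \<open>\<L>(\<alpha>)\<close>: the horizontal part of
  \<open>d(\<theta> \<and> \<L>(\<alpha>))\<close> is \<open>d\<theta> \<and> \<L>(\<alpha>)\<close>, which cancels that of \<open>d\<alpha>\<close>, as is needed for
  a value in \<open>J\<close> that depends on the class of \<open>\<alpha>\<close> only. With \<open>\<L>(\<alpha>) \<and> \<theta> = (-1)\<^sup>n\<^sup>-\<^sup>1 \<theta> \<and> \<L>(\<alpha>)\<close>
  instead, this would fail for even \<open>n\<close>.\<close>

definition rumin_d :: "nat \<Rightarrow> 'n::{finite,linorder} form \<Rightarrow> 'n form" where
  "rumin_d k \<alpha> = (if k = CARD('n) then ext_d (\<lambda>p. \<alpha> p + theta \<^bold>\<and> rumin_L \<alpha> p) else ext_d \<alpha>)"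


section \<open>Currents\<close>

text \<open>Convergence in the space of test forms. A linear functional on this space is continuous
  iff it is sequentially continuous.\<close>

definition test_converges ::
  "'n::{finite,linorder} hpoint set \<Rightarrow> (nat \<Rightarrow> 'n form) \<Rightarrow> 'n form \<Rightarrow> bool" where
  "test_converges U \<omega>s \<omega> \<longleftrightarrow>
     (\<exists>K. compact K \<and> K \<subseteq> U \<and> (\<forall>m. form_support (\<omega>s m) \<subseteq> K)) \<and>
     (\<forall>vs. uniform_limit UNIV (\<lambda>m. iter_deriv vs (\<omega>s m)) (iter_deriv vs \<omega>) sequentially)"

type_synonym 'n functional = "'n form \<Rightarrow> real"

text \<open>Functionals on the quotient are functionals on representatives that respect
  \<open>rumin_equiv\<close>. Only the values on \<open>rumin_test k U\<close> are significant.\<close>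

definition currents :: "nat \<Rightarrow> 'n::{finite,linorder} hpoint set \<Rightarrow> 'n functional set" where
  "currents k U = {T.
     (\<forall>\<omega>\<in>rumin_test k U. \<forall>\<eta>\<in>rumin_test k U. T (\<lambda>p. \<omega> p + \<eta> p) = T \<omega> + T \<eta>) \<and>
     (\<forall>c. \<forall>\<omega>\<in>rumin_test k U. T (\<lambda>p. c *\<^sub>R \<omega> p) = c * T \<omega>) \<and>
     (\<forall>\<omega>\<in>rumin_test k U. \<forall>\<eta>\<in>rumin_test k U. rumin_equiv k \<omega> \<eta> \<longrightarrow> T \<omega> = T \<eta>) \<and>
     (\<forall>\<omega>s. \<forall>\<omega>\<in>rumin_test k U. (\<forall>m. \<omega>s m \<in> rumin_test k U) \<and> test_converges U \<omega>s \<omega>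
        \<longrightarrow> (\<lambda>m. T (\<omega>s m)) \<longlonglongrightarrow> T \<omega>)}"

definition current_eq ::
  "nat \<Rightarrow> 'n::{finite,linorder} hpoint set \<Rightarrow> 'n functional \<Rightarrow> 'n functional \<Rightarrow> bool" where
  "current_eq k U S T \<longleftrightarrow> (\<forall>\<omega>\<in>rumin_test k U. S \<omega> = T \<omega>)"

text \<open>The boundary of a \<open>k\<close>-current, a \<open>(k - 1)\<close>-current. For \<open>k = 0\<close> it is the zero functional,
  formally of degree \<open>0 - 1 = 0\<close>.\<close>

definition boundary :: "nat \<Rightarrow> 'n::{finite,linorder} functional \<Rightarrow> 'n functional" where
  "boundary k T \<omega> = (if k = 0 then 0 else T (rumin_d (k - 1) \<omega>))"

definition current_support ::
  "nat \<Rightarrow> 'n::{finite,linorder} hpoint set \<Rightarrow> 'n functional \<Rightarrow> 'n hpoint set" where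
  "current_support k U T = U - \<Union>{V. open V \<and> V \<subseteq> U \<and>
     (\<forall>\<omega>\<in>rumin_test k U. rumin_support k \<omega> \<subseteq> V \<longrightarrow> T \<omega> = 0)}"


section \<open>Mass and representability\<close>

text \<open>\<open>D\<close> is integrable if through every point \<open>p\<close> there passes an integral manifold, given by a
  parametrisation \<open>\<phi>\<close> on a neighbourhood of \<open>0\<close> in the vector space \<open>D p\<close>. It is an immersion if
  the rank of \<open>D\<close> is constant.\<close>

definition integrable_distribution ::
  "('n::finite hpoint \<Rightarrow> 'n hpoint set) \<Rightarrow> bool" where
  "integrable_distribution D \<longleftrightarrow> (\<forall>p. \<exists>V \<phi>. open V \<and> 0 \<in> V \<and> smooth_on V \<phi> \<and> \<phi> 0 = p \<and>
     (\<forall>u\<in>V \<inter> D p. frechet_derivative \<phi> (at u) ` D p = D (\<phi> u)))"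

text \<open>The scalar factor \<open>c\<close> only matters for \<open>k = 0\<close>, where all scalars are simple.\<close>

definition horizontal_simple_integrable :: "nat \<Rightarrow> 'n::{finite,linorder} ext set" where
  "horizontal_simple_integrable k = {c *\<^sub>R wedge_list vs | c vs.
     length vs = k \<and> set vs \<subseteq> lie1 \<and>
     integrable_distribution (\<lambda>p. span ((\<lambda>v. left_inv_field v p) ` set vs))}"

definition simple_integrable :: "nat \<Rightarrow> 'n::{finite,linorder} ext set" where
  "simple_integrable k = (if k \<le> CARD('n) then horizontal_simple_integrable k
     else hodge ` horizontal_simple_integrable (2 * CARD('n) + 1 - k))"

definition H_multivectors :: "nat \<Rightarrow> 'n::{finite,linorder} ext set" where
  "H_multivectors k = span (simple_integrable k)"

definition comass :: "nat \<Rightarrow> 'n::{finite,linorder} ext \<Rightarrow> real" where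
  "comass k a = Sup {a \<bullet> v | v. v \<in> simple_integrable k \<and> norm v = 1}"

definition dual_comass :: "nat \<Rightarrow> 'n::{finite,linorder} ext \<Rightarrow> real" where
  "dual_comass k v = Sup {a \<bullet> v | a. a \<in> rumin_fibre k \<and> comass k a \<le> 1}"

definition mass :: "nat \<Rightarrow> 'n::{finite,linorder} hpoint set \<Rightarrow> 'n functional \<Rightarrow> ereal" where
  "mass k U T = (SUP \<omega>\<in>{\<omega> \<in> rumin_test k U. \<forall>p\<in>U. comass k (\<omega> p) \<le> 1}. ereal (T \<omega>))"

text \<open>Regularity is automatic for locally finite Borel measures on an open subset of a Euclidean
  space.\<close>

definition radon_measure_on :: "'a::euclidean_space set \<Rightarrow> 'a measure \<Rightarrow> bool" where
  "radon_measure_on U \<mu> \<longleftrightarrow> sets \<mu> = sets (restrict_space borel U) \<and>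
     (\<forall>K. compact K \<and> K \<subseteq> U \<longrightarrow> emeasure \<mu> K < \<infinity>)"

definition represented_by :: "nat \<Rightarrow> 'n::{finite,linorder} hpoint set \<Rightarrow> 'n functional
    \<Rightarrow> 'n hpoint measure \<times> ('n hpoint \<Rightarrow> 'n ext) \<Rightarrow> bool" where
  "represented_by k U T = (\<lambda>(\<mu>, \<tau>). radon_measure_on U \<mu> \<and> \<tau> \<in> borel_measurable \<mu> \<and>
     (\<forall>p\<in>U. \<tau> p \<in> H_multivectors k) \<and> (AE p in \<mu>. dual_comass k (\<tau> p) = 1) \<and>
     (\<forall>\<omega>\<in>rumin_test k U. T \<omega> = (LINT p|\<mu>. \<omega> p \<bullet> \<tau> p)))"

text \<open>The measure is determined by the current, the orienting field up to null sets. Both are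
  meaningful only for currents that are representable by integration.\<close>

definition current_measure ::
  "nat \<Rightarrow> 'n::{finite,linorder} hpoint set \<Rightarrow> 'n functional \<Rightarrow> 'n hpoint measure" where
  "current_measure k U T = fst (SOME r. represented_by k U T r)"

definition current_vector ::
  "nat \<Rightarrow> 'n::{finite,linorder} hpoint set \<Rightarrow> 'n functional \<Rightarrow> 'n hpoint \<Rightarrow> 'n ext" where
  "current_vector k U T = snd (SOME r. represented_by k U T r)"

definition current_restrict :: "nat \<Rightarrow> 'n::{finite,linorder} hpoint set \<Rightarrow> 'n functional
    \<Rightarrow> 'n hpoint set \<Rightarrow> 'n functional" where
  "current_restrict k U S A \<omega> =
     (LINT p : U \<inter> A | current_measure k U S. \<omega> p \<bullet> current_vector k U S p)"

definition normal_currents ::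
  "nat \<Rightarrow> 'n::{finite,linorder} hpoint set \<Rightarrow> 'n functional set" where
  "normal_currents k U = {T \<in> currents k U. compact (current_support k U T) \<and>
     mass k U T + mass (k - 1) U (boundary k T) < \<infinity>}"


section \<open>Slices\<close>

definition slice_plus :: "nat \<Rightarrow> 'n::{finite,linorder} hpoint set \<Rightarrow> 'n functional
    \<Rightarrow> ('n hpoint \<Rightarrow> real) \<Rightarrow> real \<Rightarrow> 'n functional" where
  "slice_plus k U T f t \<omega> =
     current_restrict (k - 1) U (boundary k T) {p \<in> U. f p > t} \<omega>
     - boundary k (current_restrict k U T {p \<in> U. f p > t}) \<omega>"

definition slice_minus :: "nat \<Rightarrow> 'n::{finite,linorder} hpoint set \<Rightarrow> 'n functional
    \<Rightarrow> ('n hpoint \<Rightarrow> real) \<Rightarrow> real \<Rightarrow> 'n functional" where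
  "slice_minus k U T f t \<omega> =
     boundary k (current_restrict k U T {p \<in> U. f p < t}) \<omega>
     - current_restrict (k - 1) U (boundary k T) {p \<in> U. f p < t} \<omega>"

end

theory Submission
  imports Defs
begin

text \<open>The measure and the orienting field of a current are chosen by \<open>SOME\<close>, so the substance is
  that every linear functional of finite mass on Rumin test forms is representable. Its coefficients
  are functionals on \<open>C\<^sub>c\<^sup>\<infinity>(U)\<close> bounded in the sup norm, and these are differences of finite
  Borel measures: the content \<open>sup {L \<phi>. 0 \<le> \<phi> \<le> 1, spt \<phi> \<subseteq> V}\<close> of open sets generates a measure,
  and slicing \<open>\<phi>\<close> into a smooth staircase compares \<open>L \<phi>\<close> with its integral. Dividing the resulting
  vector density by its dual comass gives the orienting field.

  The density of \<open>T\<close> annihilates \<open>I\<^sup>k\<close> almost everywhere since \<open>T\<close> does, and likewise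
  for \<open>\<partial>T\<close>, because \<open>d\<^sub>c\<close> maps \<open>I\<^sup>k\<close> to \<open>I\<^sup>k\<^sup>+\<^sup>1\<close> (to \<open>0\<close> if \<open>k = n\<close>). Hence restrictions only see the
  support of the class of a form, which gives the inclusion of supports. The boundary formula is \<open>d\<^sub>c d\<^sub>c = 0\<close>,
  and the two slices agree at every level that neither measure charges.\<close>

section \<open>Smooth functions\<close>

text \<open>Finite mass controls pairings with simple integrable multivectors only, while an
  orienting field must take values in their span. The link: a form that pairs to zero with all of
  them has comass 0 at every scale, so a functional of finite mass kills it. The functional thus
  factors through the pairing with \<open>H_multivectors k\<close>, and a finite dual system of
  covectors and multivectors turns it into scalar functionals. Facts about restrictions are proved
  for an arbitrary representing pair, because nothing else is known about the one that
  \<open>SOME\<close> picks.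

  The other obstacle is degree n, where \<open>rumin_d\<close> is a second order operator built from
  an inverse that is meaningful on horizontal covectors of degree n + 1 only. The Lefschetz
  isomorphism, obtained from an adjoint and a commutator, replaces that inverse by a linear map.
  That \<open>rumin_d\<close> respects classes in this degree rests on an explicit primitive: the
  lift of A theta + B dtheta is the exterior derivative of theta B (wedge products). Since the slice
  of the boundary restricts the boundary of the boundary, three functionals have to be
  represented.\<close>

abbreviation smooth :: "('a::real_normed_vector \<Rightarrow> 'b::real_normed_vector) \<Rightarrow> bool" where
  "smooth \<equiv> smooth_on UNIV"

abbreviation dir_deriv :: "'a::real_normed_vector \<Rightarrow> ('a \<Rightarrow> 'b::real_normed_vector) \<Rightarrow> 'a \<Rightarrow> 'b" where
  "dir_deriv v g \<equiv> (\<lambda>p. frechet_derivative g (at p) v)"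

text \<open>Smoothness is the largest class of differentiable maps that is closed under directional
  derivatives, so one such class containing \<open>g\<close> suffices. The closure properties below
  each exhibit a class, enlarged to finite sums where a product rule produces them.\<close>

lemma smooth_coinduct [consumes 1, case_names differentiable dir_deriv]:
  assumes "P g"
    and diff: "\<And>g p. P g \<Longrightarrow> g differentiable (at p)"
    and deriv: "\<And>g v. P g \<Longrightarrow> P (dir_deriv v g)"
  shows "smooth g"
proof -
  have "P (iter_deriv vs g)" for vs
    using \<open>P g\<close> by (induction vs) (auto intro: deriv)
  then show ?thesis
    by (auto simp: smooth_on_def intro: diff)
qed

lemma smooth_imp_differentiable: "smooth g \<Longrightarrow> g differentiable (at p)"
  unfolding smooth_on_def by (metis UNIV_I iter_deriv.simps(1))

text \<open>\<open>iter_deriv\<close> applies the head of its list last, so a derivative taken first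
  belongs at the end.\<close>

lemma iter_deriv_snoc: "iter_deriv vs (dir_deriv v g) = iter_deriv (vs @ [v]) g"
  by (induction vs) auto

lemma smooth_dir_deriv: "smooth g \<Longrightarrow> smooth (dir_deriv v g)"
  by (simp add: smooth_on_def iter_deriv_snoc)

lemma smooth_has_derivative:
  "smooth g \<Longrightarrow> (g has_derivative (\<lambda>v. dir_deriv v g p)) (at p)"
  using smooth_imp_differentiable frechet_derivative_works by blast

lemma smooth_continuous_on: "smooth g \<Longrightarrow> continuous_on S g"
  by (meson continuous_at_imp_continuous_on differentiable_imp_continuous_within
      smooth_imp_differentiable)

lemma dir_deriv_eqI: "(\<And>p. (g has_derivative (\<lambda>v. g' v p)) (at p)) \<Longrightarrow> dir_deriv v g = g' v"
  by (rule ext) (metis frechet_derivative_at)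

lemma smooth_const [simp]: "smooth (\<lambda>p. c)"
  by (rule smooth_coinduct[where P = "\<lambda>g. \<exists>c. g = (\<lambda>p. c)"]) auto

lemma smooth_add:
  fixes f g :: "'a::real_normed_vector \<Rightarrow> 'b::real_normed_vector"
  assumes "smooth f" "smooth g"
  shows "smooth (\<lambda>p. f p + g p)"
proof (rule smooth_coinduct[where P = "\<lambda>h. \<exists>f g. smooth f \<and> smooth g \<and> h = (\<lambda>p. f p + g p)"])
  show "\<exists>f' g'. smooth f' \<and> smooth g' \<and> (\<lambda>p. f p + g p) = (\<lambda>p. f' p + g' p)"
    using assms by blast
next
  fix h :: "'a \<Rightarrow> 'b" and p :: 'a
  assume "\<exists>f g. smooth f \<and> smooth g \<and> h = (\<lambda>p. f p + g p)"
  then show "h differentiable (at p)"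
    by (auto intro: differentiable_add smooth_imp_differentiable)
next
  fix h :: "'a \<Rightarrow> 'b" and v :: 'a
  assume "\<exists>f g. smooth f \<and> smooth g \<and> h = (\<lambda>p. f p + g p)"
  then obtain f g where *: "smooth f" "smooth g" "h = (\<lambda>p. f p + g p)" by blast
  then have "dir_deriv v h = (\<lambda>p. dir_deriv v f p + dir_deriv v g p)"
    by (intro dir_deriv_eqI) (auto intro!: has_derivative_add smooth_has_derivative)
  then show "\<exists>f g. smooth f \<and> smooth g \<and> dir_deriv v h = (\<lambda>p. f p + g p)"
    using * smooth_dir_deriv by blast
qed

lemma smooth_bounded_linear:
  fixes L :: "'b::real_normed_vector \<Rightarrow> 'c::real_normed_vector"
    and f :: "'a::real_normed_vector \<Rightarrow> 'b"
  assumes "bounded_linear L" "smooth f"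
  shows "smooth (\<lambda>p. L (f p))"
proof (rule smooth_coinduct[where P = "\<lambda>h. \<exists>f. smooth f \<and> h = (\<lambda>p. L (f p))"])
  show "\<exists>f'. smooth f' \<and> (\<lambda>p. L (f p)) = (\<lambda>p. L (f' p))"
    using assms by blast
next
  fix h :: "'a \<Rightarrow> 'c" and p :: 'a
  assume "\<exists>f. smooth f \<and> h = (\<lambda>p. L (f p))"
  then show "h differentiable (at p)"
    using bounded_linear.has_derivative[OF assms(1) smooth_has_derivative]
    by (auto simp: differentiable_def)
next
  fix h :: "'a \<Rightarrow> 'c" and v :: 'a
  assume "\<exists>f. smooth f \<and> h = (\<lambda>p. L (f p))"
  then obtain f where *: "smooth f" "h = (\<lambda>p. L (f p))" by blast
  then have "dir_deriv v h = (\<lambda>p. L (dir_deriv v f p))"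
    by (intro dir_deriv_eqI)
      (auto intro!: bounded_linear.has_derivative[OF assms(1)] smooth_has_derivative)
  then show "\<exists>f. smooth f \<and> dir_deriv v h = (\<lambda>p. L (f p))"
    using * smooth_dir_deriv by blast
qed

text \<open>The product rule turns one product into a sum of two, so the class for coinduction must
  contain all finite sums of such products.\<close>

inductive bilin_sum :: "('b::real_normed_vector \<Rightarrow> 'c::real_normed_vector \<Rightarrow> 'd::real_normed_vector) \<Rightarrow>
    ('a::real_normed_vector \<Rightarrow> 'd) \<Rightarrow> bool" for B where
  bilin_sum_prod: "smooth f \<Longrightarrow> smooth g \<Longrightarrow> bilin_sum B (\<lambda>p. B (f p) (g p))"
| bilin_sum_add: "bilin_sum B h1 \<Longrightarrow> bilin_sum B h2 \<Longrightarrow> bilin_sum B (\<lambda>p. h1 p + h2 p)"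

lemma smooth_bilinear:
  fixes B :: "'b::real_normed_vector \<Rightarrow> 'c::real_normed_vector \<Rightarrow> 'd::real_normed_vector"
    and f :: "'a::real_normed_vector \<Rightarrow> 'b"
  assumes B: "bounded_bilinear B" and "smooth f" "smooth g"
  shows "smooth (\<lambda>p. B (f p) (g p))"
proof -
  have *: "(\<forall>p. h differentiable (at p)) \<and> (\<forall>v. bilin_sum B (dir_deriv v h))"
    if "bilin_sum B h" for h :: "'a \<Rightarrow> 'd"
    using that
  proof induction
    case (bilin_sum_prod f g)
    have D: "((\<lambda>p. B (f p) (g p)) has_derivative
        (\<lambda>v. B (f p) (dir_deriv v g p) + B (dir_deriv v f p) (g p))) (at p)" for p
      using bilin_sum_prod by (intro bounded_bilinear.FDERIV[OF B] smooth_has_derivative)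
    then have "dir_deriv v (\<lambda>p. B (f p) (g p)) =
        (\<lambda>p. B (f p) (dir_deriv v g p) + B (dir_deriv v f p) (g p))" for v
      by (rule dir_deriv_eqI)
    then show ?case
      using D bilin_sum_prod
      by (auto simp: differentiable_def
          intro!: bilin_sum.bilin_sum_prod bilin_sum_add smooth_dir_deriv)
  next
    case (bilin_sum_add h1 h2)
    then have "dir_deriv v (\<lambda>p. h1 p + h2 p) = (\<lambda>p. dir_deriv v h1 p + dir_deriv v h2 p)" for v
      by (intro dir_deriv_eqI) (auto intro!: has_derivative_add simp flip: frechet_derivative_works)
    then show ?case
      using bilin_sum_add by (auto intro: bilin_sum.bilin_sum_add)
  qed
  show ?thesis
    by (rule smooth_coinduct[where P = "bilin_sum B"])
      (use * assms in \<open>auto intro: bilin_sum_prod\<close>)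
qed

lemma smooth_mult:
  fixes f g :: "'a::real_normed_vector \<Rightarrow> real"
  shows "smooth f \<Longrightarrow> smooth g \<Longrightarrow> smooth (\<lambda>p. f p * g p)"
  by (rule smooth_bilinear[OF bounded_bilinear_mult])

lemma smooth_scaleR: "smooth f \<Longrightarrow> smooth g \<Longrightarrow> smooth (\<lambda>p. f p *\<^sub>R g p)"
  by (rule smooth_bilinear[OF bounded_bilinear_scaleR])

lemma smooth_ident: "smooth (\<lambda>p. p)"
proof (rule smooth_coinduct[where P = "\<lambda>g. g = (\<lambda>p. p) \<or> (\<exists>c. g = (\<lambda>p. c))"])
  fix g :: "'a \<Rightarrow> 'a" and v :: 'a
  assume "g = (\<lambda>p. p) \<or> (\<exists>c. g = (\<lambda>p. c))"
  then show "dir_deriv v g = (\<lambda>p. p) \<or> (\<exists>c. dir_deriv v g = (\<lambda>p. c))"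
    by auto
qed auto

lemma smooth_linear: "bounded_linear L \<Longrightarrow> smooth L"
  using smooth_bounded_linear[OF _ smooth_ident] .

lemma smooth_uminus: "smooth f \<Longrightarrow> smooth (\<lambda>p. - f p)"
  using smooth_bounded_linear[OF bounded_linear_minus[OF bounded_linear_ident]] .

lemma smooth_diff: "smooth f \<Longrightarrow> smooth g \<Longrightarrow> smooth (\<lambda>p. f p - g p)"
  using smooth_add[OF _ smooth_uminus] by force

lemma smooth_sum: "(\<And>i. i \<in> I \<Longrightarrow> smooth (f i)) \<Longrightarrow> smooth (\<lambda>p. \<Sum>i\<in>I. f i p)"
  by (induction I rule: infinite_finite_induct) (auto intro: smooth_add)

text \<open>The chain rule multiplies \<open>f (g p)\<close>, with \<open>f\<close> differentiated,
  by a derivative of \<open>g\<close>. Carrying an arbitrary smooth factor \<open>h\<close> absorbs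
  it and keeps the class closed.\<close>

inductive comp_sum :: "('a::real_normed_vector \<Rightarrow> real) \<Rightarrow> ('a \<Rightarrow> real) \<Rightarrow> bool" for g where
  comp_sum_prod: "smooth f \<Longrightarrow> smooth h \<Longrightarrow> comp_sum g (\<lambda>p. f (g p) * h p)"
| comp_sum_add: "comp_sum g h1 \<Longrightarrow> comp_sum g h2 \<Longrightarrow> comp_sum g (\<lambda>p. h1 p + h2 p)"

lemma smooth_compose:
  fixes f :: "real \<Rightarrow> real" and g :: "'a::real_normed_vector \<Rightarrow> real"
  assumes "smooth f" "smooth g"
  shows "smooth (\<lambda>p. f (g p))"
proof -
  have *: "(\<forall>p. h differentiable (at p)) \<and> (\<forall>v. comp_sum g (dir_deriv v h))"
    if "comp_sum g h" for h :: "'a \<Rightarrow> real"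
    using that
  proof induction
    case (comp_sum_prod f h)
    \<comment> \<open>In one dimension the derivative in direction \<open>x\<close> is
      \<open>x\<close> times the one in direction 1, which brings the chain rule into the shape that
      \<open>comp_sum\<close> requires.\<close>
    have lin: "dir_deriv x f y = x * dir_deriv 1 f y" for x y
      using linear_frechet_derivative[OF smooth_imp_differentiable[OF \<open>smooth f\<close>, of y]]
      by (metis linear_scale mult.right_neutral real_scaleR_def)
    have "((\<lambda>p. f (g p)) has_derivative (\<lambda>v. dir_deriv (dir_deriv v g p) f (g p))) (at p)" for p
      using has_derivative_compose[OF smooth_has_derivative[OF \<open>smooth g\<close>]
          smooth_has_derivative[OF comp_sum_prod(1)]] .
    moreover have "(\<lambda>v. dir_deriv (dir_deriv v g p) f (g p)) = (\<lambda>v. dir_deriv v g p * dir_deriv 1 f (g p))" for p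
      by (rule ext) (rule lin)
    ultimately have "((\<lambda>p. f (g p)) has_derivative (\<lambda>v. dir_deriv v g p * dir_deriv 1 f (g p))) (at p)" for p
      by metis
    then have D: "((\<lambda>p. f (g p) * h p) has_derivative
        (\<lambda>v. f (g p) * dir_deriv v h p + dir_deriv v g p * dir_deriv 1 f (g p) * h p)) (at p)" for p
      using comp_sum_prod by (intro has_derivative_mult smooth_has_derivative)
    then have "dir_deriv v (\<lambda>p. f (g p) * h p) =
        (\<lambda>p. f (g p) * dir_deriv v h p + dir_deriv v g p * dir_deriv 1 f (g p) * h p)" for v
      by (rule dir_deriv_eqI)
    moreover have "comp_sum g (\<lambda>p. f (g p) * dir_deriv v h p + dir_deriv 1 f (g p) * (dir_deriv v g p * h p))"
      for v
      using comp_sum_prod \<open>smooth g\<close>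
      by (intro comp_sum.intros smooth_mult) (auto intro: smooth_dir_deriv)
    ultimately show ?case
      using D by (auto simp: differentiable_def algebra_simps)
  next
    case (comp_sum_add h1 h2)
    then have "dir_deriv v (\<lambda>p. h1 p + h2 p) = (\<lambda>p. dir_deriv v h1 p + dir_deriv v h2 p)" for v
      by (intro dir_deriv_eqI) (auto intro!: has_derivative_add simp flip: frechet_derivative_works)
    then show ?case
      using comp_sum_add by (auto intro: comp_sum.comp_sum_add)
  qed
  have "comp_sum g (\<lambda>p. f (g p) * 1)"
    using assms by (intro comp_sum_prod) auto
  then show ?thesis
    using * by (intro smooth_coinduct[where P = "comp_sum g"]) auto
qed

inductive quot_sum :: "('a::real_normed_vector \<Rightarrow> real) \<Rightarrow> ('a \<Rightarrow> real) \<Rightarrow> bool" for u where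
  quot_sum_quot: "smooth h \<Longrightarrow> quot_sum u (\<lambda>p. h p / u p ^ n)"
| quot_sum_add: "quot_sum u h1 \<Longrightarrow> quot_sum u h2 \<Longrightarrow> quot_sum u (\<lambda>p. h1 p + h2 p)"

lemma smooth_divide:
  fixes h u :: "'a::real_normed_vector \<Rightarrow> real"
  assumes "smooth h" "smooth u" and u0: "\<And>p. u p \<noteq> 0"
  shows "smooth (\<lambda>p. h p / u p)"
proof -
  have *: "(\<forall>p. h differentiable (at p)) \<and> (\<forall>v. quot_sum u (dir_deriv v h))"
    if "quot_sum u h" for h :: "'a \<Rightarrow> real"
    using that
  proof induction
    case (quot_sum_quot h n)
    have D: "((\<lambda>p. h p / u p ^ n) has_derivative
        (\<lambda>v. dir_deriv v h p / u p ^ n + (- (real n * h p * dir_deriv v u p)) / u p ^ Suc n)) (at p)" for p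
    proof -
      have "((\<lambda>p. h p / u p ^ n) has_derivative
        (\<lambda>v. - h p * (inverse (u p ^ n) * (of_nat n * dir_deriv v u p * u p ^ (n - 1)) * inverse (u p ^ n))
          + dir_deriv v h p / u p ^ n)) (at p)"
        using u0[of p]
        by (intro has_derivative_divide has_derivative_power smooth_has_derivative quot_sum_quot \<open>smooth u\<close>) auto
      moreover have "- h p * (inverse (u p ^ n) * (of_nat n * dir_deriv v u p * u p ^ (n - 1)) * inverse (u p ^ n))
          + dir_deriv v h p / u p ^ n =
          dir_deriv v h p / u p ^ n + (- (real n * h p * dir_deriv v u p)) / u p ^ Suc n" for v
        using u0[of p] by (cases n) (auto simp: field_simps)
      ultimately show ?thesis by simp
    qed
    then have "dir_deriv v (\<lambda>p. h p / u p ^ n) =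
        (\<lambda>p. dir_deriv v h p / u p ^ n + (- (real n * h p * dir_deriv v u p)) / u p ^ Suc n)" for v
      by (rule dir_deriv_eqI)
    moreover have "quot_sum u (\<lambda>p. dir_deriv v h p / u p ^ n + (- (real n * h p * dir_deriv v u p)) / u p ^ Suc n)"
      for v
      using quot_sum_quot \<open>smooth u\<close>
      by (intro quot_sum.intros smooth_uminus smooth_mult) (auto intro: smooth_dir_deriv)
    ultimately show ?case
      using D by (auto simp: differentiable_def simp del: power_Suc)
  next
    case (quot_sum_add h1 h2)
    then have "dir_deriv v (\<lambda>p. h1 p + h2 p) = (\<lambda>p. dir_deriv v h1 p + dir_deriv v h2 p)" for v
      by (intro dir_deriv_eqI) (auto intro!: has_derivative_add simp flip: frechet_derivative_works)
    then show ?case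
      using quot_sum_add by (auto intro: quot_sum.quot_sum_add)
  qed
  have "quot_sum u (\<lambda>p. h p / u p ^ 1)"
    using assms by (intro quot_sum_quot) auto
  then show ?thesis
    using * by (intro smooth_coinduct[where P = "quot_sum u"]) auto
qed

section \<open>A smooth step and smooth cutoff functions\<close>

definition flat_exp :: "real poly \<Rightarrow> real \<Rightarrow> real" where
  "flat_exp q s = (if s > 0 then poly q (1 / s) * exp (- (1 / s)) else 0)"

lemma poly_exp_decay: "((\<lambda>x. poly q x * exp (- x)) \<longlongrightarrow> 0) at_top" for q :: "real poly"
proof -
  have "((\<lambda>x. \<Sum>i\<le>degree q. coeff q i * (x ^ i / exp x)) \<longlongrightarrow> (\<Sum>i\<le>degree q. coeff q i * 0)) at_top"
    by (intro tendsto_intros tendsto_power_div_exp_0)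
  moreover have "(\<Sum>i\<le>degree q. coeff q i * (x ^ i / exp x)) = poly q x * exp (- x)" for x
    by (simp add: poly_altdef sum_distrib_right exp_minus divide_inverse mult.assoc)
  ultimately show ?thesis by simp
qed

text \<open>With X = 1/s the derivative of q(X) exp(-X) is X^2 (q(X) - q'(X)) exp(-X), and
  \<open>[:0, 0, 1:]\<close> is the polynomial X^2. The polynomial parameter is there to make the
  family closed under differentiation.\<close>

lemma flat_exp_has_derivative:
  "(flat_exp q has_real_derivative flat_exp ([:0, 0, 1:] * (q - pderiv q)) s) (at s)"
proof -
  consider "s > 0" | "s < 0" | "s = 0" by linarith
  then show ?thesis
  proof cases
    case 1
    have "((\<lambda>s. poly q (1 / s) * exp (- (1 / s))) has_real_derivative
        poly q (1 / s) * (exp (- (1 / s)) * (1 / s\<^sup>2)) + poly (pderiv q) (1 / s) * (- (1 / s\<^sup>2)) * exp (- (1 / s))) (at s)"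
      using 1 by (auto intro!: derivative_eq_intros DERIV_chain2[OF poly_DERIV] simp: power2_eq_square)
    moreover have "poly q (1 / s) * (exp (- (1 / s)) * (1 / s\<^sup>2)) + poly (pderiv q) (1 / s) * (- (1 / s\<^sup>2)) * exp (- (1 / s))
       = flat_exp ([:0, 0, 1:] * (q - pderiv q)) s"
      using 1 by (simp add: flat_exp_def field_simps power2_eq_square)
    ultimately have "((\<lambda>s. poly q (1 / s) * exp (- (1 / s))) has_real_derivative
        flat_exp ([:0, 0, 1:] * (q - pderiv q)) s) (at s)" by simp
    then show ?thesis
      by (rule has_field_derivative_transform_within_open[of _ _ _ "{0<..}"])
        (use 1 in \<open>auto simp: flat_exp_def\<close>)
  next
    case 2
    have "((\<lambda>s. 0) has_real_derivative 0) (at s)" by simp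
    then have "(flat_exp q has_real_derivative 0) (at s)"
      by (rule has_field_derivative_transform_within_open[of _ _ _ "{..<0}"])
        (use 2 in \<open>auto simp: flat_exp_def\<close>)
    then show ?thesis using 2 by (simp add: flat_exp_def)
  next
    case 3
    have "((\<lambda>h. flat_exp q h / h) \<longlongrightarrow> 0) (at_right 0)"
    proof -
      \<comment> \<open>With X = 1/h the right difference quotient at 0 is X q(X) exp(-X), and
        \<open>pCons 0 q\<close> is the polynomial X q(X).\<close>
      have "((\<lambda>h. poly (pCons 0 q) (inverse h) * exp (- inverse h)) \<longlongrightarrow> 0) (at_right 0)"
        by (rule filterlim_compose[OF poly_exp_decay filterlim_inverse_at_top_right])
      then show ?thesis
        by (rule tendsto_cong[THEN iffD1, rotated])
          (auto simp: eventually_at_right_field flat_exp_def field_simps intro!: exI[of _ 1])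
    qed
    moreover have "((\<lambda>h. flat_exp q h / h) \<longlongrightarrow> 0) (at_left 0)"
      by (rule tendsto_eventually) (auto simp: eventually_at_left_field flat_exp_def intro!: exI[of _ "-1"])
    ultimately have "((\<lambda>h. flat_exp q h / h) \<longlongrightarrow> 0) (at 0)"
      by (rule filterlim_split_at[rotated])
    then show ?thesis using 3 by (simp add: DERIV_def flat_exp_def)
  qed
qed

lemma smooth_flat_exp: "smooth (flat_exp q)"
proof (rule smooth_coinduct[where P = "\<lambda>g. \<exists>q. g = flat_exp q"])
  fix g :: "real \<Rightarrow> real" and p :: real
  assume "\<exists>q. g = flat_exp q"
  then show "g differentiable (at p)"
    using flat_exp_has_derivative by (meson has_field_derivative_imp_has_derivative differentiableI)
next
  fix g :: "real \<Rightarrow> real" and v :: real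
  assume "\<exists>q. g = flat_exp q"
  then obtain q where g: "g = flat_exp q" by blast
  have "dir_deriv v g = (\<lambda>s. flat_exp ([:0, 0, 1:] * (q - pderiv q)) s * v)"
    unfolding g by (rule dir_deriv_eqI)
      (use flat_exp_has_derivative has_field_derivative_imp_has_derivative in blast)
  also have "\<dots> = flat_exp (smult v ([:0, 0, 1:] * (q - pderiv q)))"
    by (auto simp: flat_exp_def fun_eq_iff)
  finally show "\<exists>q. dir_deriv v g = flat_exp q" by blast
qed auto

text \<open>It is 0 up to 1/4 and 1 from 1 on. The threshold 1/4 serves twice: with the squared
  ratio of distance to radius as argument it marks the ball of half the radius, and in the staircase
  it keeps the support of a step inside an open superlevel set.\<close>

definition smooth_step :: "real \<Rightarrow> real" where
  "smooth_step s = flat_exp 1 (s - 1/4) / (flat_exp 1 (s - 1/4) + flat_exp 1 (1 - s))"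

lemma flat_exp_nonneg: "0 \<le> flat_exp 1 s" and flat_exp_pos: "0 < s \<Longrightarrow> 0 < flat_exp 1 s"
  and flat_exp_zero: "s \<le> 0 \<Longrightarrow> flat_exp 1 s = 0"
  by (auto simp: flat_exp_def)

lemma flat_exp_sum_pos: "0 < flat_exp 1 (s - 1/4) + flat_exp 1 (1 - s)"
  using flat_exp_nonneg[of "s - 1/4"] flat_exp_nonneg[of "1 - s"]
    flat_exp_pos[of "s - 1/4"] flat_exp_pos[of "1 - s"]
  by (cases "s < 1") (auto intro: add_pos_nonneg add_nonneg_pos)

lemma smooth_step_zero: "s \<le> 1/4 \<Longrightarrow> smooth_step s = 0"
  by (simp add: smooth_step_def flat_exp_zero)

lemma smooth_step_one: "1 \<le> s \<Longrightarrow> smooth_step s = 1"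
  using flat_exp_pos[of "s - 1/4"] by (simp add: smooth_step_def flat_exp_zero[of "1 - s"])

lemma smooth_step_nonneg: "0 \<le> smooth_step s" and smooth_step_le_1: "smooth_step s \<le> 1"
  using flat_exp_sum_pos[of s] flat_exp_nonneg[of "s - 1/4"] flat_exp_nonneg[of "1 - s"]
  by (auto simp: smooth_step_def)

lemma smooth_smooth_step: "smooth smooth_step"
proof -
  have "smooth (\<lambda>s. flat_exp 1 (s - 1/4))" "smooth (\<lambda>s. flat_exp 1 (1 - s))"
    by (auto intro!: smooth_compose[OF smooth_flat_exp] smooth_diff smooth_ident)
  then have "smooth (\<lambda>s. flat_exp 1 (s - 1/4) / (flat_exp 1 (s - 1/4) + flat_exp 1 (1 - s)))"
    using flat_exp_sum_pos[THEN less_imp_neq] by (intro smooth_divide smooth_add) auto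
  then show ?thesis by (simp add: smooth_step_def[abs_def])
qed

text \<open>Bumps on finitely many balls are combined as 1 minus the product of the 1 - \<beta>,
  which stays in [0, 1] and is 1 as soon as one bump is. Having \<open>b\<close> equal to 1 on an
  open set around \<open>K\<close>, not on \<open>K\<close> alone, leaves a compact support after
  multiplication by 1 - \<open>b\<close>.\<close>

lemma smooth_urysohn:
  fixes K V :: "'a::euclidean_space set"
  assumes "compact K" "open V" "K \<subseteq> V"
  obtains b :: "'a \<Rightarrow> real" and N C where "smooth b" "\<And>p. 0 \<le> b p" "\<And>p. b p \<le> 1"
    "open N" "K \<subseteq> N" "\<And>p. p \<in> N \<Longrightarrow> b p = 1"
    "compact C" "C \<subseteq> V" "\<And>p. p \<notin> C \<Longrightarrow> b p = 0"
proof -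
  have "\<forall>x\<in>K. \<exists>r>0. cball x r \<subseteq> V"
    using assms by (meson open_contains_cball subsetD)
  then obtain r where r: "\<And>x. x \<in> K \<Longrightarrow> r x > 0 \<and> cball x (r x) \<subseteq> V" by metis
  have "K \<subseteq> (\<Union>x\<in>K. ball x (r x / 2))" using r by force
  then obtain F where F: "F \<subseteq> K" "finite F" "K \<subseteq> (\<Union>x\<in>F. ball x (r x / 2))"
    using compactE_image[OF assms(1), of K "\<lambda>x. ball x (r x / 2)"] by auto
  have "\<exists>b::'a \<Rightarrow> real. smooth b \<and> (\<forall>p. 0 \<le> b p \<and> b p \<le> 1) \<and> (\<forall>p\<in>(\<Union>x\<in>F. ball x (r x / 2)). b p = 1)
      \<and> (\<forall>p. p \<notin> (\<Union>x\<in>F. cball x (r x)) \<longrightarrow> b p = 0)"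
    using \<open>finite F\<close> \<open>F \<subseteq> K\<close>
  proof induction
    case empty
    show ?case by (intro exI[of _ "\<lambda>p. 0"]) auto
  next
    case (insert x F)
    then obtain b :: "'a \<Rightarrow> real" where "smooth b \<and> (\<forall>p. 0 \<le> b p \<and> b p \<le> 1) \<and> (\<forall>p\<in>(\<Union>x\<in>F. ball x (r x / 2)). b p = 1)
      \<and> (\<forall>p. p \<notin> (\<Union>x\<in>F. cball x (r x)) \<longrightarrow> b p = 0)"
      by blast
    then have b: "smooth b" "\<And>p. 0 \<le> b p \<and> b p \<le> 1"
      "\<And>p. p \<in> (\<Union>x\<in>F. ball x (r x / 2)) \<Longrightarrow> b p = 1" "\<And>p. p \<notin> (\<Union>x\<in>F. cball x (r x)) \<Longrightarrow> b p = 0"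
      by blast+
    have rx: "r x > 0" using r insert by auto
    define \<beta> where "\<beta> p = 1 - smooth_step ((p - x) \<bullet> (p - x) / (r x)\<^sup>2)" for p
    have "smooth (\<lambda>p. ((p - x) \<bullet> (p - x)) * (1 / (r x)\<^sup>2))"
      by (intro smooth_mult smooth_const smooth_bilinear[OF bounded_bilinear_inner] smooth_diff smooth_ident)
    then have \<beta>s: "smooth \<beta>"
      unfolding \<beta>_def[abs_def] by (intro smooth_diff smooth_const smooth_compose[OF smooth_smooth_step]) simp
    have \<beta>01: "0 \<le> \<beta> p \<and> \<beta> p \<le> 1" for p
      by (simp add: \<beta>_def smooth_step_nonneg smooth_step_le_1)
    have \<beta>1: "\<beta> p = 1" if "p \<in> ball x (r x / 2)" for p
    proof -
      have "norm (p - x) \<le> r x / 2" using that by (simp add: dist_norm norm_minus_commute)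
      then have "(norm (p - x))\<^sup>2 \<le> (r x / 2)\<^sup>2" by (intro power_mono) auto
      then have "(p - x) \<bullet> (p - x) / (r x)\<^sup>2 \<le> 1/4"
        using rx by (simp add: dot_square_norm power_divide field_simps)
      then show ?thesis by (simp add: \<beta>_def smooth_step_zero)
    qed
    have \<beta>0: "\<beta> p = 0" if "p \<notin> cball x (r x)" for p
    proof -
      have "norm (p - x) \<ge> r x" using that by (simp add: dist_norm norm_minus_commute)
      then have "(norm (p - x))\<^sup>2 \<ge> (r x)\<^sup>2" using rx by (intro power_mono) auto
      then have "(p - x) \<bullet> (p - x) / (r x)\<^sup>2 \<ge> 1"
        using rx by (simp add: dot_square_norm field_simps)
      then show ?thesis by (simp add: \<beta>_def smooth_step_one)
    qed
    have "1 - (1 - b p) * (1 - \<beta> p) \<le> 1" "0 \<le> 1 - (1 - b p) * (1 - \<beta> p)" for p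
      using b(2)[of p] \<beta>01[of p] by (auto intro: mult_le_one)
    moreover have "1 - (1 - b p) * (1 - \<beta> p) = 1" if "p \<in> (\<Union>x\<in>insert x F. ball x (r x / 2))" for p
      using that b(3)[of p] \<beta>1[of p] by (cases "p \<in> ball x (r x / 2)") auto
    moreover have "1 - (1 - b p) * (1 - \<beta> p) = 0" if "p \<notin> (\<Union>x\<in>insert x F. cball x (r x))" for p
      using that b(4)[of p] \<beta>0[of p] by auto
    moreover have "smooth (\<lambda>p. 1 - (1 - b p) * (1 - \<beta> p))"
      using b \<beta>s by (intro smooth_diff smooth_mult) auto
    ultimately show ?case
      by (intro exI[of _ "\<lambda>p. 1 - (1 - b p) * (1 - \<beta> p)"]) blast
  qed
  then obtain b :: "'a \<Rightarrow> real" where "smooth b \<and> (\<forall>p. 0 \<le> b p \<and> b p \<le> 1) \<and> (\<forall>p\<in>(\<Union>x\<in>F. ball x (r x / 2)). b p = 1)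
      \<and> (\<forall>p. p \<notin> (\<Union>x\<in>F. cball x (r x)) \<longrightarrow> b p = 0)"
    by blast
  then have b: "smooth b" "\<And>p. 0 \<le> b p" "\<And>p. b p \<le> 1"
      "\<And>p. p \<in> (\<Union>x\<in>F. ball x (r x / 2)) \<Longrightarrow> b p = 1" "\<And>p. p \<notin> (\<Union>x\<in>F. cball x (r x)) \<Longrightarrow> b p = 0"
    by blast+
  show ?thesis
  proof (rule that[OF b(1-3)])
    show "open (\<Union>x\<in>F. ball x (r x / 2))" "compact (\<Union>x\<in>F. cball x (r x))"
      using \<open>finite F\<close> by auto
    show "(\<Union>x\<in>F. cball x (r x)) \<subseteq> V" using F r by blast
  qed (use F b in auto)
qed

section \<open>Directional derivatives and their symmetry\<close>

lemma dir_deriv_bounded_linear: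
  "bounded_linear L \<Longrightarrow> smooth g \<Longrightarrow> dir_deriv v (\<lambda>p. L (g p)) = (\<lambda>p. L (dir_deriv v g p))"
  by (rule dir_deriv_eqI) (rule bounded_linear.has_derivative[OF _ smooth_has_derivative])

lemma dir_deriv_add:
  "smooth f \<Longrightarrow> smooth g \<Longrightarrow> dir_deriv v (\<lambda>p. f p + g p) = (\<lambda>p. dir_deriv v f p + dir_deriv v g p)"
  by (rule dir_deriv_eqI) (auto intro!: has_derivative_add smooth_has_derivative)

lemma dir_deriv_sum:
  "(\<And>i. i \<in> I \<Longrightarrow> smooth (f i)) \<Longrightarrow>
    dir_deriv v (\<lambda>p. \<Sum>i\<in>I. f i p) = (\<lambda>p. \<Sum>i\<in>I. dir_deriv v (f i) p)"
  by (rule dir_deriv_eqI) (auto intro!: has_derivative_sum smooth_has_derivative)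

lemma dir_deriv_scaleR:
  "smooth f \<Longrightarrow> smooth g \<Longrightarrow>
    dir_deriv v (\<lambda>p. f p *\<^sub>R g p) = (\<lambda>p. f p *\<^sub>R dir_deriv v g p + dir_deriv v f p *\<^sub>R g p)"
  by (rule dir_deriv_eqI) (auto intro!: has_derivative_scaleR smooth_has_derivative)

lemma linear_dir_deriv: "smooth g \<Longrightarrow> linear (\<lambda>v. dir_deriv v g p)"
  using linear_frechet_derivative smooth_imp_differentiable by blast

lemma smooth_deriv_along_line:
  fixes g :: "'a::real_normed_vector \<Rightarrow> real"
  assumes "smooth g"
  shows "((\<lambda>s. g (w + s *\<^sub>R u)) has_real_derivative dir_deriv u g (w + s *\<^sub>R u)) (at s)"
proof -
  have "((\<lambda>s. w + s *\<^sub>R u) has_derivative (\<lambda>x. x *\<^sub>R u)) (at s)"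
    by (auto intro!: derivative_eq_intros)
  then have "((\<lambda>s. g (w + s *\<^sub>R u)) has_derivative (\<lambda>x. dir_deriv (x *\<^sub>R u) g (w + s *\<^sub>R u))) (at s)"
    by (rule has_derivative_compose[OF _ smooth_has_derivative[OF assms]])
  moreover have "dir_deriv (x *\<^sub>R u) g (w + s *\<^sub>R u) = dir_deriv u g (w + s *\<^sub>R u) * x" for x
    using linear_scale[OF linear_dir_deriv[OF assms]] by (simp add: mult.commute)
  ultimately show ?thesis
    by (simp add: has_field_derivative_def)
qed

text \<open>The mean value theorem is applied twice: along \<open>u\<close> to the increment in
  direction \<open>v\<close>, then along \<open>v\<close>. The left side is symmetric in
  \<open>u\<close> and \<open>v\<close> while the right side is not, which is the source of the
  symmetry of second derivatives.\<close>

lemma second_difference_mvt: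
  fixes g :: "'a::real_normed_vector \<Rightarrow> real"
  assumes "smooth g" "0 < h"
  obtains q where "norm (q - p) \<le> h * (norm u + norm v)"
    "g (p + h *\<^sub>R u + h *\<^sub>R v) - g (p + h *\<^sub>R u) - g (p + h *\<^sub>R v) + g p = h\<^sup>2 * dir_deriv v (dir_deriv u g) q"
proof -
  have "((\<lambda>s. g (p + s *\<^sub>R u + h *\<^sub>R v)) has_real_derivative
      dir_deriv u g (p + s *\<^sub>R u + h *\<^sub>R v)) (at s)" for s
    using smooth_deriv_along_line[OF \<open>smooth g\<close>, of "p + h *\<^sub>R v" u s] by (simp add: add_ac)
  then have "((\<lambda>s. g (p + s *\<^sub>R u + h *\<^sub>R v) - g (p + s *\<^sub>R u)) has_real_derivative
      dir_deriv u g (p + s *\<^sub>R u + h *\<^sub>R v) - dir_deriv u g (p + s *\<^sub>R u)) (at s)" for s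
    by (intro DERIV_diff smooth_deriv_along_line \<open>smooth g\<close>)
  from MVT2[OF \<open>0 < h\<close> this] obtain s where s: "0 < s" "s < h"
    "g (p + h *\<^sub>R u + h *\<^sub>R v) - g (p + h *\<^sub>R u) - (g (p + h *\<^sub>R v) - g p) =
      h * (dir_deriv u g (p + s *\<^sub>R u + h *\<^sub>R v) - dir_deriv u g (p + s *\<^sub>R u))"
    by auto
  have "((\<lambda>t. dir_deriv u g (p + s *\<^sub>R u + t *\<^sub>R v)) has_real_derivative
      dir_deriv v (dir_deriv u g) (p + s *\<^sub>R u + t *\<^sub>R v)) (at t)" for t
    by (intro smooth_deriv_along_line smooth_dir_deriv \<open>smooth g\<close>)
  from MVT2[OF \<open>0 < h\<close> this] obtain t where t: "0 < t" "t < h"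
    "dir_deriv u g (p + s *\<^sub>R u + h *\<^sub>R v) - dir_deriv u g (p + s *\<^sub>R u) =
      h * dir_deriv v (dir_deriv u g) (p + s *\<^sub>R u + t *\<^sub>R v)"
    by auto
  show ?thesis
  proof (rule that)
    have "norm (s *\<^sub>R u + t *\<^sub>R v) \<le> s * norm u + t * norm v"
      using s t by (intro norm_triangle_le) simp
    also have "\<dots> \<le> h * norm u + h * norm v"
      using s t by (intro add_mono mult_right_mono) auto
    finally show "norm (p + s *\<^sub>R u + t *\<^sub>R v - p) \<le> h * (norm u + norm v)"
      by (simp add: algebra_simps)
    show "g (p + h *\<^sub>R u + h *\<^sub>R v) - g (p + h *\<^sub>R u) - g (p + h *\<^sub>R v) + g p =
        h\<^sup>2 * dir_deriv v (dir_deriv u g) (p + s *\<^sub>R u + t *\<^sub>R v)"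
      using s(3)[unfolded t(3)] by (simp add: power2_eq_square)
  qed
qed

text \<open>The two orders of differentiation, evaluated at two points that both converge to
  \<open>p\<close>, equal the same second difference quotient; continuity of the second derivatives
  gives the claim in the limit.\<close>

lemma dir_deriv_commute_real:
  fixes g :: "'a::real_normed_vector \<Rightarrow> real"
  assumes g: "smooth g"
  shows "dir_deriv u (dir_deriv v g) p = dir_deriv v (dir_deriv u g) p"
proof -
  define h where "h n = inverse (real (Suc n))" for n
  have h: "h n > 0" for n by (simp add: h_def)
  have h0: "h \<longlonglongrightarrow> 0"
    unfolding h_def[abs_def] by (rule LIMSEQ_inverse_real_of_nat)
  have "\<exists>q q'. norm (q - p) \<le> h n * (norm u + norm v) \<and> norm (q' - p) \<le> h n * (norm u + norm v) \<and>
      dir_deriv v (dir_deriv u g) q = dir_deriv u (dir_deriv v g) q'" for n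
  proof -
    obtain q where q: "norm (q - p) \<le> h n * (norm u + norm v)"
      "g (p + h n *\<^sub>R u + h n *\<^sub>R v) - g (p + h n *\<^sub>R u) - g (p + h n *\<^sub>R v) + g p
        = (h n)\<^sup>2 * dir_deriv v (dir_deriv u g) q"
      by (rule second_difference_mvt[OF g h])
    obtain q' where q': "norm (q' - p) \<le> h n * (norm v + norm u)"
      "g (p + h n *\<^sub>R v + h n *\<^sub>R u) - g (p + h n *\<^sub>R v) - g (p + h n *\<^sub>R u) + g p
        = (h n)\<^sup>2 * dir_deriv u (dir_deriv v g) q'"
      by (rule second_difference_mvt[OF g h])
    have e: "p + h n *\<^sub>R v + h n *\<^sub>R u = p + h n *\<^sub>R u + h n *\<^sub>R v" by simp
    have "(h n)\<^sup>2 * dir_deriv v (dir_deriv u g) q = (h n)\<^sup>2 * dir_deriv u (dir_deriv v g) q'"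
      using q(2) q'(2)[unfolded e] by linarith
    then have "dir_deriv v (dir_deriv u g) q = dir_deriv u (dir_deriv v g) q'"
      using h[of n] by simp
    then show ?thesis using q(1) q'(1)[unfolded add.commute[of "norm v"]] by blast
  qed
  then obtain q q' where q: "\<And>n. norm (q n - p) \<le> h n * (norm u + norm v)"
      "\<And>n. norm (q' n - p) \<le> h n * (norm u + norm v)"
      "\<And>n. dir_deriv v (dir_deriv u g) (q n) = dir_deriv u (dir_deriv v g) (q' n)"
    by metis
  have lim: "f \<longlonglongrightarrow> p" if "\<And>n. norm (f n - p) \<le> h n * (norm u + norm v)" for f
  proof -
    have "(\<lambda>n. h n * (norm u + norm v)) \<longlonglongrightarrow> 0"
      using tendsto_mult_right[OF h0] by auto
    then have "(\<lambda>n. f n - p) \<longlonglongrightarrow> 0"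
      by (rule Lim_null_comparison[rotated]) (use that in auto)
    then show ?thesis by (simp add: LIM_zero_iff)
  qed
  have cont: "isCont (dir_deriv a (dir_deriv b g)) p" for a b
    using smooth_continuous_on[OF smooth_dir_deriv[OF smooth_dir_deriv[OF g]], of UNIV]
    by (simp add: continuous_on_eq_continuous_at)
  have "(\<lambda>n. dir_deriv v (dir_deriv u g) (q n)) \<longlonglongrightarrow> dir_deriv v (dir_deriv u g) p"
    "(\<lambda>n. dir_deriv u (dir_deriv v g) (q' n)) \<longlonglongrightarrow> dir_deriv u (dir_deriv v g) p"
    by (rule isCont_tendsto_compose[OF cont lim[OF q(1)]], rule isCont_tendsto_compose[OF cont lim[OF q(2)]])
  then show ?thesis
    using q(3) LIMSEQ_unique by simp
qed

lemma dir_deriv_commute: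
  fixes g :: "'a::real_normed_vector \<Rightarrow> 'b::euclidean_space"
  assumes g: "smooth g"
  shows "dir_deriv u (dir_deriv v g) p = dir_deriv v (dir_deriv u g) p"
proof (rule euclidean_eqI)
  fix b :: 'b
  have L: "dir_deriv w (\<lambda>q. f q \<bullet> b) = (\<lambda>q. dir_deriv w f q \<bullet> b)" if "smooth f" for w and f :: "'a \<Rightarrow> 'b"
    by (rule dir_deriv_bounded_linear[OF bounded_linear_inner_left that])
  have D: "dir_deriv u (dir_deriv v (\<lambda>q. g q \<bullet> b)) p = dir_deriv u (dir_deriv v g) p \<bullet> b" for u v
    unfolding L[OF g] by (rule L[OF smooth_dir_deriv[OF g], THEN fun_cong])
  have "dir_deriv u (dir_deriv v (\<lambda>q. g q \<bullet> b)) p = dir_deriv v (dir_deriv u (\<lambda>q. g q \<bullet> b)) p"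
    by (rule dir_deriv_commute_real) (rule smooth_bounded_linear[OF bounded_linear_inner_left g])
  then show "dir_deriv u (dir_deriv v g) p \<bullet> b = dir_deriv v (dir_deriv u g) p \<bullet> b"
    by (rule box_equals[OF _ D D])
qed

lemma dir_deriv_eq_0:
  assumes "open V" "p \<in> V" "\<And>q. q \<in> V \<Longrightarrow> g q = 0"
  shows "dir_deriv v g p = 0"
proof -
  have "(g has_derivative (\<lambda>v. 0)) (at p)"
    by (rule has_derivative_transform_within_open[of "\<lambda>_. 0" _ _ _ V]) (use assms in auto)
  then have "(\<lambda>v. 0) = frechet_derivative g (at p)"
    by (rule frechet_derivative_at)
  then have "frechet_derivative g (at p) = (\<lambda>v. 0)"
    by (rule sym)
  then show ?thesis
    by simp
qed

section \<open>Riesz representation of bounded functionals on test functions\<close>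

definition test_fun :: "'a::euclidean_space set \<Rightarrow> ('a \<Rightarrow> real) set" where
  "test_fun V = {\<phi>. smooth \<phi> \<and> (\<exists>C. compact C \<and> C \<subseteq> V \<and> (\<forall>p. p \<notin> C \<longrightarrow> \<phi> p = 0))}"

lemma test_funI: "smooth \<phi> \<Longrightarrow> compact C \<Longrightarrow> C \<subseteq> V \<Longrightarrow> (\<And>p. p \<notin> C \<Longrightarrow> \<phi> p = 0) \<Longrightarrow> \<phi> \<in> test_fun V"
  unfolding test_fun_def by blast

lemma test_funE:
  assumes "\<phi> \<in> test_fun V"
  obtains C where "smooth \<phi>" "compact C" "C \<subseteq> V" "\<And>p. p \<notin> C \<Longrightarrow> \<phi> p = 0"
  using assms unfolding test_fun_def by blast

lemma test_fun_smooth: "\<phi> \<in> test_fun V \<Longrightarrow> smooth \<phi>"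
  by (auto simp: test_fun_def)

lemma test_fun_mono: "\<phi> \<in> test_fun V \<Longrightarrow> V \<subseteq> W \<Longrightarrow> \<phi> \<in> test_fun W"
  unfolding test_fun_def by blast

lemma test_fun_zero: "(\<lambda>p. 0) \<in> test_fun V"
  by (rule test_funI[of _ "{}"]) auto

lemma test_fun_add: "\<phi> \<in> test_fun V \<Longrightarrow> \<psi> \<in> test_fun V \<Longrightarrow> (\<lambda>p. \<phi> p + \<psi> p) \<in> test_fun V"
proof (elim test_funE)
  fix C D
  assume "smooth \<phi>" "smooth \<psi>" "compact C" "compact D" "C \<subseteq> V" "D \<subseteq> V"
    "\<And>p. p \<notin> C \<Longrightarrow> \<phi> p = 0" "\<And>p. p \<notin> D \<Longrightarrow> \<psi> p = 0"
  then show ?thesis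
    by (intro test_funI[of _ "C \<union> D"] smooth_add compact_Un) auto
qed

lemma test_fun_mult: "smooth \<phi> \<Longrightarrow> \<psi> \<in> test_fun V \<Longrightarrow> (\<lambda>p. \<phi> p * \<psi> p) \<in> test_fun V"
proof (elim test_funE)
  fix C
  assume "smooth \<phi>" "smooth \<psi>" "compact C" "C \<subseteq> V" "\<And>p. p \<notin> C \<Longrightarrow> \<psi> p = 0"
  then show ?thesis
    by (intro test_funI[of _ C] smooth_mult) auto
qed

lemma test_fun_scale: "\<phi> \<in> test_fun V \<Longrightarrow> (\<lambda>p. c * \<phi> p) \<in> test_fun V"
  by (rule test_fun_mult) auto

lemma test_fun_uminus: "\<phi> \<in> test_fun V \<Longrightarrow> (\<lambda>p. - \<phi> p) \<in> test_fun V"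
  using test_fun_scale[of \<phi> V "- 1"] by simp

lemma test_fun_diff: "\<phi> \<in> test_fun V \<Longrightarrow> \<psi> \<in> test_fun V \<Longrightarrow> (\<lambda>p. \<phi> p - \<psi> p) \<in> test_fun V"
  using test_fun_add[OF _ test_fun_uminus] by fastforce

lemma test_fun_sum: "(\<And>i. i \<in> I \<Longrightarrow> f i \<in> test_fun V) \<Longrightarrow> (\<lambda>p. \<Sum>i\<in>I. f i p) \<in> test_fun V"
  by (induction I rule: infinite_finite_induct) (auto intro: test_fun_add test_fun_zero)

lemma test_fun_bounded:
  assumes "\<phi> \<in> test_fun V"
  obtains K where "0 \<le> K" "\<And>p. \<bar>\<phi> p\<bar> \<le> K"
proof -
  obtain C where C: "smooth \<phi>" "compact C" "C \<subseteq> V" "\<And>p. p \<notin> C \<Longrightarrow> \<phi> p = 0"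
    using assms unfolding test_fun_def by blast
  have "bounded (\<phi> ` C)"
    using compact_continuous_image[OF smooth_continuous_on[OF C(1)] C(2)] compact_imp_bounded by blast
  then obtain K where "\<And>p. p \<in> C \<Longrightarrow> \<bar>\<phi> p\<bar> \<le> K"
    by (auto simp: bounded_iff)
  then have "\<bar>\<phi> p\<bar> \<le> max K 0" for p using C(4)[of p] by (cases "p \<in> C") force+
  then show ?thesis using that[of "max K 0"] by simp
qed

lemma smooth_borel_measurable: "smooth \<phi> \<Longrightarrow> \<phi> \<in> borel_measurable borel"
  by (rule borel_measurable_continuous_onI) (rule smooth_continuous_on)

lemma test_fun_integrable:
  fixes \<mu> :: "'a::euclidean_space measure"
  assumes "\<phi> \<in> test_fun V" "sets \<mu> = sets borel" "finite_measure \<mu>"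
  shows "integrable \<mu> \<phi>"
proof -
  obtain K where K: "\<And>p. \<bar>\<phi> p\<bar> \<le> K" using test_fun_bounded[OF assms(1)] by blast
  have "\<phi> \<in> borel_measurable \<mu>"
    using smooth_borel_measurable[OF test_fun_smooth[OF assms(1)]] measurable_cong_sets[OF assms(2) refl] by blast
  then show ?thesis
    using K by (intro finite_measure.integrable_const_bound[OF assms(3), of _ K]) auto
qed

lemma test_fun_urysohn:
  fixes K V :: "'a::euclidean_space set"
  assumes "compact K" "open V" "K \<subseteq> V"
  obtains b N where "b \<in> test_fun V" "\<And>p. 0 \<le> b p" "\<And>p. b p \<le> 1"
    "open N" "K \<subseteq> N" "\<And>p. p \<in> N \<Longrightarrow> b p = 1"
  using smooth_urysohn[OF assms] by (metis test_funI)

section \<open>Comparison of a number with a smooth staircase\<close>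

lemma count_below_upper: "0 \<le> x \<Longrightarrow> (\<Sum>j<J. if real j < x then 1 else 0) \<le> x + (1::real)"
proof -
  assume "0 \<le> x"
  \<comment> \<open>The sum counts the j that lie below both J and x; the second conjunct is what
    the induction step uses when J < x.\<close>
  then have "(\<Sum>j<J. if real j < x then 1 else 0) \<le> x + (1::real) \<and>
    (\<Sum>j<J. if real j < x then 1 else 0) \<le> real J"
    by (induction J) auto
  then show ?thesis by simp
qed

lemma count_below_lower: "x \<le> real J \<Longrightarrow> x - 1 \<le> (\<Sum>j<J. if real j + 1 < x then 1 else (0::real))"
proof -
  \<comment> \<open>The minimum makes the claim inductive: once J < x, every j < J satisfies j + 1 <
    x, so all J terms count.\<close>
  have "min x (real J) - 1 \<le> (\<Sum>j<J. if real j + 1 < x then 1 else (0::real)) \<and>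
    (real J < x \<longrightarrow> real J \<le> (\<Sum>j<J. if real j + 1 < x then 1 else 0))"
    by (induction J) (auto split: if_splits simp: min_def)
  then show "x \<le> real J \<Longrightarrow> ?thesis" by auto
qed

text \<open>Each step lies between the indicators of j + 1 < x and of j < x; the former add up to at
  least x - 1, the latter to at most x + 1. The error does not depend on \<open>J\<close>.\<close>

lemma staircase:
  assumes "0 \<le> x" "x \<le> real J"
  shows "\<bar>x - (\<Sum>j<J. smooth_step (x - real j))\<bar> \<le> 1"
proof -
  have "(\<Sum>j<J. smooth_step (x - real j)) \<le> (\<Sum>j<J. if real j < x then 1 else 0)"
    by (intro sum_mono) (auto simp: smooth_step_le_1 smooth_step_zero)
  moreover have "(\<Sum>j<J. if real j + 1 < x then 1 else 0) \<le> (\<Sum>j<J. smooth_step (x - real j))"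
    by (intro sum_mono) (auto simp: smooth_step_nonneg smooth_step_one)
  ultimately show ?thesis
    using count_below_upper[OF assms(1), of J] count_below_lower[OF assms(2)] by linarith
qed

text \<open>The bound is one-sided because a mass is a supremum of values; applied to multiples of
  both signs it becomes two-sided.\<close>

locale bounded_functional =
  fixes U :: "'a::euclidean_space set" and L :: "('a \<Rightarrow> real) \<Rightarrow> real" and C :: real
  assumes open_U: "open U"
    and L_add: "\<phi> \<in> test_fun U \<Longrightarrow> \<psi> \<in> test_fun U \<Longrightarrow> L (\<lambda>p. \<phi> p + \<psi> p) = L \<phi> + L \<psi>"
    and L_scale: "\<phi> \<in> test_fun U \<Longrightarrow> L (\<lambda>p. c * \<phi> p) = c * L \<phi>"
    and L_bound: "\<phi> \<in> test_fun U \<Longrightarrow> (\<And>p. \<bar>\<phi> p\<bar> \<le> 1) \<Longrightarrow> L \<phi> \<le> C"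
begin

lemma L_zero: "L (\<lambda>p. 0) = 0"
  using L_scale[OF test_fun_zero, of 0] by simp

lemma L_diff: "\<phi> \<in> test_fun U \<Longrightarrow> \<psi> \<in> test_fun U \<Longrightarrow> L (\<lambda>p. \<phi> p - \<psi> p) = L \<phi> - L \<psi>"
  using L_add[OF _ test_fun_scale[of _ U "-1"], of \<phi> \<psi>] L_scale[of \<psi> "-1"] by simp

lemma L_sum: "finite I \<Longrightarrow> (\<And>i. i \<in> I \<Longrightarrow> f i \<in> test_fun U) \<Longrightarrow> L (\<lambda>p. \<Sum>i\<in>I. f i p) = (\<Sum>i\<in>I. L (f i))"
  by (induction I rule: finite_induct) (auto simp: L_zero L_add test_fun_sum)

lemma L_bound_scaled:
  assumes "\<phi> \<in> test_fun U" "0 < r" "\<And>p. \<bar>\<phi> p\<bar> \<le> r"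
  shows "\<bar>L \<phi>\<bar> \<le> C * r"
proof -
  have "L (\<lambda>p. c * \<phi> p) \<le> C" if "\<bar>c\<bar> = 1 / r" for c
  proof (rule L_bound[OF test_fun_scale[OF assms(1)]])
    show "\<bar>c * \<phi> p\<bar> \<le> 1" for p
      using assms(2) assms(3)[of p] by (simp add: abs_mult that)
  qed
  from this[of "1 / r"] this[of "- (1 / r)"]
  have "L (\<lambda>p. (1 / r) * \<phi> p) \<le> C" "L (\<lambda>p. - (1 / r) * \<phi> p) \<le> C"
    using \<open>0 < r\<close> by auto
  then show ?thesis
    using \<open>0 < r\<close> unfolding L_scale[OF assms(1)] by (auto simp: field_simps)
qed

text \<open>Intersecting with \<open>U\<close> makes the content meaningful for every open
  \<open>V\<close>, so that the measure can be built on the whole space.\<close>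

definition subunit :: "'a set \<Rightarrow> ('a \<Rightarrow> real) set" where
  "subunit V = {\<phi> \<in> test_fun (V \<inter> U). \<forall>p. 0 \<le> \<phi> p \<and> \<phi> p \<le> 1}"

text \<open>On open sets this is the positive variation of \<open>L\<close>, not the total one. The
  measure that it generates dominates \<open>L\<close> on nonnegative functions, with equality only
  asserted for positive \<open>L\<close>.\<close>

definition content :: "'a set \<Rightarrow> real" where
  "content V = (SUP \<phi>\<in>subunit V. L \<phi>)"

section \<open>The measure generated by the content of open sets\<close>

lemma subunit_test_fun: "\<phi> \<in> subunit V \<Longrightarrow> \<phi> \<in> test_fun U"
  by (auto simp: subunit_def intro: test_fun_mono)

lemma zero_subunit: "(\<lambda>p. 0) \<in> subunit V"
  by (auto simp: subunit_def test_fun_zero)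

lemma subunit_bound: "\<phi> \<in> subunit V \<Longrightarrow> L \<phi> \<le> C"
  by (rule L_bound[OF subunit_test_fun]) (auto simp: subunit_def abs_of_nonneg)

lemma content_upper: "\<phi> \<in> subunit V \<Longrightarrow> L \<phi> \<le> content V"
  unfolding content_def by (rule cSUP_upper) (auto intro: bdd_aboveI2 subunit_bound)

lemma content_least: "(\<And>\<phi>. \<phi> \<in> subunit V \<Longrightarrow> L \<phi> \<le> c) \<Longrightarrow> content V \<le> c"
  unfolding content_def using zero_subunit by (intro cSUP_least) auto

lemma content_nonneg: "0 \<le> content V"
  using content_upper[OF zero_subunit] L_zero by simp

lemma content_le: "content V \<le> C"
  by (rule content_least) (rule subunit_bound)

lemma content_mono: "V \<subseteq> W \<Longrightarrow> content V \<le> content W"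
  by (rule content_least, rule content_upper) (auto simp: subunit_def intro: test_fun_mono)

lemma content_empty: "content {} = 0"
proof (rule antisym[OF content_least content_nonneg])
  fix \<phi> assume "\<phi> \<in> subunit {}"
  then have "\<phi> = (\<lambda>p. 0)" by (auto simp: subunit_def test_fun_def)
  then show "L \<phi> \<le> 0" using L_zero by simp
qed

text \<open>A cutoff \<open>b\<close> that is 1 near \<open>K - W\<close> splits a competitor \<phi>
  into \<phi> times \<open>b\<close>, carried by \<open>V\<close>, and the rest, carried by the
  compact set \<open>K - N\<close> inside \<open>W\<close>.\<close>

lemma content_Un:
  assumes "open V" "open W"
  shows "content (V \<union> W) \<le> content V + content W"
proof (rule content_least)
  fix \<phi> assume \<phi>: "\<phi> \<in> subunit (V \<union> W)"
  then have "\<phi> \<in> test_fun ((V \<union> W) \<inter> U)" by (simp add: subunit_def)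
  then obtain K where K: "smooth \<phi>" "compact K" "K \<subseteq> (V \<union> W) \<inter> U" "\<And>p. p \<notin> K \<Longrightarrow> \<phi> p = 0"
    unfolding test_fun_def by blast
  have "compact (K - W)" using K(2) assms by (simp add: compact_diff)
  then obtain b N where b: "b \<in> test_fun (V \<inter> U)" "\<And>p. 0 \<le> b p" "\<And>p. b p \<le> 1"
    "open N" "K - W \<subseteq> N" "\<And>p. p \<in> N \<Longrightarrow> b p = 1"
    using test_fun_urysohn[of "K - W" "V \<inter> U"] K(3) assms open_U by blast
  have 1: "(\<lambda>p. \<phi> p * b p) \<in> subunit V"
    using b \<phi> K(1) by (auto simp: subunit_def intro!: test_fun_mult mult_le_one)
  have "(\<lambda>p. (1 - b p) * \<phi> p) \<in> test_fun (W \<inter> U)"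
  proof (rule test_funI[of _ "K - N"])
    show "smooth (\<lambda>p. (1 - b p) * \<phi> p)"
      by (intro smooth_mult smooth_diff smooth_const test_fun_smooth[OF b(1)] K(1))
  qed (use K b in \<open>auto simp: compact_diff\<close>)
  then have 2: "(\<lambda>p. (1 - b p) * \<phi> p) \<in> subunit W"
    using b \<phi> by (auto simp: subunit_def intro!: mult_le_one)
  have "L \<phi> = L (\<lambda>p. \<phi> p * b p + (1 - b p) * \<phi> p)"
    by (simp add: algebra_simps)
  also have "\<dots> = L (\<lambda>p. \<phi> p * b p) + L (\<lambda>p. (1 - b p) * \<phi> p)"
    using 1 2 by (intro L_add subunit_test_fun)
  also have "\<dots> \<le> content V + content W"
    using 1 2 by (intro add_mono content_upper)
  finally show "L \<phi> \<le> content V + content W" .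
qed

lemma content_UN_finite:
  "finite I \<Longrightarrow> (\<And>i. i \<in> I \<Longrightarrow> open (V i)) \<Longrightarrow> content (\<Union>i\<in>I. V i) \<le> (\<Sum>i\<in>I. content (V i))"
proof (induction I rule: finite_induct)
  case (insert i I)
  have "content (\<Union>i\<in>insert i I. V i) \<le> content (V i) + content (\<Union>i\<in>I. V i)"
    using insert content_Un[of "V i" "\<Union>i\<in>I. V i"] by auto
  then show ?case using insert by force
qed (simp add: content_empty)

text \<open>The support of a competitor is compact and hence covered by finitely many
  \<open>V i\<close>, which reduces the claim to finite subadditivity.\<close>

lemma content_UN:
  fixes V :: "nat \<Rightarrow> 'a set"
  assumes "\<And>i. open (V i)"
  shows "ennreal (content (\<Union>i. V i)) \<le> (\<Sum>i. ennreal (content (V i)))"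
proof (cases "(\<Sum>i. ennreal (content (V i))) = top")
  case False
  then obtain s where s: "(\<Sum>i. ennreal (content (V i))) = ennreal s" "0 \<le> s"
    by (metis ennreal_cases)
  have "content (\<Union>i. V i) \<le> s"
  proof (rule content_least)
    fix \<phi> assume \<phi>: "\<phi> \<in> subunit (\<Union>i. V i)"
    then have "\<phi> \<in> test_fun ((\<Union>i. V i) \<inter> U)" by (simp add: subunit_def)
    then obtain K where K: "smooth \<phi>" "compact K" "K \<subseteq> (\<Union>i. V i) \<inter> U" "\<And>p. p \<notin> K \<Longrightarrow> \<phi> p = 0"
    unfolding test_fun_def by blast
    obtain I where I: "finite I" "K \<subseteq> (\<Union>i\<in>I. V i)"
      using compactE_image[OF K(2), of UNIV V] assms K(3) by (metis Int_subset_iff)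
    have "\<phi> \<in> subunit (\<Union>i\<in>I. V i)"
      using \<phi> K I by (auto simp: subunit_def intro!: test_funI[of _ K])
    then have "L \<phi> \<le> (\<Sum>i\<in>I. content (V i))"
      using content_upper content_UN_finite[OF I(1)] assms by (meson order_trans)
    also have "\<dots> \<le> s"
    proof -
      have "ennreal (\<Sum>i\<in>I. content (V i)) = (\<Sum>i\<in>I. ennreal (content (V i)))"
        by (simp add: content_nonneg)
      also have "\<dots> \<le> ennreal s"
        unfolding s(1)[symmetric] by (rule sum_le_suminf) (use I in auto)
      finally show ?thesis using s(2) by simp
    qed
    finally show "L \<phi> \<le> s" .
  qed
  then show ?thesis unfolding s(1) by (rule ennreal_leI)
qed simp

definition outer :: "'a set \<Rightarrow> ennreal" where
  "outer A = (INF V\<in>{V. open V \<and> A \<subseteq> V}. ennreal (content V))"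

lemma outer_lower: "open V \<Longrightarrow> A \<subseteq> V \<Longrightarrow> outer A \<le> ennreal (content V)"
  unfolding outer_def by (rule INF_lower) auto

lemma outer_open: "open V \<Longrightarrow> outer V = ennreal (content V)"
  by (rule antisym[OF outer_lower])
    (auto simp: outer_def content_mono ennreal_leI intro!: INF_greatest)

lemma outer_mono: "A \<subseteq> B \<Longrightarrow> outer A \<le> outer B"
  unfolding outer_def by (rule INF_superset_mono) auto

text \<open>The content is bounded by \<open>C\<close>, so the infimum is finite and adding
  \<open>e\<close> makes it strictly larger.\<close>

lemma outer_approx:
  assumes "0 < e"
  obtains V where "open V" "A \<subseteq> V" "ennreal (content V) \<le> outer A + ennreal e"
proof -
  have "outer A \<le> ennreal C"
    using outer_lower[of UNIV A] content_le[of UNIV] by (meson ennreal_leI open_UNIV order_trans top_greatest)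
  then obtain a where a: "outer A = ennreal a" "0 \<le> a"
    by (metis ennreal_cases ennreal_neq_top top_unique)
  then have "outer A < outer A + ennreal e"
    using assms by (simp add: ennreal_less_iff flip: ennreal_plus)
  then have "\<exists>V\<in>{V. open V \<and> A \<subseteq> V}. ennreal (content V) < outer A + ennreal e"
    by (simp only: outer_def[of A] INF_less_iff)
  then obtain V where "open V" "A \<subseteq> V" "ennreal (content V) < outer A + ennreal e"
    by auto
  then show ?thesis by (intro that) (auto intro: less_imp_le)
qed

lemma outer_measure_space_outer: "outer_measure_space (Pow UNIV) outer"
  unfolding outer_measure_space_def
proof (intro conjI)
  show "positive (Pow UNIV) outer"
    by (auto simp: positive_def outer_open content_empty)
  show "increasing (Pow UNIV) outer"
    by (auto simp: increasing_def outer_mono)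
  show "countably_subadditive (Pow UNIV) outer"
    unfolding countably_subadditive_def
  proof (intro allI impI)
    fix A :: "nat \<Rightarrow> 'a set"
    show "outer (\<Union>i. A i) \<le> (\<Sum>i. outer (A i))"
    proof (rule ennreal_le_epsilon)
      fix e :: real assume "0 < e"
      \<comment> \<open>The errors e / 2^(i + 1) add up to e.\<close>
      have "\<exists>V. open V \<and> A i \<subseteq> V \<and> ennreal (content V) \<le> outer (A i) + ennreal (e * (1/2) ^ Suc i)" for i
      proof -
        have "0 < e * (1/2) ^ Suc i" using \<open>0 < e\<close> by simp
        from outer_approx[OF this, of "A i"] show ?thesis by metis
      qed
      then obtain V where V: "\<And>i. open (V i)" "\<And>i. A i \<subseteq> V i"
        "\<And>i. ennreal (content (V i)) \<le> outer (A i) + ennreal (e * (1/2) ^ Suc i)"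
        by metis
      have "outer (\<Union>i. A i) \<le> ennreal (content (\<Union>i. V i))"
        using V by (intro outer_lower) (auto intro: open_UN)
      also have "\<dots> \<le> (\<Sum>i. ennreal (content (V i)))"
        using V by (intro content_UN)
      also have "\<dots> \<le> (\<Sum>i. outer (A i) + ennreal (e * (1/2) ^ Suc i))"
        using V by (intro suminf_le summableI)
      also have "\<dots> = (\<Sum>i. outer (A i)) + (\<Sum>i. ennreal (e * (1/2) ^ Suc i))"
        by (intro suminf_add[symmetric] summableI)
      also have "(\<Sum>i. ennreal (e * (1/2) ^ Suc i)) = ennreal e"
        using sums_mult[OF power_half_series, of e] \<open>0 < e\<close>
        by (intro suminf_ennreal_eq) auto
      finally show "outer (\<Union>i. A i) \<le> (\<Sum>i. outer (A i)) + ennreal e" .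
    qed
  qed
qed

text \<open>A function \<open>\<phi>\<close> nearly optimal for \<open>W \<inter> V\<close> can be added to any competitor on the
  complement of its support, which is an open superset of \<open>A - V\<close>.\<close>

lemma open_in_lambda_system:
  assumes V: "open V"
  shows "V \<in> lambda_system UNIV (Pow UNIV) outer"
proof -
  have split: "outer (A \<inter> V) + outer (A - V) \<le> ennreal (content W)" if W: "open W" "A \<subseteq> W" for A W
  proof -
    have *: "L \<phi> + L \<psi> \<le> content W"
      if \<phi>: "\<phi> \<in> subunit (W \<inter> V)" and K: "compact K" "K \<subseteq> W \<inter> V" "\<And>p. p \<notin> K \<Longrightarrow> \<phi> p = 0"
        and \<psi>: "\<psi> \<in> subunit (W - K)" for \<phi> \<psi> K
    proof -
      have "\<phi> p + \<psi> p \<le> 1" for p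
        using \<phi> \<psi> K(3)[of p] by (cases "p \<in> K") (auto simp: subunit_def test_fun_def)
      then have "(\<lambda>p. \<phi> p + \<psi> p) \<in> subunit W"
        using \<phi> \<psi> by (auto simp: subunit_def intro!: test_fun_add elim: test_fun_mono)
      then show ?thesis
        using content_upper L_add[OF subunit_test_fun[OF \<phi>] subunit_test_fun[OF \<psi>]] by fastforce
    qed
    have step: "L \<phi> + enn2real (outer (A - V)) \<le> content W" if \<phi>: "\<phi> \<in> subunit (W \<inter> V)" for \<phi>
    proof -
      have "\<phi> \<in> test_fun (W \<inter> V \<inter> U)" using \<phi> by (simp add: subunit_def)
      then obtain K where K: "compact K" "K \<subseteq> W \<inter> V" "\<And>p. p \<notin> K \<Longrightarrow> \<phi> p = 0"
        unfolding test_fun_def by blast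
      have "content (W - K) \<le> content W - L \<phi>"
        using *[OF \<phi> K] by (intro content_least) (simp add: le_diff_eq add.commute)
      moreover have "outer (A - V) \<le> ennreal (content (W - K))"
        using W K by (intro outer_lower open_Diff compact_imp_closed) auto
      ultimately show ?thesis
        using enn2real_leI[OF content_nonneg] by fastforce
    qed
    \<comment> \<open>Finiteness allows the real number \<open>enn2real (outer (A - V))\<close> to
      be turned back into the outer measure.\<close>
    have fin: "outer (A - V) < top"
      using outer_lower[OF W(1), of "A - V"] W(2) by (meson Diff_subset ennreal_less_top order_le_less_trans order_trans)
    have "content (W \<inter> V) \<le> content W - enn2real (outer (A - V))"
      using step by (intro content_least) (simp add: le_diff_eq)
    then have "ennreal (content (W \<inter> V) + enn2real (outer (A - V))) \<le> ennreal (content W)"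
      by (intro ennreal_leI) simp
    then have "ennreal (content (W \<inter> V)) + outer (A - V) \<le> ennreal (content W)"
      using fin by (simp add: content_nonneg)
    moreover have "outer (A \<inter> V) \<le> ennreal (content (W \<inter> V))"
      using V W by (intro outer_lower) auto
    ultimately show ?thesis
      by (meson add_right_mono order_trans)
  qed
  have le: "outer (A \<inter> V) + outer (A - V) \<le> outer A" for A
    unfolding outer_def[of A] by (rule INF_greatest) (use split in auto)
  interpret algebra UNIV "Pow (UNIV :: 'a set)" by (rule algebra_Pow)
  have "subadditive (Pow UNIV) outer"
    by (rule countably_subadditive_subadditive)
      (use outer_measure_space_outer in \<open>simp_all add: outer_measure_space_def\<close>)
  then have "outer ((A \<inter> V) \<union> (A - V)) \<le> outer (A \<inter> V) + outer (A - V)" for A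
    by (rule subadditiveD) auto
  then have ge: "outer A \<le> outer (A \<inter> V) + outer (A - V)" for A
    by (simp add: Int_Diff_Un)
  show ?thesis
    unfolding lambda_system_eq using le ge by (auto intro: antisym)
qed

text \<open>The sets measurable in the sense of Caratheodory form a sigma-algebra that contains the
  open sets, hence all Borel sets; \<open>outer\<close> is restricted to the latter.\<close>

lemma content_measure:
  obtains \<mu> where "sets \<mu> = sets borel" "finite_measure \<mu>" "\<And>V. open V \<Longrightarrow> measure \<mu> V = content V"
proof -
  interpret sigma_algebra UNIV "Pow (UNIV :: 'a set)" by (rule sigma_algebra_Pow)
  let ?S = "lambda_system UNIV (Pow UNIV) outer"
  have ms: "measure_space UNIV ?S outer"
    by (rule caratheodory_lemma[OF outer_measure_space_outer])
  then have sa: "sigma_algebra UNIV ?S" by (simp add: measure_space_def)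
  have sub: "sets borel \<subseteq> ?S"
  proof -
    have "sets borel = sigma_sets UNIV {S :: 'a set. open S}"
      by (simp add: borel_def)
    moreover have "sigma_sets UNIV {S. open S} \<subseteq> ?S"
      by (rule sigma_algebra.sigma_sets_subset[OF sa]) (use open_in_lambda_system in blast)
    ultimately show ?thesis by simp
  qed
  define \<mu> where "\<mu> = measure_of UNIV (sets borel) outer"
  have ca: "countably_additive (sets borel) outer"
    unfolding countably_additive_def
  proof (intro allI impI)
    fix A :: "nat \<Rightarrow> 'a set"
    assume A: "range A \<subseteq> sets borel" "disjoint_family A" "\<Union> (range A) \<in> sets borel"
    have "countably_additive ?S outer" using ms by (simp add: measure_space_def)
    then show "(\<Sum>i. outer (A i)) = outer (\<Union> (range A))"
      unfolding countably_additive_def using A sub by (meson subset_iff)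
  qed
  have pos: "positive (sets borel) outer"
    by (simp add: positive_def outer_open content_empty)
  have s: "sets \<mu> = sets borel"
    unfolding \<mu>_def by (metis sets.sets_measure_of_eq space_borel)
  have e: "emeasure \<mu> A = outer A" if "A \<in> sets borel" for A
    unfolding \<mu>_def
    by (rule emeasure_measure_of_sigma[OF _ pos ca that]) (metis sets.sigma_algebra_axioms space_borel)
  show ?thesis
  proof (rule that[OF s])
    have "space \<mu> = UNIV" using sets_eq_imp_space_eq[OF s] by simp
    then show "finite_measure \<mu>"
      by (intro finite_measureI) (simp add: e outer_open)
    show "measure \<mu> V = content V" if "open V" for V
      using that by (simp add: measure_def e outer_open content_nonneg)
  qed
qed

section \<open>Comparison of the functional with the integral\<close>

context
  fixes \<mu> :: "'a measure"
  assumes sets_mu: "sets \<mu> = sets borel" and finite_mu: "finite_measure \<mu>"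
    and measure_mu: "\<And>V. open V \<Longrightarrow> measure \<mu> V = content V"
begin

text \<open>The j-th of the steps whose sum approximates \<open>real N * \<phi> p\<close> up to an
  error of 1; \<open>N\<close> is the number of levels per unit.\<close>

definition stair :: "('a \<Rightarrow> real) \<Rightarrow> nat \<Rightarrow> nat \<Rightarrow> 'a \<Rightarrow> real" where
  "stair \<phi> N j p = smooth_step (real N * \<phi> p - real j)"

lemma stair_subunit:
  assumes "\<phi> \<in> test_fun U"
  shows "stair \<phi> N j \<in> subunit {p. real N * \<phi> p > real j}"
proof -
  obtain K where K: "smooth \<phi>" "compact K" "K \<subseteq> U" "\<And>p. p \<notin> K \<Longrightarrow> \<phi> p = 0"
    using assms unfolding test_fun_def by blast
  have "stair \<phi> N j \<in> test_fun ({p. real N * \<phi> p > real j} \<inter> U)"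
  \<comment> \<open>A step vanishes below the level j + 1/4, so its support is a closed part of
    \<open>K\<close> inside the open set above level j.\<close>
  proof (rule test_funI[of _ "K \<inter> {p. real N * \<phi> p \<ge> real j + 1/4}"])
    show "smooth (stair \<phi> N j)"
      unfolding stair_def[abs_def]
      by (intro smooth_compose[OF smooth_smooth_step] smooth_diff smooth_mult smooth_const K(1))
    have "closed {p. real j + 1/4 \<le> real N * \<phi> p}"
      by (intro closed_Collect_le continuous_intros smooth_continuous_on K)
    then show "compact (K \<inter> {p. real N * \<phi> p \<ge> real j + 1/4})"
      using K(2) by (simp add: compact_Int_closed)
    show "stair \<phi> N j p = 0" if "p \<notin> K \<inter> {p. real N * \<phi> p \<ge> real j + 1/4}" for p
      using that K(4)[of p] by (cases "p \<in> K") (auto simp: stair_def intro!: smooth_step_zero)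
  qed (use K in auto)
  then show ?thesis
    by (auto simp: subunit_def stair_def smooth_step_nonneg smooth_step_le_1)
qed

text \<open>The difference between \<open>N\<close> times \<phi> and its staircase is a test
  function of absolute value at most 1, so \<open>L\<close> of it is bounded by \<open>C\<close>,
  whatever \<open>N\<close> is.\<close>

lemma stair_sum_approx:
  assumes \<phi>: "\<phi> \<in> test_fun U" "\<And>p. 0 \<le> \<phi> p" and N: "0 < N" "\<And>p. real N * \<phi> p \<le> real J"
  shows "\<bar>real N * L \<phi> - (\<Sum>j<J. L (stair \<phi> N j))\<bar> \<le> C"
proof -
  have T: "stair \<phi> N j \<in> test_fun U" for j
    using stair_subunit[OF \<phi>(1)] subunit_test_fun by blast
  have "real N * L \<phi> - (\<Sum>j<J. L (stair \<phi> N j)) = L (\<lambda>p. real N * \<phi> p - (\<Sum>j<J. stair \<phi> N j p))"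
    using T \<phi> by (simp add: L_diff test_fun_sum test_fun_scale L_scale L_sum)
  moreover have "(\<lambda>p. real N * \<phi> p - (\<Sum>j<J. stair \<phi> N j p)) \<in> test_fun U"
    using T \<phi> by (intro test_fun_diff test_fun_sum test_fun_scale)
  then have "\<bar>L (\<lambda>p. real N * \<phi> p - (\<Sum>j<J. stair \<phi> N j p))\<bar> \<le> C * 1"
    by (rule L_bound_scaled) (use \<phi> N in \<open>auto simp: stair_def intro!: staircase\<close>)
  ultimately show ?thesis by simp
qed

text \<open>A layer cake formula, as contents of open superlevel sets are their measures. The
  thresholds \<open>a\<close> are general because the upper estimate uses the levels j and the lower
  one the levels j + 1.\<close>

lemma sum_content_levels:
  fixes a :: "nat \<Rightarrow> real"
  assumes "\<phi> \<in> test_fun U"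
  shows "(\<Sum>j<J. content {p. real N * \<phi> p > a j}) =
    (\<integral>p. (\<Sum>j<J. if a j < real N * \<phi> p then 1 else 0) \<partial>\<mu>)"
    and "integrable \<mu> (\<lambda>p. \<Sum>j<J. if a j < real N * \<phi> p then 1 else 0 :: real)"
proof -
  interpret finite_measure \<mu> by (rule finite_mu)
  have o: "open {p. real N * \<phi> p > a j}" for j
    by (intro open_Collect_less continuous_intros smooth_continuous_on test_fun_smooth[OF assms])
  have eq: "(\<lambda>p. if a j < real N * \<phi> p then 1 else 0 :: real) = indicator {p. real N * \<phi> p > a j}" for j
    by (auto simp: indicator_def)
  have m: "{p. real N * \<phi> p > a j} \<in> sets \<mu>" for j
    using o sets_mu by (metis borel_open)
  have i: "integrable \<mu> (\<lambda>p. if a j < real N * \<phi> p then 1 else 0 :: real)" for j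
    unfolding eq using m by (simp add: emeasure_eq_measure)
  show "integrable \<mu> (\<lambda>p. \<Sum>j<J. if a j < real N * \<phi> p then 1 else 0 :: real)"
    using i by (rule Bochner_Integration.integrable_sum)
  have "(\<integral>p. (if a j < real N * \<phi> p then 1 else 0 :: real) \<partial>\<mu>) = content {p. real N * \<phi> p > a j}" for j
    unfolding eq using m measure_mu[OF o] sets_eq_imp_space_eq[OF sets_mu] by simp
  then show "(\<Sum>j<J. content {p. real N * \<phi> p > a j}) =
      (\<integral>p. (\<Sum>j<J. if a j < real N * \<phi> p then 1 else 0) \<partial>\<mu>)"
    using i by (subst Bochner_Integration.integral_sum) auto
qed

text \<open>Division by \<open>N\<close> removes the error \<open>D\<close>; for this the staircase
  estimates have to be uniform in \<open>N\<close>.\<close>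

lemma le_of_le_div:
  fixes a b D :: real
  assumes "\<And>N::nat. 0 < N \<Longrightarrow> real N * a \<le> real N * b + D"
  shows "a \<le> b"
proof (rule ccontr)
  assume "\<not> a \<le> b"
  then obtain N :: nat where "D < real N * (a - b)"
    using reals_Archimedean3[of "a - b"] by auto
  moreover have "D < real (Suc N) * (a - b)"
    using \<open>\<not> a \<le> b\<close> calculation by (simp add: algebra_simps)
  ultimately show False using assms[of "Suc N"] by (simp add: algebra_simps)
qed

lemma test_fun_nat_bound:
  assumes "\<phi> \<in> test_fun U"
  obtains J :: nat where "\<And>p. real N * \<phi> p \<le> real J"
proof -
  obtain K where K: "\<And>p. \<bar>\<phi> p\<bar> \<le> K" using test_fun_bounded[OF assms] by blast
  obtain J :: nat where "real N * K \<le> real J" using real_arch_simple by blast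
  moreover have "real N * \<phi> p \<le> real N * K" for p
    using K[of p] by (intro mult_left_mono) auto
  ultimately show ?thesis by (meson that order_trans)
qed

text \<open>Each step is a competitor for the content of its superlevel set. This inequality, valid
  for signed \<open>L\<close>, is what makes the integral minus \<open>L\<close> a positive
  functional.\<close>

lemma L_le_integral:
  assumes \<phi>: "\<phi> \<in> test_fun U" "\<And>p. 0 \<le> \<phi> p"
  shows "L \<phi> \<le> (\<integral>p. \<phi> p \<partial>\<mu>)"
proof (rule le_of_le_div)
  interpret finite_measure \<mu> by (rule finite_mu)
  fix N :: nat assume N: "0 < N"
  obtain J where J: "\<And>p. real N * \<phi> p \<le> real J" using test_fun_nat_bound[OF \<phi>(1)] by blast
  have int: "integrable \<mu> (\<lambda>p. real N * \<phi> p + 1)"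
    using test_fun_integrable[OF \<phi>(1) sets_mu finite_mu] by auto
  have "real N * L \<phi> \<le> (\<Sum>j<J. L (stair \<phi> N j)) + C"
    using stair_sum_approx[OF \<phi> N J] by linarith
  also have "(\<Sum>j<J. L (stair \<phi> N j)) \<le> (\<Sum>j<J. content {p. real N * \<phi> p > real j})"
    by (intro sum_mono content_upper stair_subunit \<phi>)
  also have "\<dots> = (\<integral>p. (\<Sum>j<J. if real j < real N * \<phi> p then 1 else 0) \<partial>\<mu>)"
    by (rule sum_content_levels(1)[OF \<phi>(1)])
  also have "\<dots> \<le> (\<integral>p. real N * \<phi> p + 1 \<partial>\<mu>)"
    using \<phi>(2) by (intro integral_mono sum_content_levels(2)[OF \<phi>(1)] int count_below_upper) auto
  also have "\<dots> = real N * (\<integral>p. \<phi> p \<partial>\<mu>) + measure \<mu> (space \<mu>)"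
    using test_fun_integrable[OF \<phi>(1) sets_mu finite_mu] by simp
  finally show "real N * L \<phi> \<le> real N * (\<integral>p. \<phi> p \<partial>\<mu>) + (measure \<mu> (space \<mu>) + C)"
    by simp
qed

text \<open>Positivity makes \<open>L\<close> monotone. The j-th step is 1 wherever
  \<open>real N * \<phi> p\<close> exceeds j + 1 and so dominates every competitor for the content
  of that set, which gives the reverse estimate.\<close>

lemma L_eq_integral_of_pos:
  assumes pos: "\<And>\<phi>. \<phi> \<in> test_fun U \<Longrightarrow> (\<And>p. 0 \<le> \<phi> p) \<Longrightarrow> 0 \<le> L \<phi>"
    and \<phi>: "\<phi> \<in> test_fun U" "\<And>p. 0 \<le> \<phi> p"
  shows "L \<phi> = (\<integral>p. \<phi> p \<partial>\<mu>)"
proof (rule antisym[OF L_le_integral[OF \<phi>] le_of_le_div])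
  interpret finite_measure \<mu> by (rule finite_mu)
  fix N :: nat assume N: "0 < N"
  obtain J where J: "\<And>p. real N * \<phi> p \<le> real J" using test_fun_nat_bound[OF \<phi>(1)] by blast
  have int: "integrable \<mu> (\<lambda>p. real N * \<phi> p - 1)"
    using test_fun_integrable[OF \<phi>(1) sets_mu finite_mu] by auto
  have level: "content {p. real N * \<phi> p > real j + 1} \<le> L (stair \<phi> N j)" for j
  proof (rule content_least)
    fix \<psi> assume \<psi>: "\<psi> \<in> subunit {p. real N * \<phi> p > real j + 1}"
    have "\<psi> p \<le> stair \<phi> N j p" for p
    proof (cases "real N * \<phi> p > real j + 1")
      case True
      then show ?thesis using \<psi> by (simp add: stair_def smooth_step_one subunit_def)
    next
      case False
      then have "\<psi> p = 0" using \<psi> by (auto simp: subunit_def test_fun_def)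
      then show ?thesis by (simp add: stair_def smooth_step_nonneg)
    qed
    moreover have T: "stair \<phi> N j \<in> test_fun U" "\<psi> \<in> test_fun U"
      by (rule subunit_test_fun[OF stair_subunit[OF \<phi>(1)]], rule subunit_test_fun[OF \<psi>])
    ultimately have "0 \<le> L (\<lambda>p. stair \<phi> N j p - \<psi> p)"
      by (intro pos[OF test_fun_diff]) simp_all
    then show "L \<psi> \<le> L (stair \<phi> N j)"
      by (simp add: L_diff[OF T])
  qed
  have "real N * (\<integral>p. \<phi> p \<partial>\<mu>) - measure \<mu> (space \<mu>) = (\<integral>p. real N * \<phi> p - 1 \<partial>\<mu>)"
    using test_fun_integrable[OF \<phi>(1) sets_mu finite_mu] by simp
  also have "\<dots> \<le> (\<integral>p. (\<Sum>j<J. if real j + 1 < real N * \<phi> p then 1 else 0) \<partial>\<mu>)"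
    using J by (intro integral_mono sum_content_levels(2)[OF \<phi>(1)] int count_below_lower) auto
  also have "\<dots> = (\<Sum>j<J. content {p. real N * \<phi> p > real j + 1})"
    by (rule sum_content_levels(1)[OF \<phi>(1), symmetric])
  also have "\<dots> \<le> (\<Sum>j<J. L (stair \<phi> N j))"
    by (intro sum_mono level)
  also have "\<dots> \<le> real N * L \<phi> + C"
    using stair_sum_approx[OF \<phi> N J] by linarith
  finally show "real N * (\<integral>p. \<phi> p \<partial>\<mu>) \<le> real N * L \<phi> + (measure \<mu> (space \<mu>) + C)"
    by simp
qed

end

lemma positive_riesz:
  assumes pos: "\<And>\<phi>. \<phi> \<in> test_fun U \<Longrightarrow> (\<And>p. 0 \<le> \<phi> p) \<Longrightarrow> 0 \<le> L \<phi>"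
  obtains \<mu> where "sets \<mu> = sets borel" "finite_measure \<mu>"
    "\<And>\<phi>. \<phi> \<in> test_fun U \<Longrightarrow> L \<phi> = (\<integral>p. \<phi> p \<partial>\<mu>)"
proof -
  obtain \<mu> where \<mu>: "sets \<mu> = sets borel" "finite_measure \<mu>" "\<And>V. open V \<Longrightarrow> measure \<mu> V = content V"
    using content_measure by metis
  have eq: "L \<phi> = (\<integral>p. \<phi> p \<partial>\<mu>)" if "\<phi> \<in> test_fun U" "\<And>p. 0 \<le> \<phi> p" for \<phi>
    by (rule L_eq_integral_of_pos[OF \<mu>]) (simp_all add: pos that)
  have "L \<phi> = (\<integral>p. \<phi> p \<partial>\<mu>)" if \<phi>: "\<phi> \<in> test_fun U" for \<phi>
  proof -
    obtain K where K: "smooth \<phi>" "compact K" "K \<subseteq> U" "\<And>p. p \<notin> K \<Longrightarrow> \<phi> p = 0"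
      using \<phi> unfolding test_fun_def by blast
    obtain B where B: "0 \<le> B" "\<And>p. \<bar>\<phi> p\<bar> \<le> B" using test_fun_bounded[OF \<phi>] by blast
    obtain b N where b: "b \<in> test_fun U" "\<And>p. 0 \<le> b p" "\<And>p. b p \<le> 1"
      "open N" "K \<subseteq> N" "\<And>p. p \<in> N \<Longrightarrow> b p = 1"
      using test_fun_urysohn[OF K(2) open_U K(3)] by metis
    \<comment> \<open>Adding a multiple of a cutoff that is 1 on the support of \<phi> makes \<phi>
      nonnegative without leaving \<open>test_fun U\<close>.\<close>
    let ?b = "\<lambda>p. B * b p"
    have b': "?b \<in> test_fun U" using b by (intro test_fun_scale)
    have s: "(\<lambda>p. \<phi> p + ?b p) \<in> test_fun U" using \<phi> b' by (rule test_fun_add)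
    have "0 \<le> \<phi> p + ?b p" for p
    proof (cases "p \<in> K")
      case True
      then have "b p = 1" using b(5,6) by blast
      then show ?thesis using B(2)[of p] by simp
    next
      case False
      then show ?thesis using K(4) b(2) B(1) by simp
    qed
    then have "L (\<lambda>p. \<phi> p + ?b p) = (\<integral>p. \<phi> p + ?b p \<partial>\<mu>)"
      by (intro eq s)
    moreover have "L ?b = (\<integral>p. ?b p \<partial>\<mu>)"
      using b(2) B(1) by (intro eq b') simp
    ultimately show ?thesis
      using L_add[OF \<phi> b'] test_fun_integrable[OF \<phi> \<mu>(1,2)] test_fun_integrable[OF b' \<mu>(1,2)] by simp
  qed
  then show ?thesis using that \<mu> by blast
qed

text \<open>With \<mu> the measure generated by the content of \<open>L\<close>, the integral minus
  \<open>L\<close> is nonnegative on nonnegative functions and again bounded, so the positive case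
  represents it by \<nu>.\<close>

theorem signed_riesz:
  obtains \<mu> \<nu> where "sets \<mu> = sets borel" "finite_measure \<mu>" "sets \<nu> = sets borel" "finite_measure \<nu>"
    "\<And>\<phi>. \<phi> \<in> test_fun U \<Longrightarrow> L \<phi> = (\<integral>p. \<phi> p \<partial>\<mu>) - (\<integral>p. \<phi> p \<partial>\<nu>)"
proof -
  obtain \<mu> where \<mu>: "sets \<mu> = sets borel" "finite_measure \<mu>" "\<And>V. open V \<Longrightarrow> measure \<mu> V = content V"
    using content_measure by metis
  interpret \<mu>: finite_measure \<mu> by (rule \<mu>)
  define P where "P \<phi> = (\<integral>p. \<phi> p \<partial>\<mu>) - L \<phi>" for \<phi>
  note int = test_fun_integrable[OF _ \<mu>(1,2)]
  interpret P: bounded_functional U P "measure \<mu> (space \<mu>) + C"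
  proof
    fix \<phi> \<psi> c
    assume \<phi>: "\<phi> \<in> test_fun U"
    show "P (\<lambda>p. c * \<phi> p) = c * P \<phi>"
      using \<phi> by (simp add: P_def L_scale algebra_simps)
    show "P (\<lambda>p. \<phi> p + \<psi> p) = P \<phi> + P \<psi>" if "\<psi> \<in> test_fun U"
      using \<phi> that int by (simp add: P_def L_add)
    show "P \<phi> \<le> measure \<mu> (space \<mu>) + C" if "\<And>p. \<bar>\<phi> p\<bar> \<le> 1"
    proof -
      have "\<phi> p \<le> 1" for p using that[of p] by linarith
      then have "(\<integral>p. \<phi> p \<partial>\<mu>) \<le> (\<integral>p. 1 \<partial>\<mu>)"
        using int[OF \<phi>] by (intro integral_mono) auto
      moreover have "\<bar>L \<phi>\<bar> \<le> C * 1"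
        using \<phi> that by (intro L_bound_scaled) auto
      ultimately show ?thesis by (simp add: P_def)
    qed
  qed (rule open_U)
  obtain \<nu> where \<nu>: "sets \<nu> = sets borel" "finite_measure \<nu>" "\<And>\<phi>. \<phi> \<in> test_fun U \<Longrightarrow> P \<phi> = (\<integral>p. \<phi> p \<partial>\<nu>)"
    using P.positive_riesz L_le_integral[OF \<mu>] by (metis P_def diff_ge_0_iff_ge)
  show ?thesis
  proof (rule that[OF \<mu>(1,2) \<nu>(1,2)])
    show "L \<phi> = (\<integral>p. \<phi> p \<partial>\<mu>) - (\<integral>p. \<phi> p \<partial>\<nu>)" if "\<phi> \<in> test_fun U" for \<phi>
      using \<nu>(3)[OF that] by (simp add: P_def)
  qed
qed

end

section \<open>Exterior algebra of the Heisenberg Lie algebra\<close>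

lemma shuffle_sign_cases: "shuffle_sign A B = 1 \<or> shuffle_sign A B = - 1"
  unfolding shuffle_sign_def by (simp add: minus_one_power_iff)

lemma shuffle_sign_sq: "shuffle_sign A B * shuffle_sign A B = 1"
  using shuffle_sign_cases[of A B] by auto

lemma shuffle_sign_Un_left:
  fixes A B C :: "'i::{finite,linorder} set"
  assumes "A \<inter> B = {}"
  shows "shuffle_sign (A \<union> B) C = shuffle_sign A C * shuffle_sign B C"
proof -
  have "{(i, j). i \<in> A \<union> B \<and> j \<in> C \<and> j < i} =
      {(i, j). i \<in> A \<and> j \<in> C \<and> j < i} \<union> {(i, j). i \<in> B \<and> j \<in> C \<and> j < i}" by auto
  moreover have "{(i, j). i \<in> A \<and> j \<in> C \<and> j < i} \<inter> {(i, j). i \<in> B \<and> j \<in> C \<and> j < i} = {}"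
    using assms by auto
  ultimately show ?thesis
    by (simp add: shuffle_sign_def card_Un_disjoint power_add)
qed

lemma shuffle_sign_Un_right:
  fixes A B C :: "'i::{finite,linorder} set"
  assumes "B \<inter> C = {}"
  shows "shuffle_sign A (B \<union> C) = shuffle_sign A B * shuffle_sign A C"
proof -
  have "{(i, j). i \<in> A \<and> j \<in> B \<union> C \<and> j < i} =
      {(i, j). i \<in> A \<and> j \<in> B \<and> j < i} \<union> {(i, j). i \<in> A \<and> j \<in> C \<and> j < i}" by auto
  moreover have "{(i, j). i \<in> A \<and> j \<in> B \<and> j < i} \<inter> {(i, j). i \<in> A \<and> j \<in> C \<and> j < i} = {}"
    using assms by auto
  ultimately show ?thesis
    by (simp add: shuffle_sign_def card_Un_disjoint power_add)
qed

text \<open>For disjoint sets every pair of elements is an inversion for exactly one of the two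
  orders, so the two inversion counts add up to \<open>card A * card B\<close>.\<close>

lemma shuffle_sign_commute:
  fixes A B :: "'i::{finite,linorder} set"
  assumes "A \<inter> B = {}"
  shows "shuffle_sign A B = (- 1) ^ (card A * card B) * shuffle_sign B A"
proof -
  let ?P = "{(i, j). i \<in> A \<and> j \<in> B \<and> j < i}" and ?Q = "{(i, j). i \<in> B \<and> j \<in> A \<and> j < i}"
    and ?R = "{(i, j). i \<in> A \<and> j \<in> B \<and> i < j}"
  have "b < a \<or> a < b" if "a \<in> A" "b \<in> B" for a b
    using assms that by (metis IntI empty_iff linorder_less_linear)
  then have "A \<times> B = ?P \<union> ?R"
    by blast
  moreover have "card (?P \<union> ?R) = card ?P + card ?R"
    by (rule card_Un_disjoint) auto
  ultimately have "card A * card B = card ?P + card ?R"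
    by (simp flip: card_cartesian_product)
  also have "card ?R = card ?Q"
    by (rule bij_betw_same_card[of prod.swap]) (auto simp: bij_betw_def inj_on_def intro!: image_eqI[of _ prod.swap "(_, _)"])
  finally have "(- 1) ^ (card A * card B) * shuffle_sign B A
      = (- 1) ^ card ?P * ((- 1) ^ card ?Q * (- 1) ^ card ?Q :: real)"
    by (simp add: shuffle_sign_def power_add)
  also have "\<dots> = shuffle_sign A B"
    by (simp add: shuffle_sign_def flip: power_mult_distrib)
  finally show ?thesis by simp
qed

lemma shuffle_sign_empty [simp]: "shuffle_sign {} B = 1" "shuffle_sign A {} = 1"
  by (simp_all add: shuffle_sign_def)

lemma wedge_nth: "(a \<^bold>\<and> b) $ S = (\<Sum>A\<in>Pow S. shuffle_sign A (S - A) * a $ A * b $ (S - A))"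
  by (simp add: wedge_def)

lemma bilinear_wedge: "bilinear (\<^bold>\<and>)"
  unfolding bilinear_def
  by (auto intro!: linearI simp: vec_eq_iff wedge_nth sum.distrib sum_distrib_left algebra_simps)

lemma bounded_bilinear_wedge: "bounded_bilinear (\<^bold>\<and>)"
  using bilinear_wedge by (simp add: bilinear_conv_bounded_bilinear)

lemmas wedge_add_left = bounded_bilinear.add_left[OF bounded_bilinear_wedge]
  and wedge_add_right = bounded_bilinear.add_right[OF bounded_bilinear_wedge]
  and wedge_diff_right = bounded_bilinear.diff_right[OF bounded_bilinear_wedge]
  and wedge_minus_left = bounded_bilinear.minus_left[OF bounded_bilinear_wedge]
  and wedge_minus_right = bounded_bilinear.minus_right[OF bounded_bilinear_wedge]
  and wedge_scaleR_left = bounded_bilinear.scaleR_left[OF bounded_bilinear_wedge]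
  and wedge_scaleR_right = bounded_bilinear.scaleR_right[OF bounded_bilinear_wedge]
  and wedge_sum_left = bounded_bilinear.sum_left[OF bounded_bilinear_wedge]
  and wedge_sum_right = bounded_bilinear.sum_right[OF bounded_bilinear_wedge]
  and wedge_zero_left [simp] = bounded_bilinear.zero_left[OF bounded_bilinear_wedge]
  and wedge_zero_right [simp] = bounded_bilinear.zero_right[OF bounded_bilinear_wedge]
  and linear_wedge_left = bounded_linear.linear[OF bounded_bilinear.bounded_linear_left[OF bounded_bilinear_wedge]]
  and linear_wedge_right = bounded_linear.linear[OF bounded_bilinear.bounded_linear_right[OF bounded_bilinear_wedge]]

lemma basis_ext_nth: "basis_ext A $ S = (if S = A then 1 else 0)"
  by (auto simp: axis_def)

lemma ext_expansion: "(\<Sum>S\<in>UNIV. a $ S *\<^sub>R basis_ext S) = (a :: 'n::finite ext)"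
  using basis_expansion[of a] by (simp add: scalar_mult_eq_scaleR)

text \<open>Only basis elements that occur in \<open>a\<close> have to be checked, so degree and
  horizontality of \<open>a\<close> are available for them. Most identities of the exterior algebra
  below are reduced to basis elements in this way.\<close>

lemma ext_linear_eqI:
  fixes f g :: "'n::finite ext \<Rightarrow> 'b::real_vector"
  assumes "linear f" "linear g" "\<And>S. a $ S \<noteq> 0 \<Longrightarrow> f (basis_ext S) = g (basis_ext S)"
  shows "f a = g a"
proof -
  have "f a = (\<Sum>S\<in>UNIV. a $ S *\<^sub>R f (basis_ext S))"
    by (metis (no_types, lifting) ext_expansion assms(1) linear_scale linear_sum sum.cong)
  also have "\<dots> = (\<Sum>S\<in>UNIV. a $ S *\<^sub>R g (basis_ext S))"
    by (rule sum.cong) (use assms(3) in auto)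
  also have "\<dots> = g a"
    by (metis (no_types, lifting) ext_expansion assms(2) linear_scale linear_sum sum.cong)
  finally show ?thesis .
qed

lemma basis_wedge_nth:
  "(basis_ext A \<^bold>\<and> a) $ S = (if A \<subseteq> S then shuffle_sign A (S - A) * a $ (S - A) else 0)"
proof -
  have "(basis_ext A \<^bold>\<and> a) $ S = (\<Sum>B\<in>Pow S. if B = A then shuffle_sign A (S - A) * a $ (S - A) else 0)"
    unfolding wedge_nth by (rule sum.cong) (auto simp: basis_ext_nth)
  then show ?thesis by (simp add: sum.delta)
qed

lemma basis_wedge_basis:
  "basis_ext A \<^bold>\<and> basis_ext B = (if A \<inter> B = {} then shuffle_sign A B *\<^sub>R basis_ext (A \<union> B) else 0)"
proof (rule vec_eq_iff[THEN iffD2], intro allI)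
  fix S
  have "A \<subseteq> S \<and> S - A = B \<longleftrightarrow> A \<inter> B = {} \<and> S = A \<union> B" by blast
  then show "(basis_ext A \<^bold>\<and> basis_ext B) $ S =
      (if A \<inter> B = {} then shuffle_sign A B *\<^sub>R basis_ext (A \<union> B) else 0) $ S"
    unfolding basis_wedge_nth by (auto simp: basis_ext_nth)
qed

text \<open>Linearity extends the identity from basis elements one argument at a time, beginning
  with the last.\<close>

lemma wedge_assoc: "(a \<^bold>\<and> b) \<^bold>\<and> c = a \<^bold>\<and> (b \<^bold>\<and> c)"
proof -
  have basis: "(basis_ext A \<^bold>\<and> basis_ext B) \<^bold>\<and> basis_ext C = basis_ext A \<^bold>\<and> (basis_ext B \<^bold>\<and> basis_ext C)"
    for A B C :: "'a hidx set"
  proof (cases "A \<inter> B = {} \<and> A \<inter> C = {} \<and> B \<inter> C = {}")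
    case True
    then show ?thesis
      by (simp add: basis_wedge_basis wedge_scaleR_left wedge_scaleR_right Int_Un_distrib Int_Un_distrib2
          shuffle_sign_Un_left shuffle_sign_Un_right Un_assoc)
  next
    case False
    then show ?thesis
      by (auto simp: basis_wedge_basis wedge_scaleR_left wedge_scaleR_right Int_Un_distrib Int_Un_distrib2)
  qed
  have 1: "(basis_ext A \<^bold>\<and> basis_ext B) \<^bold>\<and> c = basis_ext A \<^bold>\<and> (basis_ext B \<^bold>\<and> c)" for A B
    by (rule ext_linear_eqI[where f = "\<lambda>c. (basis_ext A \<^bold>\<and> basis_ext B) \<^bold>\<and> c"
          and g = "\<lambda>c. basis_ext A \<^bold>\<and> (basis_ext B \<^bold>\<and> c)"])
      (auto intro: linear_wedge_right linear_compose[OF linear_wedge_right linear_wedge_right, unfolded o_def] basis)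
  have 2: "(basis_ext A \<^bold>\<and> b) \<^bold>\<and> c = basis_ext A \<^bold>\<and> (b \<^bold>\<and> c)" for A
    by (rule ext_linear_eqI[where f = "\<lambda>b. (basis_ext A \<^bold>\<and> b) \<^bold>\<and> c"
          and g = "\<lambda>b. basis_ext A \<^bold>\<and> (b \<^bold>\<and> c)"])
      (auto intro: linear_compose[OF linear_wedge_right linear_wedge_left, unfolded o_def]
        linear_compose[OF linear_wedge_left linear_wedge_right, unfolded o_def] 1)
  show ?thesis
    by (rule ext_linear_eqI[where f = "\<lambda>a. (a \<^bold>\<and> b) \<^bold>\<and> c" and g = "\<lambda>a. a \<^bold>\<and> (b \<^bold>\<and> c)"])
      (auto intro: linear_compose[OF linear_wedge_left linear_wedge_left, unfolded o_def] linear_wedge_left 2)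
qed

lemma subspace_graded: "subspace (graded k :: 'n::finite ext set)"
  by (auto simp: subspace_def graded_def) force

lemma gradedD: "a \<in> graded k \<Longrightarrow> a $ S \<noteq> 0 \<Longrightarrow> card S = k"
  by (auto simp: graded_def)

lemma basis_graded: "basis_ext S \<in> graded (card S)"
  by (auto simp: graded_def basis_ext_nth)

lemma wedge_graded:
  assumes "a \<in> graded k" "b \<in> graded l"
  shows "a \<^bold>\<and> b \<in> graded (k + l)"
proof -
  have "card S = k + l" if nz: "(a \<^bold>\<and> b) $ S \<noteq> 0" for S
  proof -
    obtain A where "A \<subseteq> S" "shuffle_sign A (S - A) * a $ A * b $ (S - A) \<noteq> 0"
      using nz unfolding wedge_nth by (metis (no_types, lifting) PowD sum.neutral)
    then have "card A = k" "card (S - A) = l" "A \<subseteq> S" using assms by (auto dest: gradedD)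
    then show ?thesis
      by (metis add.commute card_Diff_subset card_mono finite le_add_diff_inverse2)
  qed
  then show ?thesis by (auto simp: graded_def)
qed

lemma wedge_commute:
  assumes "a \<in> graded k" "b \<in> graded l"
  shows "a \<^bold>\<and> b = (- 1) ^ (k * l) *\<^sub>R (b \<^bold>\<and> a)"
proof -
  have basis: "basis_ext A \<^bold>\<and> basis_ext B = (- 1) ^ (card A * card B) *\<^sub>R (basis_ext B \<^bold>\<and> basis_ext A)"
    for A B :: "'a hidx set"
    using shuffle_sign_commute[of A B] by (auto simp: basis_wedge_basis Un_commute Int_commute)
  have 1: "basis_ext A \<^bold>\<and> b = (- 1) ^ (card A * l) *\<^sub>R (b \<^bold>\<and> basis_ext A)" for A
    by (rule ext_linear_eqI[where f = "\<lambda>b. basis_ext A \<^bold>\<and> b"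
          and g = "\<lambda>b. (- 1) ^ (card A * l) *\<^sub>R (b \<^bold>\<and> basis_ext A)"])
      (use gradedD[OF assms(2)] in \<open>auto intro: linear_wedge_right linear_wedge_left linear_compose_scale_right basis\<close>)
  show ?thesis
    by (rule ext_linear_eqI[where f = "\<lambda>a. a \<^bold>\<and> b" and g = "\<lambda>a. (- 1) ^ (k * l) *\<^sub>R (b \<^bold>\<and> a)"])
      (use gradedD[OF assms(1)] in \<open>auto intro: linear_wedge_right linear_wedge_left linear_compose_scale_right 1\<close>)
qed

section \<open>Horizontal covectors, theta and dtheta\<close>

definition horizontal :: "'n::finite ext set" where
  "horizontal = {a. \<forall>S. It \<in> S \<longrightarrow> a $ S = 0}"

lemma horizontal_graded_eq: "horizontal_graded k = graded k \<inter> horizontal"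
  by (auto simp: horizontal_graded_def horizontal_def)

lemma subspace_horizontal: "subspace horizontal"
  by (auto simp: subspace_def horizontal_def)

lemma subspace_horizontal_graded: "subspace (horizontal_graded k)"
  unfolding horizontal_graded_eq by (intro subspace_inter subspace_graded subspace_horizontal)

lemma basis_horizontal: "It \<notin> S \<Longrightarrow> basis_ext S \<in> horizontal"
  by (auto simp: horizontal_def basis_ext_nth)

lemma wedge_horizontal:
  assumes "a \<in> horizontal" "b \<in> horizontal"
  shows "a \<^bold>\<and> b \<in> horizontal"
proof -
  have "shuffle_sign A (S - A) * a $ A * b $ (S - A) = 0" if "It \<in> S" "A \<subseteq> S" for A S
    using that assms by (cases "It \<in> A") (auto simp: horizontal_def)
  then show ?thesis by (auto simp: horizontal_def wedge_nth intro!: sum.neutral)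
qed

lemma theta_graded: "theta \<in> graded 1"
  using basis_graded[of "{It}"] by (simp add: theta_def)

lemma basis_singleton_graded: "basis_ext {i} \<in> graded 1"
  using basis_graded[of "{i}"] by simp

lemma dtheta_graded: "dtheta \<in> graded 2"
  unfolding dtheta_def
proof (intro subspace_neg subspace_sum subspace_graded)
  fix j
  show "basis_ext {Ix j} \<^bold>\<and> basis_ext {Iy j} \<in> graded 2"
    using wedge_graded[OF basis_singleton_graded basis_singleton_graded] by (simp add: numeral_2_eq_2)
qed

lemma dtheta_horizontal: "dtheta \<in> horizontal"
  unfolding dtheta_def
  by (intro subspace_neg subspace_sum subspace_horizontal wedge_horizontal basis_horizontal) auto

lemma dtheta_commute: "dtheta \<^bold>\<and> a = a \<^bold>\<and> dtheta"
  by (rule ext_linear_eqI[where f = "\<lambda>a. dtheta \<^bold>\<and> a" and g = "\<lambda>a. a \<^bold>\<and> dtheta"])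
    (use wedge_commute[OF dtheta_graded basis_graded] in
      \<open>auto intro: linear_wedge_right linear_wedge_left simp: power_mult\<close>)

lemma theta_commute: "a \<in> graded k \<Longrightarrow> theta \<^bold>\<and> a = (- 1) ^ k *\<^sub>R (a \<^bold>\<and> theta)"
  using wedge_commute[OF theta_graded] by simp

lemma theta_theta: "theta \<^bold>\<and> theta = 0"
  by (simp add: theta_def basis_wedge_basis)

lemma less_eq_It: "i \<le> (It :: 'a::linorder hidx)"
  by (cases i) auto

text \<open>\<open>It\<close> is the largest index, so appending it on the right costs no
  sign.\<close>

lemma basis_wedge_theta: "basis_ext S \<^bold>\<and> theta = (if It \<in> S then 0 else basis_ext (insert It S))"
proof -
  have "{(i, j). i \<in> S \<and> j \<in> {It} \<and> j < i} = {}"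
    using less_eq_It by (auto simp: not_less)
  then have "shuffle_sign S {It} = 1"
    unfolding shuffle_sign_def by (simp only: card.empty power_0)
  then show ?thesis
    by (simp add: theta_def basis_wedge_basis)
qed

lemma basis_ext_cases:
  obtains "basis_ext S \<in> horizontal \<inter> graded (card S)"
  | h m where "h \<in> horizontal" "h \<in> graded m" "basis_ext S = h \<^bold>\<and> theta" "card S = Suc m"
proof (cases "It \<in> S")
  case False
  then show ?thesis using that(1) basis_horizontal basis_graded by blast
next
  case True
  have "basis_ext S = basis_ext (S - {It}) \<^bold>\<and> theta"
    using True by (simp add: basis_wedge_theta insert_absorb)
  moreover have "card S = Suc (card (S - {It}))"
    using card_Suc_Diff1[OF finite True] by simp
  moreover have "basis_ext (S - {It}) \<in> horizontal" "basis_ext (S - {It}) \<in> graded (card (S - {It}))"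
    by (auto intro: basis_horizontal basis_graded)
  ultimately show ?thesis
    using that(2) by blast
qed

lemma wedge_theta_eq_0_if_horizontal_part_0:
  assumes "horizontal_part a = 0"
  shows "a \<^bold>\<and> theta = 0"
  by (rule ext_linear_eqI[where f = "\<lambda>a. a \<^bold>\<and> theta" and g = "\<lambda>a. 0"])
    (use assms in \<open>auto intro: linear_wedge_left linear_zero simp: basis_wedge_theta horizontal_part_def vec_eq_iff
      split: if_splits\<close>)

text \<open>The Chevalley-Eilenberg differential of the Lie algebra: the exterior derivative on left
  invariant forms, and the part of order zero of \<open>ext_d\<close>.\<close>

definition d_coeff :: "'n::{finite,linorder} ext \<Rightarrow> 'n ext" where
  "d_coeff a = (\<Sum>S\<in>UNIV. a $ S *\<^sub>R d_basis S)"

lemma linear_d_coeff: "linear d_coeff"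
  by (auto intro!: linearI simp: d_coeff_def scaleR_add_left sum.distrib scaleR_sum_right)

lemma d_coeff_basis: "d_coeff (basis_ext S) = d_basis S"
  by (simp add: d_coeff_def basis_ext_nth if_distrib[of "\<lambda>x. x *\<^sub>R _"] cong: if_cong)

lemma d_coeff_horizontal:
  assumes "a \<in> horizontal"
  shows "d_coeff a = 0"
  unfolding d_coeff_def
  by (rule sum.neutral) (use assms in \<open>auto simp: horizontal_def d_basis_def\<close>)

lemma d_coeff_wedge_theta:
  assumes "a \<in> horizontal" "a \<in> graded m"
  shows "d_coeff (a \<^bold>\<and> theta) = (- 1) ^ m *\<^sub>R (a \<^bold>\<and> dtheta)"
proof (rule ext_linear_eqI[where f = "\<lambda>a. d_coeff (a \<^bold>\<and> theta)" and g = "\<lambda>a. (- 1) ^ m *\<^sub>R (a \<^bold>\<and> dtheta)"])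
  fix S assume S: "a $ S \<noteq> 0"
  then have "It \<notin> S" "card S = m" using assms by (auto simp: horizontal_def graded_def)
  then show "d_coeff (basis_ext S \<^bold>\<and> theta) = (- 1) ^ m *\<^sub>R (basis_ext S \<^bold>\<and> dtheta)"
    by (simp add: basis_wedge_theta d_coeff_basis d_basis_def)
qed (auto intro: linear_compose[OF linear_wedge_left linear_d_coeff, unfolded o_def]
    linear_wedge_left linear_compose_scale_right)

text \<open>\<open>d_basis\<close> trades the factor \<open>theta\<close> for \<open>dtheta\<close>,
  so no \<open>theta\<close> is left; this is why \<open>d_coeff\<close> squares to 0.\<close>

lemma d_coeff_is_horizontal: "d_coeff a \<in> horizontal"
  unfolding d_coeff_def d_basis_def
  by (auto intro!: subspace_sum subspace_scale subspace_horizontal wedge_horizontal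
      basis_horizontal dtheta_horizontal subspace_0)

lemma d_coeff_d_coeff: "d_coeff (d_coeff a) = 0"
  by (rule d_coeff_horizontal[OF d_coeff_is_horizontal])

lemma d_basis_singleton: "d_basis {i} = (if i = It then dtheta else 0)"
proof -
  have "basis_ext {} \<^bold>\<and> dtheta = dtheta"
    by (simp add: vec_eq_iff basis_wedge_nth)
  then show ?thesis by (auto simp: d_basis_def)
qed

lemma d_coeff_graded: "a \<in> graded k \<Longrightarrow> d_coeff a \<in> graded (Suc k)"
  unfolding d_coeff_def d_basis_def
proof (intro subspace_sum subspace_graded)
  fix S
  assume a: "a \<in> graded k"
  show "a $ S *\<^sub>R (if It \<in> S then (- 1) ^ card (S - {It}) *\<^sub>R (basis_ext (S - {It}) \<^bold>\<and> dtheta) else 0)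
      \<in> graded (Suc k)"
  proof (cases "a $ S \<noteq> 0 \<and> It \<in> S")
    case True
    then have "card (S - {It}) + 2 = Suc k"
      using gradedD[OF a, of S] card_Suc_Diff1[of S It] by simp
    then have "basis_ext (S - {It}) \<^bold>\<and> dtheta \<in> graded (Suc k)"
      using wedge_graded[OF basis_graded dtheta_graded, of "S - {It}"] by simp
    then show ?thesis
      by (simp add: subspace_scale subspace_graded True)
  next
    case False
    then have "a $ S *\<^sub>R (if It \<in> S then (- 1) ^ card (S - {It}) *\<^sub>R (basis_ext (S - {It}) \<^bold>\<and> dtheta) else 0) = 0"
      by auto
    then show ?thesis by (simp only: subspace_0 subspace_graded)
  qed
qed

lemma d_coeff_leibniz_theta:
  assumes "a \<in> graded k"
  shows "d_coeff (a \<^bold>\<and> theta) = d_coeff a \<^bold>\<and> theta + (- 1) ^ k *\<^sub>R (a \<^bold>\<and> dtheta)"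
proof (rule ext_linear_eqI[where f = "\<lambda>a. d_coeff (a \<^bold>\<and> theta)"
      and g = "\<lambda>a. d_coeff a \<^bold>\<and> theta + (- 1) ^ k *\<^sub>R (a \<^bold>\<and> dtheta)"])
  fix S assume S: "a $ S \<noteq> 0"
  then have k: "card S = k" using assms by (rule gradedD[rotated])
  show "d_coeff (basis_ext S \<^bold>\<and> theta) =
      d_coeff (basis_ext S) \<^bold>\<and> theta + (- 1) ^ k *\<^sub>R (basis_ext S \<^bold>\<and> dtheta)"
  proof (rule basis_ext_cases[of S])
    assume "basis_ext S \<in> horizontal \<inter> graded (card S)"
    then show ?thesis
      using k by (simp add: d_coeff_wedge_theta[of _ k] d_coeff_horizontal)
  next
    fix h :: "'a ext" and m
    assume h: "h \<in> horizontal" "h \<in> graded m" "basis_ext S = h \<^bold>\<and> theta" "card S = Suc m"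
    \<comment> \<open>Here the left side is 0 because \<open>theta\<close> occurs twice, and the two
      terms on the right cancel since \<open>card S = Suc m\<close>.\<close>
    have "(h \<^bold>\<and> dtheta) \<^bold>\<and> theta = (h \<^bold>\<and> theta) \<^bold>\<and> dtheta"
      unfolding wedge_assoc by (simp add: dtheta_commute)
    then show ?thesis
      using h k by (simp add: d_coeff_wedge_theta wedge_assoc[of h theta theta] theta_theta
          linear_0[OF linear_d_coeff] wedge_scaleR_left)
  qed
qed (auto intro!: linear_compose[OF linear_wedge_left linear_d_coeff, unfolded o_def]
    linear_compose[OF linear_d_coeff linear_wedge_left, unfolded o_def]
    linear_wedge_left linear_compose_scale_right linear_compose_add)

lemma d_coeff_leibniz_dtheta: "d_coeff (a \<^bold>\<and> dtheta) = d_coeff a \<^bold>\<and> dtheta"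
proof (rule ext_linear_eqI[where f = "\<lambda>a. d_coeff (a \<^bold>\<and> dtheta)" and g = "\<lambda>a. d_coeff a \<^bold>\<and> dtheta"])
  fix S :: "'a hidx set"
  show "d_coeff (basis_ext S \<^bold>\<and> dtheta) = d_coeff (basis_ext S) \<^bold>\<and> dtheta"
  proof (rule basis_ext_cases[of S])
    assume "basis_ext S \<in> horizontal \<inter> graded (card S)"
    then show ?thesis
      by (simp add: d_coeff_horizontal wedge_horizontal dtheta_horizontal)
  next
    fix h :: "'a ext" and m
    assume h: "h \<in> horizontal" "h \<in> graded m" "basis_ext S = h \<^bold>\<and> theta"
    have eq: "basis_ext S \<^bold>\<and> dtheta = (h \<^bold>\<and> dtheta) \<^bold>\<and> theta"
      unfolding h wedge_assoc by (simp only: dtheta_commute)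
    have "d_coeff (basis_ext S \<^bold>\<and> dtheta) = (- 1) ^ (m + 2) *\<^sub>R ((h \<^bold>\<and> dtheta) \<^bold>\<and> dtheta)"
      unfolding eq
      by (rule d_coeff_wedge_theta[OF wedge_horizontal[OF h(1) dtheta_horizontal] wedge_graded[OF h(2) dtheta_graded]])
    also have "\<dots> = d_coeff (basis_ext S) \<^bold>\<and> dtheta"
      unfolding h(3) d_coeff_wedge_theta[OF h(1,2)] by (simp add: wedge_scaleR_left)
    finally show ?thesis .
  qed
qed (auto intro!: linear_compose[OF linear_wedge_left linear_d_coeff, unfolded o_def]
    linear_compose[OF linear_d_coeff linear_wedge_left, unfolded o_def])

text \<open>A factor of degree 1 on the left gives the minus sign. In the proof that
  \<open>ext_d\<close> squares to 0 this rule supplies the terms that cancel the brackets of the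
  frame and the mixed terms.\<close>

lemma d_coeff_leibniz_basis:
  "d_coeff (basis_ext {i} \<^bold>\<and> a) = d_basis {i} \<^bold>\<and> a - basis_ext {i} \<^bold>\<and> d_coeff a"
proof (rule ext_linear_eqI[where f = "\<lambda>a. d_coeff (basis_ext {i} \<^bold>\<and> a)"
      and g = "\<lambda>a. d_basis {i} \<^bold>\<and> a - basis_ext {i} \<^bold>\<and> d_coeff a"])
  fix S :: "'a hidx set"
  note e1 = basis_singleton_graded[of i]
  show "d_coeff (basis_ext {i} \<^bold>\<and> basis_ext S) =
      d_basis {i} \<^bold>\<and> basis_ext S - basis_ext {i} \<^bold>\<and> d_coeff (basis_ext S)"
  proof (cases "i = It")
    case False
    then have eh: "basis_ext {i} \<in> horizontal" by (intro basis_horizontal) auto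
    show ?thesis
    proof (rule basis_ext_cases[of S])
      assume "basis_ext S \<in> horizontal \<inter> graded (card S)"
      then show ?thesis
        using False eh by (simp add: d_coeff_horizontal wedge_horizontal d_basis_singleton)
    next
      fix h :: "'a ext" and m
      assume h: "h \<in> horizontal" "h \<in> graded m" "basis_ext S = h \<^bold>\<and> theta"
      have "d_coeff (basis_ext {i} \<^bold>\<and> basis_ext S) = (- 1) ^ (1 + m) *\<^sub>R ((basis_ext {i} \<^bold>\<and> h) \<^bold>\<and> dtheta)"
        unfolding h(3) wedge_assoc[symmetric]
        by (rule d_coeff_wedge_theta[OF wedge_horizontal[OF eh h(1)] wedge_graded[OF e1 h(2)]])
      then show ?thesis
        unfolding h(3) d_coeff_wedge_theta[OF h(1,2)] using False
        by (simp add: d_basis_singleton wedge_scaleR_right wedge_assoc)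
    qed
  next
    case True
    then have i: "basis_ext {i} = theta" "d_basis {i} = dtheta"
      by (simp_all add: theta_def d_basis_singleton)
    show ?thesis
    proof (rule basis_ext_cases[of S])
      assume "basis_ext S \<in> horizontal \<inter> graded (card S)"
      then show ?thesis
        unfolding i
        by (simp add: d_coeff_horizontal theta_commute[of "basis_ext S" "card S"] linear_scale[OF linear_d_coeff]
            d_coeff_wedge_theta[of _ "card S"] dtheta_commute[of "basis_ext S"] flip: power_mult_distrib)
    next
      fix h :: "'a ext" and m
      assume h: "h \<in> horizontal" "h \<in> graded m" "basis_ext S = h \<^bold>\<and> theta"
      have th: "theta \<^bold>\<and> (h \<^bold>\<and> x) = (- 1) ^ m *\<^sub>R (h \<^bold>\<and> (theta \<^bold>\<and> x))" for x
        using h theta_commute[OF h(2)] by (metis wedge_assoc wedge_scaleR_left)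
      have "theta \<^bold>\<and> (h \<^bold>\<and> theta) = 0" by (simp add: th theta_theta)
      moreover have "theta \<^bold>\<and> d_coeff (h \<^bold>\<and> theta) = dtheta \<^bold>\<and> (h \<^bold>\<and> theta)"
      proof -
        have "theta \<^bold>\<and> d_coeff (h \<^bold>\<and> theta) = ((- 1) ^ m * (- 1) ^ m) *\<^sub>R (h \<^bold>\<and> (theta \<^bold>\<and> dtheta))"
          unfolding d_coeff_wedge_theta[OF h(1,2)] by (simp add: wedge_scaleR_right th)
        also have "\<dots> = dtheta \<^bold>\<and> (h \<^bold>\<and> theta)"
          unfolding dtheta_commute[of "h \<^bold>\<and> theta"] by (simp add: wedge_assoc flip: power_mult_distrib)
        finally show ?thesis .
      qed
      ultimately show ?thesis
        unfolding i h by (simp add: linear_0[OF linear_d_coeff])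
    qed
  qed
qed (auto intro!: linear_compose[OF linear_wedge_right linear_d_coeff, unfolded o_def]
    linear_compose[OF linear_d_coeff linear_wedge_right, unfolded o_def]
    linear_wedge_right linear_compose_sub)

section \<open>The Lefschetz isomorphism and the Rumin fibres\<close>

definition vertical :: "'n::finite ext set" where
  "vertical = {a. \<forall>S. It \<notin> S \<longrightarrow> a $ S = 0}"

lemma vertical_wedge_left:
  assumes "a \<in> vertical"
  shows "a \<^bold>\<and> b \<in> vertical"
proof -
  have "a $ A = 0" if "It \<notin> S" "A \<subseteq> S" for A S
    using assms that by (auto simp: vertical_def)
  then show ?thesis
    by (auto simp: vertical_def wedge_nth intro!: sum.neutral)
qed

lemma vertical_wedge_right:
  assumes "b \<in> vertical"
  shows "a \<^bold>\<and> b \<in> vertical"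
proof -
  have "b $ (S - A) = 0" if "It \<notin> S" for A S
    using assms that by (auto simp: vertical_def)
  then show ?thesis
    by (auto simp: vertical_def wedge_nth intro!: sum.neutral)
qed

lemma theta_vertical: "theta \<in> vertical"
  by (auto simp: vertical_def theta_def basis_ext_nth)

lemma horizontal_part_eq_0_iff: "horizontal_part a = 0 \<longleftrightarrow> a \<in> vertical"
  by (auto simp: horizontal_part_def vertical_def vec_eq_iff)

lemma linear_horizontal_part: "linear horizontal_part"
  by (auto intro!: linearI simp: horizontal_part_def vec_eq_iff)

lemma horizontal_part_of_horizontal: "a \<in> horizontal \<Longrightarrow> horizontal_part a = a"
  by (auto simp: horizontal_part_def horizontal_def vec_eq_iff)

lemma horizontal_part_horizontal: "horizontal_part a \<in> horizontal"
  by (auto simp: horizontal_part_def horizontal_def)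

lemma horizontal_part_graded: "a \<in> graded k \<Longrightarrow> horizontal_part a \<in> horizontal_graded k"
  by (auto simp: horizontal_part_def horizontal_graded_def graded_def)

lemma diff_horizontal_part: "a - horizontal_part a \<in> vertical"
  by (auto simp: horizontal_part_def vertical_def)

lemma horizontal_part_wedge_dtheta: "horizontal_part (a \<^bold>\<and> dtheta) = horizontal_part a \<^bold>\<and> dtheta"
proof -
  have "horizontal_part (a \<^bold>\<and> dtheta) =
      horizontal_part (horizontal_part a \<^bold>\<and> dtheta) + horizontal_part ((a - horizontal_part a) \<^bold>\<and> dtheta)"
    unfolding linear_add[OF linear_horizontal_part, symmetric] wedge_add_left[symmetric] by simp
  moreover have "horizontal_part ((a - horizontal_part a) \<^bold>\<and> dtheta) = 0"
    by (simp add: horizontal_part_eq_0_iff vertical_wedge_left diff_horizontal_part)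
  moreover have "horizontal_part (horizontal_part a \<^bold>\<and> dtheta) = horizontal_part a \<^bold>\<and> dtheta"
    by (intro horizontal_part_of_horizontal wedge_horizontal horizontal_part_horizontal dtheta_horizontal)
  ultimately show ?thesis by simp
qed

lemma horizontal_part_wedge_theta: "horizontal_part (a \<^bold>\<and> theta) = 0"
  by (simp add: horizontal_part_eq_0_iff vertical_wedge_right theta_vertical)

lemma vertical_wedge_theta: "a \<in> vertical \<Longrightarrow> a \<^bold>\<and> theta = 0"
  by (rule wedge_theta_eq_0_if_horizontal_part_0) (simp add: horizontal_part_eq_0_iff)

lemma theta_wedge_vertical:
  assumes "a \<in> vertical"
  shows "theta \<^bold>\<and> a = 0"
proof (rule ext_linear_eqI[where f = "\<lambda>a. theta \<^bold>\<and> a" and g = "\<lambda>a. 0"])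
  fix S assume "a $ S \<noteq> 0"
  then have "It \<in> S" using assms by (auto simp: vertical_def)
  then show "theta \<^bold>\<and> basis_ext S = 0"
    by (simp add: theta_def basis_wedge_basis)
qed (auto intro: linear_wedge_right linear_zero)

lemma theta_wedge_horizontal_part: "theta \<^bold>\<and> horizontal_part a = theta \<^bold>\<and> a"
  using theta_wedge_vertical[OF diff_horizontal_part[of a]] by (simp add: wedge_diff_right)

text \<open>This is degree k - m, except that only 0 is left if k < m, where truncated subtraction
  would give degree 0. It matches the degree conditions in \<open>fibre_I\<close>.\<close>

definition shifted_graded :: "nat \<Rightarrow> nat \<Rightarrow> 'n::finite ext set" where
  "shifted_graded m k = {a. \<forall>S. a $ S \<noteq> 0 \<longrightarrow> card S + m = k}"

lemma shifted_graded_cases: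
  assumes "a \<in> shifted_graded m k"
  obtains "a = 0" | j where "j + m = k" "a \<in> graded j"
proof (cases "a = 0")
  case False
  then obtain S where "a $ S \<noteq> 0" by (auto simp: vec_eq_iff)
  then have "card S + m = k" using assms by (auto simp: shifted_graded_def)
  moreover have "a \<in> graded (card S)"
    using assms \<open>card S + m = k\<close> by (auto simp: shifted_graded_def graded_def)
  ultimately show ?thesis by (rule that(2))
qed (rule that(1))

lemma shifted_gradedI: "a \<in> graded j \<Longrightarrow> j + m = k \<Longrightarrow> a \<in> shifted_graded m k"
  by (auto simp: shifted_graded_def graded_def)

lemma subspace_shifted_graded: "subspace (shifted_graded m k)"
  by (auto simp: subspace_def shifted_graded_def) force

lemma fibre_I_eq: "fibre_I k = {a \<^bold>\<and> theta + b \<^bold>\<and> dtheta | a b. a \<in> shifted_graded 1 k \<and> b \<in> shifted_graded 2 k}"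
  by (simp add: fibre_I_def shifted_graded_def)

lemma fibre_I_eq_image:
  "fibre_I k = (\<lambda>(a, b). a \<^bold>\<and> theta + b \<^bold>\<and> dtheta) ` (shifted_graded 1 k \<times> shifted_graded 2 k)"
  unfolding fibre_I_eq by auto

lemma linear_theta_dtheta: "linear (\<lambda>(a, b). a \<^bold>\<and> theta + b \<^bold>\<and> dtheta)"
  by (auto intro!: linearI simp: wedge_add_left wedge_scaleR_left algebra_simps)

lemma subspace_shifted_prod: "subspace (shifted_graded 1 k \<times> shifted_graded 2 k)"
  by (intro subspace_Times subspace_shifted_graded)

lemma subspace_fibre_I: "subspace (fibre_I k)"
  unfolding fibre_I_eq_image by (intro linear_subspace_image linear_theta_dtheta subspace_shifted_prod)

text \<open>The two factors are chosen linearly in the covector, so that pointwise application to a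
  smooth section of \<open>fibre_I\<close> yields smooth factors of \<open>theta\<close> and
  \<open>dtheta\<close>.\<close>

lemma fibre_I_select:
  obtains A B :: "'n::{finite,linorder} ext \<Rightarrow> 'n ext"
  where "linear A" "linear B" "\<And>c. A c \<in> shifted_graded 1 k" "\<And>c. B c \<in> shifted_graded 2 k"
    "\<And>c. c \<in> fibre_I k \<Longrightarrow> c = A c \<^bold>\<and> theta + B c \<^bold>\<and> dtheta"
proof -
  obtain g :: "'n ext \<Rightarrow> 'n ext \<times> 'n ext"
    where g: "range g \<subseteq> shifted_graded 1 k \<times> shifted_graded 2 k" "linear g"
      "\<And>c. c \<in> fibre_I k \<Longrightarrow> (\<lambda>(a, b). a \<^bold>\<and> theta + b \<^bold>\<and> dtheta) (g c) = c"
    using linear_exists_right_inverse_on[OF linear_theta_dtheta subspace_shifted_prod[of k]]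
    unfolding fibre_I_eq_image by metis
  show ?thesis
  proof (rule that[of "\<lambda>c. fst (g c)" "\<lambda>c. snd (g c)"])
    show "linear (\<lambda>c. fst (g c))" "linear (\<lambda>c. snd (g c))"
      using linear_compose[OF g(2) linear_fst] linear_compose[OF g(2) linear_snd] by (simp_all add: o_def)
    have "g c \<in> shifted_graded 1 k \<times> shifted_graded 2 k" for c using g(1) by blast
    then show "fst (g c) \<in> shifted_graded 1 k" "snd (g c) \<in> shifted_graded 2 k" for c
      by (metis mem_Times_iff)+
    show "c = fst (g c) \<^bold>\<and> theta + snd (g c) \<^bold>\<and> dtheta" if "c \<in> fibre_I k" for c
      using g(3)[OF that] by (simp add: case_prod_beta)
  qed
qed

lemma fibre_I_graded:
  assumes "c \<in> fibre_I k"
  shows "c \<in> graded k"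
proof -
  obtain a b where c: "c = a \<^bold>\<and> theta + b \<^bold>\<and> dtheta" "a \<in> shifted_graded 1 k" "b \<in> shifted_graded 2 k"
    using assms unfolding fibre_I_eq by blast
  have "a \<^bold>\<and> theta \<in> graded k"
    using c(2) by (rule shifted_graded_cases)
      (use wedge_graded[OF _ theta_graded] subspace_0[OF subspace_graded] in auto)
  moreover have "b \<^bold>\<and> dtheta \<in> graded k"
    using c(3) by (rule shifted_graded_cases)
      (use wedge_graded[OF _ dtheta_graded] subspace_0[OF subspace_graded] in auto)
  ultimately show ?thesis
    unfolding c(1) by (intro subspace_add subspace_graded)
qed

lemma basis_wedge_shifted_graded:
  assumes "a \<in> shifted_graded m k"
  shows "basis_ext {i} \<^bold>\<and> a \<in> shifted_graded m (Suc k)"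
proof -
  show ?thesis
    using assms
  proof (rule shifted_graded_cases)
    assume "a = 0"
    then show ?thesis by (simp add: shifted_graded_def)
  next
    fix j assume "j + m = k" "a \<in> graded j"
    then show ?thesis
      using wedge_graded[OF basis_singleton_graded[of i], of a j] by (intro shifted_gradedI) auto
  qed
qed

lemma fibre_I_basis_wedge:
  assumes "c \<in> fibre_I k"
  shows "basis_ext {i} \<^bold>\<and> c \<in> fibre_I (Suc k)"
proof -
  obtain a b where c: "c = a \<^bold>\<and> theta + b \<^bold>\<and> dtheta" "a \<in> shifted_graded 1 k" "b \<in> shifted_graded 2 k"
    using assms unfolding fibre_I_eq by blast
  have "basis_ext {i} \<^bold>\<and> c = (basis_ext {i} \<^bold>\<and> a) \<^bold>\<and> theta + (basis_ext {i} \<^bold>\<and> b) \<^bold>\<and> dtheta"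
    unfolding c(1) wedge_add_right wedge_assoc ..
  then show ?thesis
    unfolding fibre_I_eq using c(2,3) basis_wedge_shifted_graded by blast
qed

lemma d_coeff_shifted_graded:
  assumes "a \<in> shifted_graded m k"
  shows "d_coeff a \<in> shifted_graded m (Suc k)"
proof -
  show ?thesis
    using assms
  proof (rule shifted_graded_cases)
    assume "a = 0"
    then show ?thesis by (simp add: linear_0[OF linear_d_coeff] shifted_graded_def)
  next
    fix j assume "j + m = k" "a \<in> graded j"
    then show ?thesis using d_coeff_graded by (intro shifted_gradedI) auto
  qed
qed

text \<open>Differentiating the factor \<open>theta\<close> of the first summand gives a multiple of
  \<open>dtheta\<close>, which the second summand absorbs. The degrees fit because
  \<open>card S + 1 = k\<close> says the same as \<open>card S + 2 = Suc k\<close>.\<close>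

lemma fibre_I_d_coeff:
  assumes "c \<in> fibre_I k"
  shows "d_coeff c \<in> fibre_I (Suc k)"
proof -
  obtain a b where c: "c = a \<^bold>\<and> theta + b \<^bold>\<and> dtheta" "a \<in> shifted_graded 1 k" "b \<in> shifted_graded 2 k"
    using assms unfolding fibre_I_eq by blast
  have "a \<in> graded (k - 1)"
    using c(2) by (rule shifted_graded_cases) (auto simp: subspace_0[OF subspace_graded])
  then have "d_coeff c = d_coeff a \<^bold>\<and> theta + ((- 1) ^ (k - 1) *\<^sub>R a + d_coeff b) \<^bold>\<and> dtheta"
    unfolding c(1) linear_add[OF linear_d_coeff] d_coeff_leibniz_dtheta
    by (simp add: d_coeff_leibniz_theta wedge_add_left wedge_scaleR_left)
  moreover have "a \<in> shifted_graded 2 (Suc k)"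
    using c(2) by (simp add: shifted_graded_def)
  then have "(- 1) ^ (k - 1) *\<^sub>R a + d_coeff b \<in> shifted_graded 2 (Suc k)"
    using d_coeff_shifted_graded[OF c(3)] by (intro subspace_add subspace_scale subspace_shifted_graded)
  ultimately show ?thesis
    unfolding fibre_I_eq using d_coeff_shifted_graded[OF c(2)] by blast
qed

lemma subspace_fibre_J: "subspace (fibre_J k)"
  unfolding subspace_def
  by (auto simp: fibre_J_def wedge_add_left wedge_scaleR_left
      subspace_0[OF subspace_graded] subspace_add[OF subspace_graded] subspace_scale[OF subspace_graded])

lemma fibre_J_basis_wedge:
  assumes "c \<in> fibre_J k"
  shows "basis_ext {i} \<^bold>\<and> c \<in> fibre_J (Suc k)"
  using assms wedge_graded[OF basis_singleton_graded[of i], of c k] by (simp add: fibre_J_def wedge_assoc)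

text \<open>The Leibniz rule for the vanishing product with \<open>theta\<close> has as second term
  the product with \<open>dtheta\<close>, which vanishes too, so both conditions pass to the
  derivative.\<close>

lemma fibre_J_d_coeff:
  assumes "c \<in> fibre_J k"
  shows "d_coeff c \<in> fibre_J (Suc k)"
proof -
  have c: "c \<in> graded k" "c \<^bold>\<and> theta = 0" "c \<^bold>\<and> dtheta = 0" using assms by (auto simp: fibre_J_def)
  then show ?thesis
    using d_coeff_graded[OF c(1)] d_coeff_leibniz_theta[OF c(1)] d_coeff_leibniz_dtheta[of c]
    by (simp add: fibre_J_def linear_0[OF linear_d_coeff])
qed

lemma subspace_rumin_fibre: "subspace (rumin_fibre k)"
  by (simp add: rumin_fibre_def subspace_graded subspace_fibre_J)

lemma subspace_rumin_null: "subspace (rumin_null k)"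
  by (simp add: rumin_null_def subspace_fibre_I)

lemma rumin_fibre_graded: "rumin_fibre k \<subseteq> graded k"
  by (auto simp: rumin_fibre_def fibre_J_def)

lemma rumin_null_subset: "rumin_null k \<subseteq> rumin_fibre k"
  using subspace_0[OF subspace_fibre_J] by (auto simp: rumin_fibre_def rumin_null_def fibre_I_graded)

section \<open>Lefschetz operators on horizontal covectors\<close>

definition xy_pair :: "'n \<Rightarrow> 'n hidx set" where
  "xy_pair j = {Ix j, Iy j}"

text \<open>The Lefschetz operator: the wedge product with the standard symplectic form, the sum of
  the dx_j dy_j, which is \<open>dtheta\<close> up to sign.\<close>

definition raise :: "'n::{finite,linorder} ext \<Rightarrow> 'n ext" where
  "raise a = (\<chi> S. \<Sum>j\<in>UNIV. if xy_pair j \<subseteq> S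
     then shuffle_sign (xy_pair j) (S - xy_pair j) * a $ (S - xy_pair j) else 0)"

text \<open>The dual Lefschetz operator, that is, the adjoint of \<open>raise\<close>.\<close>

definition lower :: "'n::{finite,linorder} ext \<Rightarrow> 'n ext" where
  "lower b = (\<chi> R. \<Sum>j\<in>UNIV. if xy_pair j \<inter> R = {}
     then shuffle_sign (xy_pair j) R * b $ (R \<union> xy_pair j) else 0)"

lemma card_xy_pair: "card (xy_pair j) = 2"
  by (simp add: xy_pair_def)

lemma xy_pair_disjoint: "i \<noteq> j \<Longrightarrow> xy_pair i \<inter> xy_pair j = {}"
  by (auto simp: xy_pair_def)

lemma dtheta_wedge: "dtheta \<^bold>\<and> a = - raise a"
proof -
  have *: "basis_ext {Ix j} \<^bold>\<and> basis_ext {Iy j} = basis_ext (xy_pair j)" for j :: 'a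
  proof -
    have "{(i, i'). i \<in> {Ix j} \<and> i' \<in> {Iy j} \<and> i' < i} = {}"
      by (auto simp: less_hidx_def)
    then have "shuffle_sign {Ix j} {Iy j} = 1"
      unfolding shuffle_sign_def by (simp only: card.empty power_0)
    moreover have "{Ix j} \<union> {Iy j} = xy_pair j" by (auto simp: xy_pair_def)
    ultimately show ?thesis by (simp add: basis_wedge_basis)
  qed
  show ?thesis
    unfolding dtheta_def wedge_minus_left wedge_sum_left *
    by (simp add: vec_eq_iff raise_def basis_wedge_nth)
qed

text \<open>For each j, removing and adding the pair exchanges the sets that contain it with those
  disjoint from it and matches the two sums term by term.\<close>

lemma raise_inner: "raise a \<bullet> b = a \<bullet> lower b"
proof -
  have swap: "(\<Sum>S\<in>UNIV. if xy_pair j \<subseteq> S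
       then shuffle_sign (xy_pair j) (S - xy_pair j) * a $ (S - xy_pair j) * b $ S else 0) =
     (\<Sum>R\<in>UNIV. if xy_pair j \<inter> R = {}
       then a $ R * (shuffle_sign (xy_pair j) R * b $ (R \<union> xy_pair j)) else 0)" for j
  proof -
    have "(\<Sum>S\<in>{S. xy_pair j \<subseteq> S}. shuffle_sign (xy_pair j) (S - xy_pair j) * a $ (S - xy_pair j) * b $ S) =
      (\<Sum>R\<in>{R. xy_pair j \<inter> R = {}}. a $ R * (shuffle_sign (xy_pair j) R * b $ (R \<union> xy_pair j)))"
    proof (rule sum.reindex_bij_witness[of _ "\<lambda>R. R \<union> xy_pair j" "\<lambda>S. S - xy_pair j"])
      fix S assume S: "S \<in> {S. xy_pair j \<subseteq> S}"
      then show "S - xy_pair j \<union> xy_pair j = S" by blast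
      then show "a $ (S - xy_pair j) * (shuffle_sign (xy_pair j) (S - xy_pair j) * b $ (S - xy_pair j \<union> xy_pair j))
          = shuffle_sign (xy_pair j) (S - xy_pair j) * a $ (S - xy_pair j) * b $ S"
        by simp
    qed auto
    then show ?thesis by (simp add: sum.If_cases)
  qed
  have "raise a \<bullet> b = (\<Sum>j\<in>UNIV. \<Sum>S\<in>UNIV. if xy_pair j \<subseteq> S
       then shuffle_sign (xy_pair j) (S - xy_pair j) * a $ (S - xy_pair j) * b $ S else 0)"
    unfolding inner_vec_def raise_def
    by (subst sum.swap) (auto simp: sum_distrib_right intro!: sum.cong)
  also have "\<dots> = a \<bullet> lower b"
    unfolding swap inner_vec_def lower_def
    by (subst sum.swap) (auto simp: sum_distrib_left intro!: sum.cong)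
  finally show ?thesis .
qed

text \<open>Each j contributes 1 minus the number of its two coordinates in \<open>R\<close>. The
  left side will be the diagonal entry of the commutator of \<open>lower\<close> and
  \<open>raise\<close>.\<close>

lemma count_xy_pairs:
  fixes R :: "'n::{finite,linorder} hidx set"
  assumes "It \<notin> R"
  shows "(\<Sum>j\<in>UNIV. (if xy_pair j \<inter> R = {} then 1 else 0) - (if xy_pair j \<subseteq> R then 1 else 0))
    = real CARD('n) - real (card R)"
proof -
  let ?X = "{j. Ix j \<in> R}" and ?Y = "{j. Iy j \<in> R}"
  have "R = Ix ` ?X \<union> Iy ` ?Y"
  proof (rule set_eqI)
    fix i show "i \<in> R \<longleftrightarrow> i \<in> Ix ` ?X \<union> Iy ` ?Y" using assms by (cases i) auto
  qed
  moreover have "card (Ix ` ?X \<union> Iy ` ?Y) = card (Ix ` ?X) + card (Iy ` ?Y)"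
    by (rule card_Un_disjoint) auto
  moreover have "card (Ix ` ?X) = card ?X" "card (Iy ` ?Y) = card ?Y"
    by (auto intro!: card_image simp: inj_on_def)
  ultimately have R: "card R = card ?X + card ?Y" by metis
  have "(\<Sum>j\<in>UNIV. (if xy_pair j \<inter> R = {} then 1 else 0) - (if xy_pair j \<subseteq> R then 1 else 0)) =
      (\<Sum>j\<in>UNIV. 1 - (if Ix j \<in> R then 1 else 0) - (if Iy j \<in> R then 1 else (0::real)))"
    by (rule sum.cong) (auto simp: xy_pair_def)
  also have "\<dots> = real CARD('n) - real (card ?X) - real (card ?Y)"
    by (simp add: sum_subtractf sum.If_cases)
  finally show ?thesis using R by simp
qed

text \<open>The \<open>sl\<^sub>2\<close> relation: for \<open>i \<noteq> j\<close> raising by the pair \<open>i\<close> and lowering by the pair \<open>j\<close> commute,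
  and for \<open>i = j\<close> the commutator is diagonal.\<close>

lemma lower_raise_commutator:
  fixes a :: "'n::{finite,linorder} ext"
  assumes "It \<notin> R"
  shows "lower (raise a) $ R = raise (lower a) $ R + (real CARD('n) - real (card R)) * a $ R"
proof -
  \<comment> \<open>\<open>P i j\<close> is the contribution of raising by the pair i and then
    lowering by the pair j, \<open>Q i j\<close> that of the opposite order.\<close>
  define P where "P i j = (if xy_pair j \<inter> R = {} then shuffle_sign (xy_pair j) R *
     (if xy_pair i \<subseteq> R \<union> xy_pair j then shuffle_sign (xy_pair i) (R \<union> xy_pair j - xy_pair i) *
        a $ (R \<union> xy_pair j - xy_pair i) else 0) else 0)" for i j
  define Q where "Q i j = (if xy_pair i \<subseteq> R then shuffle_sign (xy_pair i) (R - xy_pair i) *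
     (if xy_pair j \<inter> (R - xy_pair i) = {} then shuffle_sign (xy_pair j) (R - xy_pair i) *
        a $ (R - xy_pair i \<union> xy_pair j) else 0) else 0)" for i j
  have l: "lower (raise a) $ R = (\<Sum>i\<in>UNIV. \<Sum>j\<in>UNIV. P i j)"
    unfolding lower_def raise_def
    by (subst sum.swap) (auto simp: P_def sum_distrib_left intro!: sum.cong)
  have r: "raise (lower a) $ R = (\<Sum>i\<in>UNIV. \<Sum>j\<in>UNIV. Q i j)"
    unfolding lower_def raise_def by (auto simp: Q_def sum_distrib_left intro!: sum.cong)
  have off: "P i j = Q i j" if "i \<noteq> j" for i j
  proof (cases "xy_pair j \<inter> R = {} \<and> xy_pair i \<subseteq> R")
    case True
    have d: "xy_pair i \<inter> xy_pair j = {}" using that by (rule xy_pair_disjoint)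
    have e: "R \<union> xy_pair j - xy_pair i = (R - xy_pair i) \<union> xy_pair j" using d by blast
    have R: "R = (R - xy_pair i) \<union> xy_pair i" using True by blast
    have s1: "shuffle_sign (xy_pair j) R =
        shuffle_sign (xy_pair j) (R - xy_pair i) * shuffle_sign (xy_pair j) (xy_pair i)"
      by (subst R, rule shuffle_sign_Un_right) blast
    have s2: "shuffle_sign (xy_pair i) ((R - xy_pair i) \<union> xy_pair j) =
        shuffle_sign (xy_pair i) (R - xy_pair i) * shuffle_sign (xy_pair i) (xy_pair j)"
      by (rule shuffle_sign_Un_right) (use True in blast)
    \<comment> \<open>Pairs have even size, so they commute without a sign.\<close>
    have "shuffle_sign (xy_pair j) (xy_pair i) = shuffle_sign (xy_pair i) (xy_pair j)"
      using shuffle_sign_commute[of "xy_pair j" "xy_pair i"] d by (simp add: card_xy_pair Int_commute)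
    then have "shuffle_sign (xy_pair j) (xy_pair i) * shuffle_sign (xy_pair i) (xy_pair j) = 1"
      by (simp add: shuffle_sign_sq)
    then have "shuffle_sign (xy_pair j) R * shuffle_sign (xy_pair i) ((R - xy_pair i) \<union> xy_pair j) =
        shuffle_sign (xy_pair i) (R - xy_pair i) * shuffle_sign (xy_pair j) (R - xy_pair i)"
      unfolding s1 s2 by (simp add: mult.commute mult.left_commute)
    then have "shuffle_sign (xy_pair j) R * (shuffle_sign (xy_pair i) ((R - xy_pair i) \<union> xy_pair j) * x) =
        shuffle_sign (xy_pair i) (R - xy_pair i) * (shuffle_sign (xy_pair j) (R - xy_pair i) * x)" for x
      by (metis mult.assoc)
    moreover have "xy_pair i \<subseteq> R \<union> xy_pair j" "xy_pair j \<inter> (R - xy_pair i) = {}" using True by auto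
    ultimately show ?thesis
      using True by (simp add: P_def Q_def e)
  next
    case False
    then show ?thesis
      using xy_pair_disjoint[OF that] by (auto simp: P_def Q_def)
  qed
  have diag: "P i i - Q i i = ((if xy_pair i \<inter> R = {} then 1 else 0) - (if xy_pair i \<subseteq> R then 1 else 0)) * a $ R"
    for i
  proof -
    have "xy_pair i \<noteq> {}" by (simp add: xy_pair_def)
    moreover have "R \<union> xy_pair i - xy_pair i = R" if "xy_pair i \<inter> R = {}" using that by blast
    moreover have "R - xy_pair i \<union> xy_pair i = R" if "xy_pair i \<subseteq> R" using that by blast
    moreover have "shuffle_sign A B * (shuffle_sign A B * x) = x" for A B :: "'n hidx set" and x
      by (simp add: shuffle_sign_sq flip: mult.assoc)
    ultimately show ?thesis
      by (auto simp: P_def Q_def)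
  qed
  have "lower (raise a) $ R - raise (lower a) $ R = (\<Sum>i\<in>UNIV. \<Sum>j\<in>UNIV. P i j - Q i j)"
    unfolding l r by (simp add: sum_subtractf)
  also have "\<dots> = (\<Sum>i\<in>UNIV. \<Sum>j\<in>UNIV. if j = i then P i i - Q i i else 0)"
    by (intro sum.cong refl) (auto simp: off)
  also have "\<dots> = (\<Sum>i\<in>UNIV. P i i - Q i i)" by simp
  also have "\<dots> = (real CARD('n) - real (card R)) * a $ R"
    unfolding diag sum_distrib_right[symmetric] count_xy_pairs[OF assms] ..
  finally show ?thesis by simp
qed

text \<open>This is the commutator relation tested against \<open>a\<close> itself. In degrees n - 1
  and n + 1 the last factor is 1 and -1, which yields injectivity and surjectivity of the Lefschetz
  map.\<close>

lemma norm_raise_lower: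
  fixes a :: "'n::{finite,linorder} ext"
  assumes "a \<in> horizontal_graded k"
  shows "raise a \<bullet> raise a = lower a \<bullet> lower a + (real CARD('n) - real k) * (a \<bullet> a)"
proof -
  have "raise a \<bullet> raise a = a \<bullet> lower (raise a)" by (rule raise_inner)
  also have "\<dots> = (\<Sum>R\<in>UNIV. a $ R * raise (lower a) $ R + (real CARD('n) - real k) * (a $ R * a $ R))"
    unfolding inner_vec_def
  proof (rule sum.cong[OF refl])
    fix R
    show "a $ R \<bullet> lower (raise a) $ R = a $ R * raise (lower a) $ R + (real CARD('n) - real k) * (a $ R * a $ R)"
    proof (cases "a $ R = 0")
      case False
      then have "It \<notin> R" "card R = k"
        using assms by (auto simp: horizontal_graded_def graded_def)
      then show ?thesis by (simp add: lower_raise_commutator algebra_simps)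
    qed simp
  qed
  also have "\<dots> = raise (lower a) \<bullet> a + (real CARD('n) - real k) * (a \<bullet> a)"
    by (simp add: inner_vec_def sum.distrib sum_distrib_left mult.commute)
  finally show ?thesis by (simp only: raise_inner[of "lower a" a])
qed

lemma raise_horizontal_graded: "a \<in> horizontal_graded k \<Longrightarrow> raise a \<in> horizontal_graded (k + 2)"
proof -
  assume a: "a \<in> horizontal_graded k"
  have "dtheta \<^bold>\<and> a \<in> horizontal_graded (k + 2)"
    using a wedge_graded[OF dtheta_graded, of a k] wedge_horizontal[OF dtheta_horizontal, of a]
    by (simp add: horizontal_graded_eq add.commute)
  then have "- (dtheta \<^bold>\<and> a) \<in> horizontal_graded (k + 2)"
    by (rule subspace_neg[OF subspace_horizontal_graded])
  then show ?thesis by (simp add: dtheta_wedge)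
qed

lemma lower_horizontal_graded:
  assumes "b \<in> horizontal_graded (k + 2)"
  shows "lower b \<in> horizontal_graded k"
proof -
  have "card R = k \<and> It \<notin> R" if "lower b $ R \<noteq> 0" for R
  proof -
    have "\<not> (\<forall>j. xy_pair j \<inter> R = {} \<longrightarrow> b $ (R \<union> xy_pair j) = 0)"
    proof
      assume *: "\<forall>j. xy_pair j \<inter> R = {} \<longrightarrow> b $ (R \<union> xy_pair j) = 0"
      have "lower b $ R = 0"
        unfolding lower_def vec_lambda_beta
      proof (rule sum.neutral, rule ballI)
        fix j
        show "(if xy_pair j \<inter> R = {} then shuffle_sign (xy_pair j) R * b $ (R \<union> xy_pair j) else 0) = 0"
          using * by simp
      qed
      then show False using that by simp
    qed
    then obtain j where j: "xy_pair j \<inter> R = {}" "b $ (R \<union> xy_pair j) \<noteq> 0"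
      by blast
    then have "card (R \<union> xy_pair j) = k + 2" "It \<notin> R"
      using assms by (auto simp: horizontal_graded_def graded_def)
    moreover have "card (R \<union> xy_pair j) = card R + 2"
      using card_Un_disjoint[of R "xy_pair j"] j(1) by (simp add: card_xy_pair Int_commute)
    ultimately show ?thesis by simp
  qed
  then show ?thesis by (auto simp: horizontal_graded_def graded_def)
qed

lemma linear_raise: "linear raise"
proof (rule linearI)
  have raise_eq: "raise a = - (dtheta \<^bold>\<and> a)" for a :: "'a ext"
    unfolding dtheta_wedge by simp
  show "raise (a + b) = raise a + raise b" for a b :: "'a ext"
    unfolding raise_eq wedge_add_right by simp
  show "raise (c *\<^sub>R a) = c *\<^sub>R raise a" for c and a :: "'a ext"
    unfolding raise_eq wedge_scaleR_right by simp
qed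

lemma raise_injective:
  fixes a :: "'n::{finite,linorder} ext"
  assumes "a \<in> horizontal_graded (CARD('n) - 1)" "raise a = 0"
  shows "a = 0"
proof -
  \<comment> \<open>With n at least 1 the factor in degree n - 1 is exactly 1, so two nonnegative
    terms add up to 0.\<close>
  have "CARD('n) \<ge> 1" by (simp add: Suc_le_eq)
  then have "0 = lower a \<bullet> lower a + a \<bullet> a"
    using norm_raise_lower[OF assms(1)] assms(2) by (simp add: of_nat_diff)
  then have "a \<bullet> a = 0"
    using inner_ge_zero[of a] inner_ge_zero[of "lower a"] by linarith
  then show ?thesis by simp
qed

text \<open>The component \<open>z\<close> of \<open>b\<close> orthogonal to the image satisfies
  \<open>lower z = 0\<close> by adjointness. In degree n + 1 the norm identity then equates a square
  with minus a square, so \<open>z\<close> is 0.\<close>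

lemma raise_surjective:
  fixes b :: "'n::{finite,linorder} ext"
  assumes "b \<in> horizontal_graded (CARD('n) + 1)"
  obtains a where "a \<in> horizontal_graded (CARD('n) - 1)" "raise a = b"
proof -
  let ?H = "horizontal_graded (CARD('n) - 1) :: 'n ext set"
  have n: "CARD('n) - 1 + 2 = CARD('n) + 1" using zero_less_card_finite[where ?'a = 'n] by linarith
  have sub: "subspace (raise ` ?H)"
    by (intro linear_subspace_image linear_raise subspace_horizontal_graded)
  have span: "span (raise ` ?H) = raise ` ?H" using sub by simp
  obtain w z where wz: "w \<in> raise ` ?H" "\<And>x. x \<in> raise ` ?H \<Longrightarrow> orthogonal z x" "b = w + z"
    using orthogonal_subspace_decomp_exists[of "raise ` ?H" b] unfolding span by metis
  have w: "w \<in> horizontal_graded (CARD('n) + 1)"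
    using wz(1) raise_horizontal_graded[of _ "CARD('n) - 1"] unfolding n by blast
  have "z = b - w" using wz(3) by simp
  then have z: "z \<in> horizontal_graded (CARD('n) + 1)"
    using assms w subspace_diff[OF subspace_horizontal_graded] by blast
  then have lz: "lower z \<in> ?H"
    using lower_horizontal_graded[of z "CARD('n) - 1"] n by simp
  have "raise (lower z) \<bullet> z = 0"
    using wz(2)[of "raise (lower z)"] lz by (auto simp: orthogonal_def inner_commute)
  then have "lower z \<bullet> lower z = 0" by (simp add: raise_inner)
  then have "raise z \<bullet> raise z = - (z \<bullet> z)"
    using norm_raise_lower[OF z] by simp
  then have "z \<bullet> z = 0"
    using inner_ge_zero[of z] inner_ge_zero[of "raise z"] by linarith
  then have "b = w" using wz(3) by simp
  then show ?thesis using wz(1) that by blast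
qed

lemma lefschetz_inv_dtheta_wedge:
  fixes b :: "'n::{finite,linorder} ext"
  assumes "b \<in> horizontal_graded (CARD('n) - 1)"
  shows "lefschetz_inv (dtheta \<^bold>\<and> b) = b"
proof -
  have "inj_on (\<lambda>b. dtheta \<^bold>\<and> b) (horizontal_graded (CARD('n) - 1) :: 'n ext set)"
  proof (rule inj_onI)
    fix x y :: "'n ext"
    assume *: "x \<in> horizontal_graded (CARD('n) - 1)" "y \<in> horizontal_graded (CARD('n) - 1)"
      "dtheta \<^bold>\<and> x = dtheta \<^bold>\<and> y"
    have "raise x = raise y"
      using *(3) unfolding dtheta_wedge by (simp only: neg_equal_iff_equal)
    then have "raise (x - y) = 0"
      unfolding linear_diff[OF linear_raise] by simp
    then have "x - y = 0"
      by (rule raise_injective[OF subspace_diff[OF subspace_horizontal_graded *(1,2)]])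
    then show "x = y" by simp
  qed
  then show ?thesis
    unfolding lefschetz_inv_def using assms by (rule inv_into_f_f)
qed

lemma lefschetz_inv_horizontal:
  fixes c :: "'n::{finite,linorder} ext"
  assumes "c \<in> horizontal_graded (CARD('n) + 1)"
  shows "lefschetz_inv c \<in> horizontal_graded (CARD('n) - 1)" "dtheta \<^bold>\<and> lefschetz_inv c = c"
proof -
  obtain a where a: "a \<in> horizontal_graded (CARD('n) - 1)" "raise a = c"
    using assms by (rule raise_surjective)
  have c: "c = dtheta \<^bold>\<and> (- a)"
    unfolding wedge_minus_right dtheta_wedge minus_minus by (rule a(2)[symmetric])
  have na: "- a \<in> horizontal_graded (CARD('n) - 1)"
    using a by (intro subspace_neg subspace_horizontal_graded)
  have e: "lefschetz_inv c = - a"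
    unfolding c by (rule lefschetz_inv_dtheta_wedge[OF na])
  show "lefschetz_inv c \<in> horizontal_graded (CARD('n) - 1)"
    unfolding e by (rule na)
  show "dtheta \<^bold>\<and> lefschetz_inv c = c"
    unfolding e by (rule c[symmetric])
qed

text \<open>\<open>lefschetz_inv\<close> is not specified off the horizontal covectors of degree n +
  1. A linear map that agrees with it there lets smoothness and linearity pass to
  \<open>rumin_L\<close>.\<close>

lemma lefschetz_inv_linear:
  obtains G :: "'n::{finite,linorder} ext \<Rightarrow> 'n ext"
  where "linear G" "\<And>c. c \<in> horizontal_graded (CARD('n) + 1) \<Longrightarrow> lefschetz_inv c = G c"
proof -
  let ?H = "horizontal_graded (CARD('n) - 1) :: 'n ext set"
  have "inj_on (\<lambda>b. dtheta \<^bold>\<and> b) ?H"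
    by (rule inj_on_inverseI) (rule lefschetz_inv_dtheta_wedge)
  from linear_exists_left_inverse_on[OF linear_wedge_right subspace_horizontal_graded this]
  obtain G :: "'n ext \<Rightarrow> 'n ext" where G: "linear G" "\<And>v. v \<in> ?H \<Longrightarrow> G (dtheta \<^bold>\<and> v) = v"
    by blast
  show ?thesis
  proof (rule that[OF G(1)])
    show "lefschetz_inv c = G c" if "c \<in> horizontal_graded (CARD('n) + 1)" for c
      using G(2)[OF lefschetz_inv_horizontal(1)[OF that]] lefschetz_inv_horizontal(2)[OF that] by simp
  qed
qed

section \<open>The Rumin differential\<close>

lemma sum_hidx:
  fixes f :: "'n::finite hidx \<Rightarrow> 'b::comm_monoid_add"
  shows "(\<Sum>i\<in>UNIV. f i) = (\<Sum>j\<in>UNIV. f (Ix j)) + (\<Sum>j\<in>UNIV. f (Iy j)) + f It"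
proof -
  have "i \<in> insert It (range Ix \<union> range Iy)" for i :: "'n hidx"
    by (cases i) auto
  then have U: "(UNIV :: 'n hidx set) = insert It (range Ix \<union> range Iy)" by blast
  have "(\<Sum>i\<in>UNIV. f i) = f It + (\<Sum>i\<in>range Ix \<union> range Iy. f i)"
    unfolding U by (rule sum.insert) auto
  also have "(\<Sum>i\<in>range Ix \<union> range Iy. f i) = (\<Sum>i\<in>range Ix. f i) + (\<Sum>i\<in>range Iy. f i)"
    by (rule sum.union_disjoint) auto
  also have "(\<Sum>i\<in>range Ix. f i) = (\<Sum>j\<in>UNIV. f (Ix j))"
    by (subst sum.reindex) (auto simp: inj_on_def)
  also have "(\<Sum>i\<in>range Iy. f i) = (\<Sum>j\<in>UNIV. f (Iy j))"
    by (subst sum.reindex) (auto simp: inj_on_def)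
  finally show ?thesis by (simp add: add.commute)
qed

section \<open>The left invariant frame and its brackets\<close>

definition frame_lin :: "'n::finite hidx \<Rightarrow> 'n hpoint \<Rightarrow> 'n hpoint" where
  "frame_lin i p = frame i p - frame i 0"

lemma frame_lin_simps [simp]:
  "frame_lin (Ix j) p = (0, 0, - (fst (snd p) $ j) / 2)"
  "frame_lin (Iy j) p = (0, 0, fst p $ j / 2)"
  "frame_lin It p = 0"
  by (cases p; simp add: frame_lin_def zero_prod_def)+

lemma frame_eq: "frame i p = frame i 0 + frame_lin i p"
  by (simp add: frame_lin_def)

lemma linear_frame_lin: "linear (frame_lin i)"
  by (cases i) (auto intro!: linearI simp: zero_prod_def add_divide_distrib)

text \<open>\<open>frame_lin i\<close> is the derivative of the affine field \<open>frame i\<close>,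
  so the left side is the Lie bracket of the fields i and j at \<open>p\<close>: only the x and y
  fields of the same index have a nonzero bracket, the vertical field up to sign.\<close>

lemma frame_lin_frame:
  "frame_lin j (frame i p) - frame_lin i (frame j p) =
    (case (i, j) of (Ix a, Iy b) \<Rightarrow> if a = b then 1 else 0
      | (Iy a, Ix b) \<Rightarrow> if a = b then - 1 else 0 | _ \<Rightarrow> 0) *\<^sub>R frame It p"
  by (cases p; cases i; cases j) (auto simp: zero_prod_def axis_def)

definition frame_deriv :: "'n::finite hidx \<Rightarrow> ('n hpoint \<Rightarrow> 'b::real_normed_vector) \<Rightarrow> 'n hpoint \<Rightarrow> 'b" where
  "frame_deriv i \<omega> p = frechet_derivative \<omega> (at p) (frame i p)"

text \<open>Expanding the moving direction in a fixed basis reduces derivatives along the frame to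
  \<open>dir_deriv\<close> with smooth coefficients.\<close>

lemma frame_deriv_expand:
  assumes "smooth \<omega>"
  shows "frame_deriv i \<omega> p = (\<Sum>b\<in>Basis. (frame i p \<bullet> b) *\<^sub>R dir_deriv b \<omega> p)"
proof -
  have "frame_deriv i \<omega> p = dir_deriv (\<Sum>b\<in>Basis. (frame i p \<bullet> b) *\<^sub>R b) \<omega> p"
    by (simp add: frame_deriv_def euclidean_representation)
  also have "\<dots> = (\<Sum>b\<in>Basis. (frame i p \<bullet> b) *\<^sub>R dir_deriv b \<omega> p)"
    by (simp only: linear_sum[OF linear_dir_deriv[OF assms]] linear_scale[OF linear_dir_deriv[OF assms]])
  finally show ?thesis .
qed

lemma bounded_linear_frame_lin_inner: "bounded_linear (\<lambda>p. frame_lin i p \<bullet> b)"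
  by (intro bounded_linear_compose[OF bounded_linear_inner_left]
      linear_conv_bounded_linear[THEN iffD1] linear_frame_lin)

lemma smooth_frame_inner: "smooth (\<lambda>p. frame i p \<bullet> b)"
proof -
  have "smooth (\<lambda>p. frame i 0 \<bullet> b + frame_lin i p \<bullet> b)"
    by (intro smooth_add smooth_const smooth_linear bounded_linear_frame_lin_inner)
  then show ?thesis
    by (subst frame_eq) (simp only: inner_add_left)
qed

lemma smooth_frame_deriv: "smooth \<omega> \<Longrightarrow> smooth (frame_deriv i \<omega>)"
proof -
  assume s: "smooth \<omega>"
  have "smooth (\<lambda>p. \<Sum>b\<in>Basis. (frame i p \<bullet> b) *\<^sub>R dir_deriv b \<omega> p)"
    by (intro smooth_sum smooth_scaleR smooth_frame_inner smooth_dir_deriv s)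
  moreover have "frame_deriv i \<omega> = (\<lambda>p. \<Sum>b\<in>Basis. (frame i p \<bullet> b) *\<^sub>R dir_deriv b \<omega> p)"
    by (rule ext) (rule frame_deriv_expand[OF s])
  ultimately show ?thesis by simp
qed

text \<open>By the product rule, the variation of the field itself adds a first order term to the
  second derivative; only this term survives in commutators.\<close>

lemma dir_deriv_frame_deriv:
  fixes \<omega> :: "'n::finite hpoint \<Rightarrow> 'b::euclidean_space"
  assumes s: "smooth \<omega>"
  shows "dir_deriv u (frame_deriv i \<omega>) p = dir_deriv (frame i p) (dir_deriv u \<omega>) p + dir_deriv (frame_lin i u) \<omega> p"
proof -
  have fd: "dir_deriv u (\<lambda>p. frame i p \<bullet> b) p = frame_lin i u \<bullet> b" for b
  proof -
    have "((\<lambda>p. frame i 0 \<bullet> b + frame_lin i p \<bullet> b) has_derivative (\<lambda>v. 0 + frame_lin i v \<bullet> b)) (at p)"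
      by (intro has_derivative_add has_derivative_const bounded_linear_imp_has_derivative
          bounded_linear_frame_lin_inner)
    then have "((\<lambda>p. frame i p \<bullet> b) has_derivative (\<lambda>v. frame_lin i v \<bullet> b)) (at p)"
      unfolding inner_add_left[symmetric] frame_eq[symmetric] by simp
    from frechet_derivative_at[OF this] have "frechet_derivative (\<lambda>p. frame i p \<bullet> b) (at p) = (\<lambda>v. frame_lin i v \<bullet> b)"
      by (rule sym)
    then show ?thesis by simp
  qed
  have frame_deriv: "frame_deriv i \<omega> = (\<lambda>p. \<Sum>b\<in>Basis. (frame i p \<bullet> b) *\<^sub>R dir_deriv b \<omega> p)"
    by (rule ext) (rule frame_deriv_expand[OF s])
  have "dir_deriv u (frame_deriv i \<omega>) = (\<lambda>p. \<Sum>b\<in>Basis. dir_deriv u (\<lambda>p. (frame i p \<bullet> b) *\<^sub>R dir_deriv b \<omega> p) p)"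
    unfolding frame_deriv by (intro dir_deriv_sum smooth_scaleR smooth_frame_inner smooth_dir_deriv s)
  then have "dir_deriv u (frame_deriv i \<omega>) p = (\<Sum>b\<in>Basis. dir_deriv u (\<lambda>p. (frame i p \<bullet> b) *\<^sub>R dir_deriv b \<omega> p) p)"
    by (rule fun_cong)
  also have "\<dots> = (\<Sum>b\<in>Basis. (frame i p \<bullet> b) *\<^sub>R dir_deriv b (dir_deriv u \<omega>) p + (frame_lin i u \<bullet> b) *\<^sub>R dir_deriv b \<omega> p)"
  proof (rule sum.cong[OF refl])
    fix b :: "'n hpoint"
    have "dir_deriv u (\<lambda>p. (frame i p \<bullet> b) *\<^sub>R dir_deriv b \<omega> p) =
        (\<lambda>p. (frame i p \<bullet> b) *\<^sub>R dir_deriv u (dir_deriv b \<omega>) p + dir_deriv u (\<lambda>p. frame i p \<bullet> b) p *\<^sub>R dir_deriv b \<omega> p)"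
      by (rule dir_deriv_scaleR[OF smooth_frame_inner smooth_dir_deriv[OF s]])
    then have D: "dir_deriv u (\<lambda>p. (frame i p \<bullet> b) *\<^sub>R dir_deriv b \<omega> p) p =
        (frame i p \<bullet> b) *\<^sub>R dir_deriv u (dir_deriv b \<omega>) p + dir_deriv u (\<lambda>p. frame i p \<bullet> b) p *\<^sub>R dir_deriv b \<omega> p"
      by (rule fun_cong)
    show "dir_deriv u (\<lambda>p. (frame i p \<bullet> b) *\<^sub>R dir_deriv b \<omega> p) p =
        (frame i p \<bullet> b) *\<^sub>R dir_deriv b (dir_deriv u \<omega>) p + (frame_lin i u \<bullet> b) *\<^sub>R dir_deriv b \<omega> p"
      by (rule trans[OF D], rule arg_cong2[where f = plus],
          rule arg_cong[where f = "scaleR (frame i p \<bullet> b)"], rule dir_deriv_commute[OF s],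
          rule arg_cong[where f = "\<lambda>c. c *\<^sub>R dir_deriv b \<omega> p"], rule fd)
  qed
  also have "\<dots> = dir_deriv (\<Sum>b\<in>Basis. (frame i p \<bullet> b) *\<^sub>R b) (dir_deriv u \<omega>) p
      + dir_deriv (\<Sum>b\<in>Basis. (frame_lin i u \<bullet> b) *\<^sub>R b) \<omega> p"
    by (simp only: sum.distrib linear_sum[OF linear_dir_deriv[OF s]] linear_scale[OF linear_dir_deriv[OF s]]
        linear_sum[OF linear_dir_deriv[OF smooth_dir_deriv[OF s]]]
        linear_scale[OF linear_dir_deriv[OF smooth_dir_deriv[OF s]]])
  finally show ?thesis by (simp only: euclidean_representation)
qed

definition bracket_coeff :: "'n hidx \<Rightarrow> 'n hidx \<Rightarrow> real" where
  "bracket_coeff i j = (case (i, j) of (Ix a, Iy b) \<Rightarrow> if a = b then 1 else 0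
      | (Iy a, Ix b) \<Rightarrow> if a = b then - 1 else 0 | _ \<Rightarrow> 0)"

text \<open>The second derivatives are symmetric and cancel, which leaves the derivative along the
  bracket of the two fields.\<close>

lemma frame_deriv_commutator:
  fixes \<omega> :: "'n::finite hpoint \<Rightarrow> 'b::euclidean_space"
  assumes s: "smooth \<omega>"
  shows "frame_deriv i (frame_deriv j \<omega>) p - frame_deriv j (frame_deriv i \<omega>) p = bracket_coeff i j *\<^sub>R frame_deriv It \<omega> p"
proof -
  have 1: "frame_deriv i (frame_deriv j \<omega>) p = dir_deriv (frame j p) (dir_deriv (frame i p) \<omega>) p + dir_deriv (frame_lin j (frame i p)) \<omega> p"
    for i j
    by (rule trans[OF frame_deriv_def dir_deriv_frame_deriv[OF s]])
  define A where "A = dir_deriv (frame j p) (dir_deriv (frame i p) \<omega>) p"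
  define x where "x = dir_deriv (frame_lin j (frame i p)) \<omega> p"
  define y where "y = dir_deriv (frame_lin i (frame j p)) \<omega> p"
  have ij: "frame_deriv i (frame_deriv j \<omega>) p = A + x"
    unfolding A_def x_def by (rule 1)
  have ji: "frame_deriv j (frame_deriv i \<omega>) p = A + y"
    unfolding A_def y_def by (rule trans[OF 1 arg_cong2[where f = plus, OF dir_deriv_commute[OF s] refl]])
  have "frame_deriv i (frame_deriv j \<omega>) p - frame_deriv j (frame_deriv i \<omega>) p = x - y"
    unfolding ij ji by simp
  also have "\<dots> = dir_deriv (frame_lin j (frame i p) - frame_lin i (frame j p)) \<omega> p"
    unfolding x_def y_def by (rule linear_diff[OF linear_dir_deriv[OF s], symmetric])
  also have "\<dots> = bracket_coeff i j *\<^sub>R frame_deriv It \<omega> p"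
    unfolding frame_lin_frame bracket_coeff_def[symmetric] frame_deriv_def by (rule linear_scale[OF linear_dir_deriv[OF s]])
  finally show ?thesis .
qed

lemma frame_deriv_linear_image: "linear (L :: 'b::euclidean_space \<Rightarrow> 'c::real_normed_vector) \<Longrightarrow> smooth \<omega> \<Longrightarrow> frame_deriv i (\<lambda>p. L (\<omega> p)) p = L (frame_deriv i \<omega> p)"
  unfolding frame_deriv_def by (rule fun_cong[OF dir_deriv_bounded_linear]) (simp add: linear_conv_bounded_linear)

lemma frame_deriv_add: "smooth f \<Longrightarrow> smooth g \<Longrightarrow> frame_deriv i (\<lambda>p. f p + g p) p = frame_deriv i f p + frame_deriv i g p"
  unfolding frame_deriv_def by (rule fun_cong[OF dir_deriv_add])

lemma frame_deriv_sum: "(\<And>j. j \<in> I \<Longrightarrow> smooth (f j)) \<Longrightarrow> frame_deriv i (\<lambda>p. \<Sum>j\<in>I. f j p) p = (\<Sum>j\<in>I. frame_deriv i (f j) p)"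
  unfolding frame_deriv_def by (rule fun_cong[OF dir_deriv_sum])

lemma smooth_linear_image:
  "linear (L :: 'b::euclidean_space \<Rightarrow> 'c::real_normed_vector) \<Longrightarrow> smooth \<omega> \<Longrightarrow> smooth (\<lambda>p. L (\<omega> p))"
  by (rule smooth_bounded_linear) (simp add: linear_conv_bounded_linear)

lemma smooth_wedge_right: "smooth \<omega> \<Longrightarrow> smooth (\<lambda>p. a \<^bold>\<and> \<omega> p)"
  by (rule smooth_linear_image[OF linear_wedge_right])

lemma smooth_wedge_left: "smooth \<omega> \<Longrightarrow> smooth (\<lambda>p. \<omega> p \<^bold>\<and> a)"
  by (rule smooth_linear_image[OF linear_wedge_left])

lemma smooth_d_coeff: "smooth \<omega> \<Longrightarrow> smooth (\<lambda>p. d_coeff (\<omega> p))"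
  by (rule smooth_linear_image[OF linear_d_coeff])

text \<open>Let \<open>z\<close> be the component of the derivative orthogonal to \<open>V\<close>.
  The inner product of the map with \<open>z\<close> is identically 0, hence so is that of its
  derivative, and \<open>z\<close> is 0.\<close>

lemma dir_deriv_in_subspace:
  fixes \<omega> :: "'a::real_normed_vector \<Rightarrow> 'b::euclidean_space"
  assumes s: "smooth \<omega>" and V: "subspace V" and \<omega>: "\<And>p. \<omega> p \<in> V"
  shows "dir_deriv v \<omega> p \<in> V"
proof -
  have span: "span V = V" using V by simp
  obtain y z where yz: "y \<in> V" "\<And>w. w \<in> V \<Longrightarrow> orthogonal z w" "dir_deriv v \<omega> p = y + z"
    using orthogonal_subspace_decomp_exists[of V "dir_deriv v \<omega> p"] unfolding span by metis
  have "(\<lambda>p. \<omega> p \<bullet> z) = (\<lambda>p. 0)"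
    using yz(2)[OF \<omega>] by (simp add: orthogonal_def inner_commute)
  moreover have "dir_deriv v (\<lambda>p. \<omega> p \<bullet> z) p = dir_deriv v \<omega> p \<bullet> z"
    by (rule fun_cong[OF dir_deriv_bounded_linear[OF bounded_linear_inner_left s]])
  ultimately have "dir_deriv v \<omega> p \<bullet> z = 0" by simp
  moreover have "y \<bullet> z = 0"
    using yz(2)[OF yz(1)] by (simp add: orthogonal_def inner_commute)
  ultimately have "z \<bullet> z = 0" unfolding yz(3) inner_add_left by simp
  then show ?thesis using yz by simp
qed

lemma frame_deriv_in_subspace:
  fixes \<omega> :: "'n::finite hpoint \<Rightarrow> 'b::euclidean_space"
  shows "smooth \<omega> \<Longrightarrow> subspace V \<Longrightarrow> (\<And>p. \<omega> p \<in> V) \<Longrightarrow> frame_deriv i \<omega> p \<in> V"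
  unfolding frame_deriv_def by (rule dir_deriv_in_subspace)

section \<open>The exterior derivative in the left invariant coframe\<close>

lemma ext_d_eq: "ext_d \<omega> p = (\<Sum>i\<in>UNIV. basis_ext {i} \<^bold>\<and> frame_deriv i \<omega> p) + d_coeff (\<omega> p)"
  by (simp add: ext_d_def frame_deriv_def d_coeff_def)

lemma smooth_ext_d:
  assumes "smooth \<omega>"
  shows "smooth (ext_d \<omega>)"
proof -
  have "smooth (\<lambda>p. (\<Sum>i\<in>UNIV. basis_ext {i} \<^bold>\<and> frame_deriv i \<omega> p) + d_coeff (\<omega> p))"
    by (intro smooth_add smooth_sum smooth_wedge_right smooth_d_coeff smooth_frame_deriv assms)
  moreover have "ext_d \<omega> = (\<lambda>p. (\<Sum>i\<in>UNIV. basis_ext {i} \<^bold>\<and> frame_deriv i \<omega> p) + d_coeff (\<omega> p))"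
    by (rule ext) (rule ext_d_eq)
  ultimately show ?thesis by simp
qed

lemma ext_d_add:
  assumes "smooth \<omega>" "smooth \<eta>"
  shows "ext_d (\<lambda>p. \<omega> p + \<eta> p) p = ext_d \<omega> p + ext_d \<eta> p"
  unfolding ext_d_eq frame_deriv_add[OF assms] wedge_add_right sum.distrib linear_add[OF linear_d_coeff] by simp

lemma ext_d_scale:
  assumes "smooth \<omega>"
  shows "ext_d (\<lambda>p. c *\<^sub>R \<omega> p) p = c *\<^sub>R ext_d \<omega> p"
  unfolding ext_d_eq frame_deriv_linear_image[OF linear_scale_self[of c] assms] wedge_scaleR_right
    linear_scale[OF linear_d_coeff] scaleR_right_distrib scaleR_sum_right ..

text \<open>Antisymmetrising the second order part \<open>X\<close> leaves only brackets, that is,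
  minus \<open>dtheta\<close> times the vertical derivative of \<omega>. The derivative of
  \<open>theta\<close> in the part of order zero cancels this, and the mixed terms cancel by the
  Leibniz rule.\<close>

lemma ext_d_ext_d:
  fixes \<omega> :: "'n::{finite,linorder} form"
  assumes s: "smooth \<omega>"
  shows "ext_d (ext_d \<omega>) p = 0"
proof -
  let ?e = "\<lambda>i. basis_ext {i} :: 'n ext"
  define X where "X = (\<Sum>i\<in>UNIV. \<Sum>j\<in>UNIV. (?e i \<^bold>\<and> ?e j) \<^bold>\<and> frame_deriv i (frame_deriv j \<omega>) p)"
  have anti: "?e a \<^bold>\<and> ?e b = - (?e b \<^bold>\<and> ?e a)" for a b
    using wedge_commute[OF basis_singleton_graded basis_singleton_graded, of a b] by simp
  have anti_xy: "?e (Iy a) \<^bold>\<and> ?e (Ix a) = - (?e (Ix a) \<^bold>\<and> ?e (Iy a))" for a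
    by (rule anti)
  have "X = (\<Sum>j\<in>UNIV. \<Sum>i\<in>UNIV. (?e i \<^bold>\<and> ?e j) \<^bold>\<and> frame_deriv i (frame_deriv j \<omega>) p)"
    unfolding X_def by (rule sum.swap)
  also have "\<dots> = (\<Sum>i\<in>UNIV. \<Sum>j\<in>UNIV. - ((?e i \<^bold>\<and> ?e j) \<^bold>\<and> frame_deriv j (frame_deriv i \<omega>) p))"
  proof (intro sum.cong refl)
    fix i j
    show "(?e j \<^bold>\<and> ?e i) \<^bold>\<and> frame_deriv j (frame_deriv i \<omega>) p = - ((?e i \<^bold>\<and> ?e j) \<^bold>\<and> frame_deriv j (frame_deriv i \<omega>) p)"
      by (subst anti[of j i]) (rule wedge_minus_left)
  qed
  finally have "X + X = (\<Sum>i\<in>UNIV. \<Sum>j\<in>UNIV. (?e i \<^bold>\<and> ?e j) \<^bold>\<and> frame_deriv i (frame_deriv j \<omega>) p - (?e i \<^bold>\<and> ?e j) \<^bold>\<and> frame_deriv j (frame_deriv i \<omega>) p)"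
    unfolding X_def by (simp add: sum.distrib sum_negf sum_subtractf)
  also have "\<dots> = (\<Sum>i\<in>UNIV. \<Sum>j\<in>UNIV. bracket_coeff i j *\<^sub>R ((?e i \<^bold>\<and> ?e j) \<^bold>\<and> frame_deriv It \<omega> p))"
    by (intro sum.cong refl) (simp only: wedge_diff_right[symmetric] frame_deriv_commutator[OF s] wedge_scaleR_right)
  also have "\<dots> = (\<Sum>a\<in>UNIV. (?e (Ix a) \<^bold>\<and> ?e (Iy a)) \<^bold>\<and> frame_deriv It \<omega> p) - (\<Sum>a\<in>UNIV. (?e (Iy a) \<^bold>\<and> ?e (Ix a)) \<^bold>\<and> frame_deriv It \<omega> p)"
    by (simp add: sum_hidx bracket_coeff_def sum_negf if_distrib[of "\<lambda>x. x *\<^sub>R _"] cong: if_cong)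
  also have "\<dots> = 2 *\<^sub>R (\<Sum>a\<in>UNIV. (?e (Ix a) \<^bold>\<and> ?e (Iy a)) \<^bold>\<and> frame_deriv It \<omega> p)"
    by (simp add: anti_xy wedge_minus_left sum_negf scaleR_2)
  also have "\<dots> = - (2 *\<^sub>R (dtheta \<^bold>\<and> frame_deriv It \<omega> p))"
    by (simp add: dtheta_def wedge_minus_left wedge_sum_left)
  finally have "2 *\<^sub>R X = 2 *\<^sub>R (- (dtheta \<^bold>\<and> frame_deriv It \<omega> p))"
    by (simp add: scaleR_2)
  then have X: "X = - (dtheta \<^bold>\<and> frame_deriv It \<omega> p)"
    by (simp only: scaleR_cancel_left) simp
  have dWt: "(\<Sum>i\<in>UNIV. d_basis {i} \<^bold>\<and> frame_deriv i \<omega> p) = dtheta \<^bold>\<and> frame_deriv It \<omega> p"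
    by (simp add: sum_hidx d_basis_singleton)
  have Wd: "frame_deriv i (ext_d \<omega>) p = (\<Sum>j\<in>UNIV. ?e j \<^bold>\<and> frame_deriv i (frame_deriv j \<omega>) p) + d_coeff (frame_deriv i \<omega> p)" for i
  proof -
    have "frame_deriv i (ext_d \<omega>) p = frame_deriv i (\<lambda>p. (\<Sum>j\<in>UNIV. ?e j \<^bold>\<and> frame_deriv j \<omega> p) + d_coeff (\<omega> p)) p"
      by (simp add: ext_d_eq[abs_def])
    also have "\<dots> = (\<Sum>j\<in>UNIV. frame_deriv i (\<lambda>p. ?e j \<^bold>\<and> frame_deriv j \<omega> p) p) + frame_deriv i (\<lambda>p. d_coeff (\<omega> p)) p"
      by (simp only: frame_deriv_add[OF smooth_sum[OF smooth_wedge_right[OF smooth_frame_deriv[OF s]]] smooth_d_coeff[OF s]]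
          frame_deriv_sum[OF smooth_wedge_right[OF smooth_frame_deriv[OF s]]])
    also have "\<dots> = (\<Sum>j\<in>UNIV. ?e j \<^bold>\<and> frame_deriv i (frame_deriv j \<omega>) p) + d_coeff (frame_deriv i \<omega> p)"
      unfolding frame_deriv_linear_image[OF linear_d_coeff s] frame_deriv_linear_image[OF linear_wedge_right smooth_frame_deriv[OF s]] ..
    finally show ?thesis .
  qed
  have "ext_d (ext_d \<omega>) p = (\<Sum>i\<in>UNIV. ?e i \<^bold>\<and> frame_deriv i (ext_d \<omega>) p) + d_coeff (ext_d \<omega> p)"
    by (rule ext_d_eq)
  also have "(\<Sum>i\<in>UNIV. ?e i \<^bold>\<and> frame_deriv i (ext_d \<omega>) p) = X + (\<Sum>i\<in>UNIV. ?e i \<^bold>\<and> d_coeff (frame_deriv i \<omega> p))"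
    unfolding Wd X_def by (simp add: wedge_add_right wedge_sum_right sum.distrib wedge_assoc)
  also have "d_coeff (ext_d \<omega> p) = (\<Sum>i\<in>UNIV. d_basis {i} \<^bold>\<and> frame_deriv i \<omega> p) - (\<Sum>i\<in>UNIV. ?e i \<^bold>\<and> d_coeff (frame_deriv i \<omega> p))"
    unfolding ext_d_eq linear_add[OF linear_d_coeff] linear_sum[OF linear_d_coeff] d_coeff_d_coeff
      d_coeff_leibniz_basis by (simp add: sum_subtractf)
  finally show ?thesis unfolding X dWt by simp
qed

lemma ext_d_theta_wedge:
  fixes \<omega> :: "'n::{finite,linorder} form"
  assumes "smooth \<omega>"
  shows "ext_d (\<lambda>p. theta \<^bold>\<and> \<omega> p) p = dtheta \<^bold>\<and> \<omega> p - theta \<^bold>\<and> ext_d \<omega> p"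
proof -
  have "basis_ext {i} \<^bold>\<and> (theta \<^bold>\<and> a) = - (theta \<^bold>\<and> (basis_ext {i} \<^bold>\<and> a))" for i and a :: "'n ext"
    using wedge_commute[OF basis_singleton_graded theta_graded, of i]
    by (simp add: wedge_minus_left flip: wedge_assoc)
  moreover have "d_coeff (theta \<^bold>\<and> a) = dtheta \<^bold>\<and> a - theta \<^bold>\<and> d_coeff a" for a :: "'n ext"
    using d_coeff_leibniz_basis[of It a] by (simp add: theta_def d_basis_singleton)
  ultimately show ?thesis
    unfolding ext_d_eq frame_deriv_linear_image[OF linear_wedge_right assms]
    by (simp add: wedge_add_right wedge_sum_right sum_negf)
qed

lemma ext_d_wedge_theta:
  fixes \<omega> :: "'n::{finite,linorder} form"
  assumes "smooth \<omega>" "\<And>p. \<omega> p \<in> graded k"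
  shows "ext_d (\<lambda>p. \<omega> p \<^bold>\<and> theta) p = ext_d \<omega> p \<^bold>\<and> theta + (- 1) ^ k *\<^sub>R (\<omega> p \<^bold>\<and> dtheta)"
  unfolding ext_d_eq frame_deriv_linear_image[OF linear_wedge_left assms(1)] d_coeff_leibniz_theta[OF assms(2)]
  by (simp add: wedge_add_left wedge_sum_left wedge_assoc)

lemma ext_d_wedge_dtheta:
  fixes \<omega> :: "'n::{finite,linorder} form"
  assumes "smooth \<omega>"
  shows "ext_d (\<lambda>p. \<omega> p \<^bold>\<and> dtheta) p = ext_d \<omega> p \<^bold>\<and> dtheta"
  unfolding ext_d_eq frame_deriv_linear_image[OF linear_wedge_left assms] d_coeff_leibniz_dtheta
  by (simp add: wedge_add_left wedge_sum_left wedge_assoc)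

text \<open>Frame derivatives of a section of a constant subspace stay in it, so membership of the
  exterior derivative becomes an algebraic condition on fibres. It is applied to degrees,
  \<open>fibre_I\<close> and \<open>fibre_J\<close>.\<close>

lemma ext_d_in_subspace:
  fixes \<omega> :: "'n::{finite,linorder} form"
  assumes "smooth \<omega>" "\<And>p. \<omega> p \<in> V" "subspace V" "subspace V'"
    "\<And>i a. a \<in> V \<Longrightarrow> basis_ext {i} \<^bold>\<and> a \<in> V'" "\<And>a. a \<in> V \<Longrightarrow> d_coeff a \<in> V'"
  shows "ext_d \<omega> p \<in> V'"
  unfolding ext_d_eq using assms frame_deriv_in_subspace[OF assms(1,3,2)]
  by (intro subspace_add subspace_sum) auto

lemma ext_d_graded:
  assumes "smooth \<omega>" "\<And>p. \<omega> p \<in> graded k"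
  shows "ext_d \<omega> p \<in> graded (Suc k)"
proof (rule ext_d_in_subspace[OF assms subspace_graded subspace_graded])
  show "basis_ext {i} \<^bold>\<and> a \<in> graded (Suc k)" if "a \<in> graded k" for i and a :: "'a ext"
    using wedge_graded[OF basis_singleton_graded that, of i] by simp
qed (rule d_coeff_graded)

lemma ext_d_fibre_I:
  assumes "smooth \<omega>" "\<And>p. \<omega> p \<in> fibre_I k"
  shows "ext_d \<omega> p \<in> fibre_I (Suc k)"
  by (rule ext_d_in_subspace[OF assms subspace_fibre_I subspace_fibre_I fibre_I_basis_wedge fibre_I_d_coeff])

lemma ext_d_fibre_J:
  assumes "smooth \<omega>" "\<And>p. \<omega> p \<in> fibre_J k"
  shows "ext_d \<omega> p \<in> fibre_J (Suc k)"
  by (rule ext_d_in_subspace[OF assms subspace_fibre_J subspace_fibre_J fibre_J_basis_wedge fibre_J_d_coeff])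

lemma ext_d_eq_0:
  assumes "open V" "p \<in> V" "\<And>q. q \<in> V \<Longrightarrow> \<omega> q = 0"
  shows "ext_d \<omega> p = 0"
  unfolding ext_d_eq frame_deriv_def using assms(3)[OF assms(2)] dir_deriv_eq_0[OF assms]
  by (simp add: linear_0[OF linear_d_coeff])

text \<open>In degree n the operator is one fixed linear map applied to the exterior derivative. Its
  smoothness, linearity and locality are all read off from this form.\<close>

lemma rumin_L_linear:
  obtains G :: "'n::{finite,linorder} ext \<Rightarrow> 'n ext"
  where "linear G"
    "\<And>\<omega> p. smooth \<omega> \<Longrightarrow> (\<And>p. \<omega> p \<in> graded CARD('n)) \<Longrightarrow> rumin_L \<omega> p = G (ext_d \<omega> p)"
proof -
  obtain G0 :: "'n ext \<Rightarrow> 'n ext" where G0: "linear G0"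
    "\<And>c. c \<in> horizontal_graded (CARD('n) + 1) \<Longrightarrow> lefschetz_inv c = G0 c"
    using lefschetz_inv_linear by blast
  show ?thesis
  proof (rule that)
    show "linear (\<lambda>a. G0 (- horizontal_part a))"
      using linear_compose[OF linear_compose_neg[OF linear_horizontal_part] G0(1)] by (simp add: o_def)
    fix \<omega> :: "'n form" and p
    assume "smooth \<omega>" "\<And>p. \<omega> p \<in> graded CARD('n)"
    then have "ext_d \<omega> p \<in> graded (CARD('n) + 1)"
      using ext_d_graded[of \<omega> "CARD('n)" p] by simp
    then have "- horizontal_part (ext_d \<omega> p) \<in> horizontal_graded (CARD('n) + 1)"
      by (intro subspace_neg subspace_horizontal_graded horizontal_part_graded)
    then show "rumin_L \<omega> p = G0 (- horizontal_part (ext_d \<omega> p))"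
      unfolding rumin_L_def by (rule G0(2))
  qed
qed

text \<open>The representative of the class of a form of degree n whose exterior derivative has no
  horizontal part.\<close>

definition rumin_lift :: "'n::{finite,linorder} form \<Rightarrow> 'n form" where
  "rumin_lift \<omega> p = \<omega> p + theta \<^bold>\<and> rumin_L \<omega> p"

lemma rumin_d_eq: "rumin_d k \<omega> = (if k = CARD('n) then ext_d (rumin_lift \<omega>) else ext_d \<omega>)"
  for \<omega> :: "'n::{finite,linorder} form"
  by (simp add: rumin_d_def rumin_lift_def[abs_def])

lemma smooth_rumin_L:
  fixes \<omega> :: "'n::{finite,linorder} form"
  assumes "smooth \<omega>" "\<And>p. \<omega> p \<in> graded CARD('n)"
  shows "smooth (rumin_L \<omega>)"
proof -
  obtain G :: "'n ext \<Rightarrow> 'n ext" where G: "linear G"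
    "\<And>\<omega> p. smooth \<omega> \<Longrightarrow> (\<And>p. \<omega> p \<in> graded CARD('n)) \<Longrightarrow> rumin_L \<omega> p = G (ext_d \<omega> p)"
    using rumin_L_linear by blast
  have "rumin_L \<omega> = (\<lambda>p. G (ext_d \<omega> p))"
    by (rule ext) (rule G(2)[OF assms])
  then show ?thesis
    using smooth_linear_image[OF G(1) smooth_ext_d[OF assms(1)]] by simp
qed

lemma smooth_rumin_lift:
  fixes \<omega> :: "'n::{finite,linorder} form"
  assumes "smooth \<omega>" "\<And>p. \<omega> p \<in> graded CARD('n)"
  shows "smooth (rumin_lift \<omega>)"
  unfolding rumin_lift_def[abs_def]
  by (intro smooth_add assms smooth_wedge_right smooth_rumin_L)

lemma rumin_L_horizontal_graded:
  fixes \<omega> :: "'n::{finite,linorder} form"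
  assumes "smooth \<omega>" "\<And>p. \<omega> p \<in> graded CARD('n)"
  shows "rumin_L \<omega> p \<in> horizontal_graded (CARD('n) - 1)"
    and "dtheta \<^bold>\<and> rumin_L \<omega> p = - horizontal_part (ext_d \<omega> p)"
proof -
  have "ext_d \<omega> p \<in> graded (CARD('n) + 1)"
    using ext_d_graded[OF assms] by simp
  then have *: "- horizontal_part (ext_d \<omega> p) \<in> horizontal_graded (CARD('n) + 1)"
    by (intro subspace_neg subspace_horizontal_graded horizontal_part_graded)
  show "rumin_L \<omega> p \<in> horizontal_graded (CARD('n) - 1)"
    "dtheta \<^bold>\<and> rumin_L \<omega> p = - horizontal_part (ext_d \<omega> p)"
    unfolding rumin_L_def by (rule lefschetz_inv_horizontal[OF *])+
qed

lemma rumin_lift_graded: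
  fixes \<omega> :: "'n::{finite,linorder} form"
  assumes "smooth \<omega>" "\<And>p. \<omega> p \<in> graded CARD('n)"
  shows "rumin_lift \<omega> p \<in> graded CARD('n)"
proof -
  have "rumin_L \<omega> p \<in> graded (CARD('n) - 1)"
    using rumin_L_horizontal_graded(1)[OF assms] by (simp add: horizontal_graded_def)
  then have "theta \<^bold>\<and> rumin_L \<omega> p \<in> graded (1 + (CARD('n) - 1))"
    by (rule wedge_graded[OF theta_graded])
  then have "theta \<^bold>\<and> rumin_L \<omega> p \<in> graded CARD('n)" by simp
  then show ?thesis
    unfolding rumin_lift_def by (intro subspace_add subspace_graded assms)
qed

text \<open>The horizontal part of the derivative is removed by the choice of the lift, so its
  product with \<open>theta\<close> is 0. Differentiating that product, with \<open>ext_d\<close>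
  squaring to 0, forces the product with \<open>dtheta\<close> to vanish as well.\<close>

lemma ext_d_rumin_lift_fibre_J:
  fixes \<omega> :: "'n::{finite,linorder} form"
  assumes s: "smooth \<omega>" and g: "\<And>p. \<omega> p \<in> graded CARD('n)"
  shows "ext_d (rumin_lift \<omega>) p \<in> fibre_J (Suc CARD('n))"
proof -
  let ?\<gamma> = "ext_d (rumin_lift \<omega>)"
  have s\<gamma>: "smooth ?\<gamma>" by (intro smooth_ext_d smooth_rumin_lift s g)
  have g\<gamma>: "?\<gamma> p \<in> graded (Suc CARD('n))" for p
    by (rule ext_d_graded[OF smooth_rumin_lift[OF s g] rumin_lift_graded[OF s g]])
  have "?\<gamma> p = ext_d \<omega> p + (dtheta \<^bold>\<and> rumin_L \<omega> p - theta \<^bold>\<and> ext_d (rumin_L \<omega>) p)" for p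
    unfolding rumin_lift_def[abs_def]
    by (subst ext_d_add[OF s smooth_wedge_right[OF smooth_rumin_L[OF s g]]])
      (simp only: ext_d_theta_wedge[OF smooth_rumin_L[OF s g]])
  then have "?\<gamma> p = (ext_d \<omega> p - horizontal_part (ext_d \<omega> p)) - theta \<^bold>\<and> ext_d (rumin_L \<omega>) p" for p
    by (simp add: rumin_L_horizontal_graded(2)[OF s g])
  moreover have "subspace vertical"
    by (auto simp: subspace_def vertical_def)
  then have "(ext_d \<omega> p - horizontal_part (ext_d \<omega> p)) - theta \<^bold>\<and> ext_d (rumin_L \<omega>) p \<in> vertical" for p
    by (rule subspace_diff[OF _ diff_horizontal_part vertical_wedge_left[OF theta_vertical]])
  ultimately have \<gamma>t: "?\<gamma> p \<^bold>\<and> theta = 0" for p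
    by (simp only: vertical_wedge_theta)
  have "ext_d (\<lambda>p. ?\<gamma> p \<^bold>\<and> theta) p = ext_d ?\<gamma> p \<^bold>\<and> theta + (- 1) ^ Suc CARD('n) *\<^sub>R (?\<gamma> p \<^bold>\<and> dtheta)"
    by (rule ext_d_wedge_theta[OF s\<gamma> g\<gamma>])
  moreover have "ext_d (\<lambda>p. ?\<gamma> p \<^bold>\<and> theta) p = 0"
    by (rule ext_d_eq_0[of UNIV]) (simp_all add: \<gamma>t)
  ultimately have "(- 1) ^ Suc CARD('n) *\<^sub>R (?\<gamma> p \<^bold>\<and> dtheta) = 0"
    by (simp only: ext_d_ext_d[OF smooth_rumin_lift[OF s g]] wedge_zero_left) simp
  then have "?\<gamma> p \<^bold>\<and> dtheta = 0" by simp
  then show ?thesis using g\<gamma> \<gamma>t by (simp add: fibre_J_def)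
qed

lemma shifted_graded_imp_graded:
  assumes "a \<in> shifted_graded m k"
  shows "a \<in> graded (k - m)"
  using assms
proof (rule shifted_graded_cases)
  assume "a = 0"
  then show ?thesis by (simp only: subspace_0[OF subspace_graded])
next
  fix j assume "j + m = k" "a \<in> graded j"
  then show ?thesis by (simp only: diff_add_inverse2 flip: \<open>j + m = k\<close>)
qed

lemma shifted_graded_eq_0: "a \<in> shifted_graded m k \<Longrightarrow> k < m \<Longrightarrow> a = 0"
  by (auto simp: shifted_graded_def vec_eq_iff)

text \<open>If \<omega> is A theta + B dtheta, its lift turns out to be exact, namely the exterior
  derivative of theta B. Hence \<open>rumin_d\<close> is well defined on classes in degree
  n.\<close>

lemma ext_d_rumin_lift_fibre_I:
  fixes \<omega> :: "'n::{finite,linorder} form"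
  assumes s: "smooth \<omega>" and I: "\<And>p. \<omega> p \<in> fibre_I CARD('n)"
  shows "ext_d (rumin_lift \<omega>) p = 0"
proof -
  let ?n = "CARD('n)"
  have n: "?n \<ge> 1" by (simp add: Suc_le_eq)
  obtain A0 B0 :: "'n ext \<Rightarrow> 'n ext" where AB0:
    "linear A0" "linear B0" "\<And>c. A0 c \<in> shifted_graded 1 ?n" "\<And>c. B0 c \<in> shifted_graded 2 ?n"
    "\<And>c. c \<in> fibre_I ?n \<Longrightarrow> c = A0 c \<^bold>\<and> theta + B0 c \<^bold>\<and> dtheta"
    using fibre_I_select[of ?n] by metis
  define A where "A = (\<lambda>p. A0 (\<omega> p))"
  define B where "B = (\<lambda>p. B0 (\<omega> p))"
  have sA: "smooth A"
    unfolding A_def by (rule smooth_linear_image[OF AB0(1) s])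
  have sB: "smooth B"
    unfolding B_def by (rule smooth_linear_image[OF AB0(2) s])
  have gA: "A p \<in> graded (?n - 1)" for p
    unfolding A_def by (rule shifted_graded_imp_graded[OF AB0(3)])
  have dB: "ext_d B p \<in> graded (?n - 1)" for p
  proof (cases "?n = 1")
    \<comment> \<open>For n = 1 the degree n - 2 of \<open>B\<close> would be negative, so
      \<open>B\<close> is 0; truncated subtraction would place it in degree 0 and its derivative in
      the wrong degree.\<close>
    case True
    have "B p = 0" for p
      unfolding B_def by (rule shifted_graded_eq_0[OF AB0(4)]) (simp only: True)
    then have "ext_d B p = 0" by (intro ext_d_eq_0[of UNIV]) auto
    then show ?thesis by (simp add: subspace_0[OF subspace_graded])
  next
    case False
    have "B p \<in> graded (?n - 2)" for p
      unfolding B_def by (rule shifted_graded_imp_graded[OF AB0(4)])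
    then have "ext_d B p \<in> graded (Suc (?n - 2))" by (rule ext_d_graded[OF sB])
    moreover have "Suc (?n - 2) = ?n - 1" using False n by linarith
    ultimately show ?thesis by simp
  qed
  have \<omega>: "\<omega> p = A p \<^bold>\<and> theta + B p \<^bold>\<and> dtheta" for p
    unfolding A_def B_def by (rule AB0(5)[OF I])
  have d\<omega>: "ext_d \<omega> p = ext_d A p \<^bold>\<and> theta + (- 1) ^ (?n - 1) *\<^sub>R (A p \<^bold>\<and> dtheta) + ext_d B p \<^bold>\<and> dtheta" for p
  proof -
    have "\<omega> = (\<lambda>p. A p \<^bold>\<and> theta + B p \<^bold>\<and> dtheta)"
      by (rule ext) (rule \<omega>)
    then have "ext_d \<omega> p = ext_d (\<lambda>p. A p \<^bold>\<and> theta + B p \<^bold>\<and> dtheta) p"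
      by (rule arg_cong)
    also have "\<dots> = ext_d (\<lambda>p. A p \<^bold>\<and> theta) p + ext_d (\<lambda>p. B p \<^bold>\<and> dtheta) p"
      by (intro ext_d_add smooth_wedge_left sA sB)
    finally show ?thesis
      unfolding ext_d_wedge_theta[OF sA gA] ext_d_wedge_dtheta[OF sB] .
  qed
  \<comment> \<open>\<open>Z\<close> solves the Lefschetz equation: minus the horizontal part of the
    derivative of \<omega> is \<open>dtheta\<close> times the horizontal part of \<open>Z\<close>,
    so the latter is \<open>rumin_L \<omega> p\<close>.\<close>
  define Z where "Z p = - ((- 1) ^ (?n - 1) *\<^sub>R A p) - ext_d B p" for p
  have Z: "Z p \<in> graded (?n - 1)" for p
    unfolding Z_def by (intro subspace_diff subspace_neg subspace_scale subspace_graded gA dB)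
  have "- horizontal_part (ext_d \<omega> p) = dtheta \<^bold>\<and> horizontal_part (Z p)" for p
  proof -
    have "horizontal_part (ext_d \<omega> p) = horizontal_part (((- 1) ^ (?n - 1) *\<^sub>R A p + ext_d B p) \<^bold>\<and> dtheta)"
      unfolding d\<omega> wedge_add_left wedge_scaleR_left linear_add[OF linear_horizontal_part] horizontal_part_wedge_theta
      by simp
    also have "(- 1) ^ (?n - 1) *\<^sub>R A p + ext_d B p = - Z p"
      by (simp add: Z_def)
    also have "horizontal_part (- Z p \<^bold>\<and> dtheta) = - (dtheta \<^bold>\<and> horizontal_part (Z p))"
      unfolding horizontal_part_wedge_dtheta linear_neg[OF linear_horizontal_part] wedge_minus_left
        dtheta_commute[of "horizontal_part (Z p)"] ..
    finally show ?thesis by simp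
  qed
  then have "rumin_L \<omega> p = horizontal_part (Z p)" for p
    unfolding rumin_L_def
    by (simp only: lefschetz_inv_dtheta_wedge[OF horizontal_part_graded[OF Z]])
  then have "theta \<^bold>\<and> rumin_L \<omega> p = theta \<^bold>\<and> Z p" for p
    by (simp only: theta_wedge_horizontal_part)
  also have "theta \<^bold>\<and> Z p = - (A p \<^bold>\<and> theta) - theta \<^bold>\<and> ext_d B p" for p
    unfolding Z_def wedge_diff_right wedge_minus_right wedge_scaleR_right theta_commute[OF gA]
    by (simp flip: power_mult_distrib)
  finally have "rumin_lift \<omega> p = dtheta \<^bold>\<and> B p - theta \<^bold>\<and> ext_d B p" for p
    unfolding rumin_lift_def dtheta_commute[of "B p"] by (subst \<omega>) simp
  then have "rumin_lift \<omega> = ext_d (\<lambda>p. theta \<^bold>\<and> B p)"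
    by (intro ext) (simp only: ext_d_theta_wedge[OF sB])
  then show ?thesis
    using ext_d_ext_d[OF smooth_wedge_right[OF sB]] by simp
qed

section \<open>Test forms\<close>

lemma rumin_testI:
  assumes "smooth \<omega>" "\<And>p. \<omega> p \<in> rumin_fibre k" "compact K" "K \<subseteq> U" "\<And>p. p \<notin> K \<Longrightarrow> \<omega> p = 0"
  shows "\<omega> \<in> rumin_test k U"
proof -
  have sub: "form_support \<omega> \<subseteq> K"
    unfolding form_support_def
    by (rule closure_minimal[OF _ compact_imp_closed[OF assms(3)]]) (use assms(5) in blast)
  have "closed (form_support \<omega>)" by (simp add: form_support_def)
  then have "compact (K \<inter> form_support \<omega>)"
    by (rule compact_Int_closed[OF assms(3)])
  moreover have "K \<inter> form_support \<omega> = form_support \<omega>"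
    using sub by blast
  ultimately have "compact (form_support \<omega>)"
    by (simp only:)
  then show ?thesis
    unfolding rumin_test_def
    by (intro CollectI conjI allI assms(1,2) order_trans[OF sub assms(4)])
qed

lemma rumin_test_smooth: "\<omega> \<in> rumin_test k U \<Longrightarrow> smooth \<omega>"
  and rumin_test_fibre: "\<omega> \<in> rumin_test k U \<Longrightarrow> \<omega> p \<in> rumin_fibre k"
  and rumin_test_compact: "\<omega> \<in> rumin_test k U \<Longrightarrow> compact (form_support \<omega>)"
  and rumin_test_support: "\<omega> \<in> rumin_test k U \<Longrightarrow> form_support \<omega> \<subseteq> U"
  unfolding rumin_test_def by (elim CollectE conjE allE; assumption)+

lemma rumin_test_graded: "\<omega> \<in> rumin_test k U \<Longrightarrow> \<omega> p \<in> graded k"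
  by (rule subsetD[OF rumin_fibre_graded rumin_test_fibre])

lemma not_in_form_support: "p \<notin> form_support \<omega> \<Longrightarrow> \<omega> p = 0"
  unfolding form_support_def using closure_subset[of "{p. \<omega> p \<noteq> 0}"] by blast

lemma rumin_test_zero: "(\<lambda>p. 0) \<in> rumin_test k U"
  by (rule rumin_testI[of _ _ "{}"]) (auto simp: subspace_0[OF subspace_rumin_fibre])

lemma rumin_test_add:
  assumes "\<omega> \<in> rumin_test k U" "\<eta> \<in> rumin_test k U"
  shows "(\<lambda>p. \<omega> p + \<eta> p) \<in> rumin_test k U"
proof (rule rumin_testI[of _ _ "form_support \<omega> \<union> form_support \<eta>"])
  show "smooth (\<lambda>p. \<omega> p + \<eta> p)"
    by (rule smooth_add[OF assms[THEN rumin_test_smooth]])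
  show "\<omega> p + \<eta> p \<in> rumin_fibre k" for p
    by (intro subspace_add subspace_rumin_fibre rumin_test_fibre[OF assms(1)] rumin_test_fibre[OF assms(2)])
  show "compact (form_support \<omega> \<union> form_support \<eta>)"
    by (intro compact_Un rumin_test_compact[OF assms(1)] rumin_test_compact[OF assms(2)])
  show "form_support \<omega> \<union> form_support \<eta> \<subseteq> U"
    using rumin_test_support[OF assms(1)] rumin_test_support[OF assms(2)] by blast
  show "\<omega> p + \<eta> p = 0" if "p \<notin> form_support \<omega> \<union> form_support \<eta>" for p
    using that by (simp add: not_in_form_support)
qed

lemma rumin_test_mult:
  assumes "smooth \<phi>" "\<omega> \<in> rumin_test k U"
  shows "(\<lambda>p. \<phi> p *\<^sub>R \<omega> p) \<in> rumin_test k U"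
proof (rule rumin_testI[of _ _ "form_support \<omega>"])
  show "smooth (\<lambda>p. \<phi> p *\<^sub>R \<omega> p)"
    by (rule smooth_scaleR[OF assms(1) rumin_test_smooth[OF assms(2)]])
  show "\<phi> p *\<^sub>R \<omega> p \<in> rumin_fibre k" for p
    by (intro subspace_scale subspace_rumin_fibre rumin_test_fibre[OF assms(2)])
qed (use rumin_test_compact[OF assms(2)] rumin_test_support[OF assms(2)] in \<open>simp_all add: not_in_form_support\<close>)

lemma rumin_test_scale: "\<omega> \<in> rumin_test k U \<Longrightarrow> (\<lambda>p. c *\<^sub>R \<omega> p) \<in> rumin_test k U"
  by (rule rumin_test_mult[OF smooth_const])

lemma rumin_test_diff:
  assumes "\<omega> \<in> rumin_test k U" "\<eta> \<in> rumin_test k U"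
  shows "(\<lambda>p. \<omega> p - \<eta> p) \<in> rumin_test k U"
  using rumin_test_add[OF assms(1) rumin_test_scale[OF assms(2), of "- 1"]] by simp

lemma rumin_test_sum:
  "finite I \<Longrightarrow> (\<And>i. i \<in> I \<Longrightarrow> f i \<in> rumin_test k U) \<Longrightarrow> (\<lambda>p. \<Sum>i\<in>I. f i p) \<in> rumin_test k U"
  by (induction I rule: finite_induct) (auto simp: rumin_test_zero rumin_test_add)

lemma rumin_test_test_fun_scaleR:
  assumes "\<phi> \<in> test_fun U" "a \<in> rumin_fibre k"
  shows "(\<lambda>p. \<phi> p *\<^sub>R a) \<in> rumin_test k U"
proof -
  obtain C where C: "smooth \<phi>" "compact C" "C \<subseteq> U" "\<And>p. p \<notin> C \<Longrightarrow> \<phi> p = 0"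
    using assms(1) unfolding test_fun_def by blast
  show ?thesis
  proof (rule rumin_testI[OF _ _ C(2,3)])
    show "smooth (\<lambda>p. \<phi> p *\<^sub>R a)" by (rule smooth_scaleR[OF C(1) smooth_const])
    show "\<phi> p *\<^sub>R a \<in> rumin_fibre k" for p
      by (rule subspace_scale[OF subspace_rumin_fibre assms(2)])
    show "\<phi> p *\<^sub>R a = 0" if "p \<notin> C" for p using C(4)[OF that] by simp
  qed
qed

lemma rumin_test_inner_test_fun:
  assumes "\<omega> \<in> rumin_test k U"
  shows "(\<lambda>p. \<omega> p \<bullet> a) \<in> test_fun U"
proof (rule test_funI[of _ "form_support \<omega>"])
  show "smooth (\<lambda>p. \<omega> p \<bullet> a)"
    by (rule smooth_bounded_linear[OF bounded_linear_inner_left rumin_test_smooth[OF assms]])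
qed (use rumin_test_compact[OF assms] rumin_test_support[OF assms] in \<open>simp_all add: not_in_form_support\<close>)

section \<open>The Rumin differential on test forms\<close>

lemma rumin_L_add:
  fixes \<omega> \<eta> :: "'n::{finite,linorder} form"
  assumes "smooth \<omega>" "smooth \<eta>" "\<And>p. \<omega> p \<in> graded CARD('n)" "\<And>p. \<eta> p \<in> graded CARD('n)"
  shows "rumin_L (\<lambda>p. \<omega> p + \<eta> p) p = rumin_L \<omega> p + rumin_L \<eta> p"
proof -
  obtain G :: "'n ext \<Rightarrow> 'n ext" where G: "linear G"
    "\<And>\<omega> p. smooth \<omega> \<Longrightarrow> (\<And>p. \<omega> p \<in> graded CARD('n)) \<Longrightarrow> rumin_L \<omega> p = G (ext_d \<omega> p)"
    using rumin_L_linear by blast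
  have "rumin_L (\<lambda>p. \<omega> p + \<eta> p) p = G (ext_d (\<lambda>p. \<omega> p + \<eta> p) p)"
    by (rule G(2)[OF smooth_add[OF assms(1,2)]]) (intro subspace_add subspace_graded assms(3,4))
  then show ?thesis
    unfolding ext_d_add[OF assms(1,2)] linear_add[OF G(1)] G(2)[OF assms(1,3)] G(2)[OF assms(2,4)] .
qed

lemma rumin_L_scale:
  fixes \<omega> :: "'n::{finite,linorder} form"
  assumes "smooth \<omega>" "\<And>p. \<omega> p \<in> graded CARD('n)"
  shows "rumin_L (\<lambda>p. c *\<^sub>R \<omega> p) p = c *\<^sub>R rumin_L \<omega> p"
proof -
  obtain G :: "'n ext \<Rightarrow> 'n ext" where G: "linear G"
    "\<And>\<omega> p. smooth \<omega> \<Longrightarrow> (\<And>p. \<omega> p \<in> graded CARD('n)) \<Longrightarrow> rumin_L \<omega> p = G (ext_d \<omega> p)"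
    using rumin_L_linear by blast
  have "rumin_L (\<lambda>p. c *\<^sub>R \<omega> p) p = G (ext_d (\<lambda>p. c *\<^sub>R \<omega> p) p)"
    by (rule G(2)[OF smooth_scaleR[OF smooth_const assms(1)]]) (intro subspace_scale subspace_graded assms(2))
  then show ?thesis
    unfolding ext_d_scale[OF assms(1)] linear_scale[OF G(1)] G(2)[OF assms] .
qed

lemma rumin_d_add:
  fixes \<omega> \<eta> :: "'n::{finite,linorder} form"
  assumes "smooth \<omega>" "smooth \<eta>" "\<And>p. \<omega> p \<in> graded k" "\<And>p. \<eta> p \<in> graded k"
  shows "rumin_d k (\<lambda>p. \<omega> p + \<eta> p) = (\<lambda>p. rumin_d k \<omega> p + rumin_d k \<eta> p)"
proof (cases "k = CARD('n)")
  case True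
  have a: "\<And>p. \<omega> p \<in> graded CARD('n)" "\<And>p. \<eta> p \<in> graded CARD('n)"
    using assms(3,4) unfolding True .
  have "rumin_lift (\<lambda>p. \<omega> p + \<eta> p) = (\<lambda>p. rumin_lift \<omega> p + rumin_lift \<eta> p)"
    by (rule ext) (simp add: rumin_lift_def rumin_L_add[OF assms(1,2) a] wedge_add_right)
  then show ?thesis
    unfolding rumin_d_eq if_P[OF True]
    by (simp only: ext_d_add[OF smooth_rumin_lift[OF assms(1) a(1)] smooth_rumin_lift[OF assms(2) a(2)], abs_def])
next
  case False
  then show ?thesis
    unfolding rumin_d_eq by (simp add: ext_d_add[OF assms(1,2), abs_def])
qed

lemma rumin_d_scale:
  fixes \<omega> :: "'n::{finite,linorder} form"
  assumes "smooth \<omega>" "\<And>p. \<omega> p \<in> graded k"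
  shows "rumin_d k (\<lambda>p. c *\<^sub>R \<omega> p) = (\<lambda>p. c *\<^sub>R rumin_d k \<omega> p)"
proof (cases "k = CARD('n)")
  case True
  have a: "\<And>p. \<omega> p \<in> graded CARD('n)"
    using assms(2) unfolding True .
  have "rumin_lift (\<lambda>p. c *\<^sub>R \<omega> p) = (\<lambda>p. c *\<^sub>R rumin_lift \<omega> p)"
    by (rule ext) (simp add: rumin_lift_def rumin_L_scale[OF assms(1) a] wedge_scaleR_right scaleR_add_right)
  then show ?thesis
    unfolding rumin_d_eq if_P[OF True]
    by (simp only: ext_d_scale[OF smooth_rumin_lift[OF assms(1) a], abs_def])
next
  case False
  then show ?thesis
    unfolding rumin_d_eq by (simp add: ext_d_scale[OF assms(1), abs_def])
qed

lemma smooth_rumin_d: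
  fixes \<omega> :: "'n::{finite,linorder} form"
  assumes "smooth \<omega>" "\<And>p. \<omega> p \<in> graded k"
  shows "smooth (rumin_d k \<omega>)"
  unfolding rumin_d_eq using assms by (auto intro!: smooth_ext_d smooth_rumin_lift)

lemma rumin_d_fibre:
  fixes \<omega> :: "'n::{finite,linorder} form"
  assumes "smooth \<omega>" "\<And>p. \<omega> p \<in> rumin_fibre k"
  shows "rumin_d k \<omega> p \<in> rumin_fibre (Suc k)"
proof -
  consider "Suc k \<le> CARD('n)" | "k = CARD('n)" | "\<not> k \<le> CARD('n)" by linarith
  then show ?thesis
  proof cases
    case 1
    then have "\<omega> p \<in> graded k" for p using assms(2)[of p] by (simp add: rumin_fibre_def)
    from ext_d_graded[OF assms(1) this] show ?thesis
      using 1 by (simp add: rumin_d_eq rumin_fibre_def)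
  next
    case 2
    then have "\<omega> p \<in> graded CARD('n)" for p using assms(2)[of p] by (simp add: rumin_fibre_def)
    from ext_d_rumin_lift_fibre_J[OF assms(1) this] show ?thesis
      using 2 by (simp add: rumin_d_eq rumin_fibre_def)
  next
    case 3
    then have "\<omega> p \<in> fibre_J k" for p using assms(2)[of p] by (simp add: rumin_fibre_def)
    from ext_d_fibre_J[OF assms(1) this] show ?thesis
      using 3 by (simp add: rumin_d_eq rumin_fibre_def)
  qed
qed

text \<open>Locality extends to degree n because \<open>rumin_L\<close> is a pointwise function of
  the exterior derivative, so the lift vanishes on \<open>V\<close> together with the form.\<close>

lemma rumin_d_eq_0:
  fixes \<omega> :: "'n::{finite,linorder} form"
  assumes "smooth \<omega>" "\<And>p. \<omega> p \<in> graded k" "open V" "p \<in> V" "\<And>q. q \<in> V \<Longrightarrow> \<omega> q = 0"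
  shows "rumin_d k \<omega> p = 0"
proof (cases "k = CARD('n)")
  case True
  obtain G :: "'n ext \<Rightarrow> 'n ext" where G: "linear G"
    "\<And>\<omega> p. smooth \<omega> \<Longrightarrow> (\<And>p. \<omega> p \<in> graded CARD('n)) \<Longrightarrow> rumin_L \<omega> p = G (ext_d \<omega> p)"
    using rumin_L_linear by blast
  have a: "\<And>p. \<omega> p \<in> graded CARD('n)"
    using assms(2) unfolding True .
  have "rumin_lift \<omega> q = 0" if "q \<in> V" for q
  proof -
    have "ext_d \<omega> q = 0"
      by (rule ext_d_eq_0[OF assms(3) that]) (rule assms(5))
    then show ?thesis
      unfolding rumin_lift_def G(2)[OF assms(1) a] assms(5)[OF that] by (simp add: linear_0[OF G(1)])
  qed
  then show ?thesis
    using ext_d_eq_0[OF assms(3,4)] True by (simp add: rumin_d_eq)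
next
  case False
  then show ?thesis
    using ext_d_eq_0[OF assms(3,4,5)] by (simp add: rumin_d_eq)
qed

lemma rumin_d_not_in_form_support:
  assumes "\<omega> \<in> rumin_test k U" "p \<notin> form_support \<omega>"
  shows "rumin_d k \<omega> p = 0"
proof (rule rumin_d_eq_0[of _ _ "- form_support \<omega>"])
  show "open (- form_support \<omega>)" by (simp add: form_support_def open_Compl)
qed (use assms in \<open>simp_all add: rumin_test_smooth rumin_test_graded not_in_form_support\<close>)

lemma rumin_d_test:
  assumes "\<omega> \<in> rumin_test k U"
  shows "rumin_d k \<omega> \<in> rumin_test (Suc k) U"
  using assms
  by (intro rumin_testI[of _ _ "form_support \<omega>"])
    (simp_all add: smooth_rumin_d rumin_test_smooth rumin_test_graded rumin_d_fibre rumin_test_fibre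
      rumin_test_compact rumin_test_support rumin_d_not_in_form_support)

lemma rumin_d_null:
  fixes \<omega> :: "'n::{finite,linorder} form"
  assumes "smooth \<omega>" "\<And>p. \<omega> p \<in> rumin_null k"
  shows "rumin_d k \<omega> p \<in> rumin_null (Suc k)"
proof -
  consider "Suc k \<le> CARD('n)" | "k = CARD('n)" | "\<not> k \<le> CARD('n)" by linarith
  then show ?thesis
  proof cases
    case 1
    then have "\<omega> p \<in> fibre_I k" for p using assms(2)[of p] by (simp add: rumin_null_def)
    from ext_d_fibre_I[OF assms(1) this] show ?thesis
      using 1 by (simp add: rumin_d_eq rumin_null_def)
  next
    case 2
    then have "\<omega> p \<in> fibre_I CARD('n)" for p using assms(2)[of p] by (simp add: rumin_null_def)
    from ext_d_rumin_lift_fibre_I[OF assms(1) this] show ?thesis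
      using 2 by (simp add: rumin_d_eq rumin_null_def)
  next
    case 3
    then have "\<omega> p = 0" for p using assms(2)[of p] by (simp add: rumin_null_def)
    then have "ext_d \<omega> p = 0" by (intro ext_d_eq_0[of UNIV]) simp_all
    then show ?thesis
      using 3 by (simp add: rumin_d_eq rumin_null_def)
  qed
qed

text \<open>Beyond the vanishing of \<open>ext_d\<close> applied twice, the case k = n - 1 needs an
  argument: Rumin's operator is 0 on the closed form \<open>ext_d \<omega>\<close>, so the lift
  leaves that form unchanged.\<close>

lemma rumin_d_rumin_d:
  fixes \<omega> :: "'n::{finite,linorder} form"
  assumes "smooth \<omega>" "\<And>p. \<omega> p \<in> graded k"
  shows "rumin_d (Suc k) (rumin_d k \<omega>) = (\<lambda>p. 0)"
proof (rule ext)
  fix p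
  consider "Suc k = CARD('n)" | "k = CARD('n)" | "Suc k \<noteq> CARD('n)" "k \<noteq> CARD('n)" by blast
  then show "rumin_d (Suc k) (rumin_d k \<omega>) p = 0"
  proof cases
    case 1
    then have d: "rumin_d k \<omega> = ext_d \<omega>" by (simp add: rumin_d_eq)
    have g: "ext_d \<omega> p \<in> graded CARD('n)" for p
      using ext_d_graded[OF assms] unfolding 1 .
    obtain G :: "'n ext \<Rightarrow> 'n ext" where G: "linear G"
      "\<And>\<omega> p. smooth \<omega> \<Longrightarrow> (\<And>p. \<omega> p \<in> graded CARD('n)) \<Longrightarrow> rumin_L \<omega> p = G (ext_d \<omega> p)"
      using rumin_L_linear by blast
    have "rumin_L (ext_d \<omega>) p = 0" for p
      unfolding G(2)[OF smooth_ext_d[OF assms(1)] g] ext_d_ext_d[OF assms(1)] by (rule linear_0[OF G(1)])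
    then have "rumin_lift (ext_d \<omega>) = ext_d \<omega>"
      by (simp add: rumin_lift_def fun_eq_iff)
    then show ?thesis
      unfolding d using 1 by (simp add: rumin_d_eq ext_d_ext_d[OF assms(1)])
  next
    case 2
    have a: "\<And>p. \<omega> p \<in> graded CARD('n)"
      using assms(2) unfolding 2 .
    show ?thesis
      using ext_d_ext_d[OF smooth_rumin_lift[OF assms(1) a]] 2 by (simp add: rumin_d_eq)
  next
    case 3
    then show ?thesis
      using ext_d_ext_d[OF assms(1)] by (simp add: rumin_d_eq)
  qed
qed

text \<open>The projection is linear, so applying it pointwise to a smooth form gives a smooth
  form.\<close>

lemma null_projection:
  obtains P :: "'n::{finite,linorder} ext \<Rightarrow> 'n ext"
  where "linear P" "\<And>c. P c \<in> rumin_null k" "\<And>c. c \<in> rumin_null k \<Longrightarrow> P c = c"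
proof (cases "k \<le> CARD('n)")
  case True
  obtain A B :: "'n ext \<Rightarrow> 'n ext" where AB:
    "linear A" "linear B" "\<And>c. A c \<in> shifted_graded 1 k" "\<And>c. B c \<in> shifted_graded 2 k"
    "\<And>c. c \<in> fibre_I k \<Longrightarrow> c = A c \<^bold>\<and> theta + B c \<^bold>\<and> dtheta"
    using fibre_I_select[of k] by metis
  have n: "rumin_null k = (fibre_I k :: 'n ext set)" using True by (simp add: rumin_null_def)
  show ?thesis
  proof (rule that[of "\<lambda>c. A c \<^bold>\<and> theta + B c \<^bold>\<and> dtheta"])
    show "linear (\<lambda>c. A c \<^bold>\<and> theta + B c \<^bold>\<and> dtheta)"
      by (rule linear_compose_add[OF linear_compose[OF AB(1) linear_wedge_left, unfolded o_def]
            linear_compose[OF AB(2) linear_wedge_left, unfolded o_def]])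
    show "A c \<^bold>\<and> theta + B c \<^bold>\<and> dtheta \<in> rumin_null k" for c
      unfolding n fibre_I_eq using AB(3,4) by blast
    show "A c \<^bold>\<and> theta + B c \<^bold>\<and> dtheta = c" if "c \<in> rumin_null k" for c
      using AB(5)[OF that[unfolded n]] by (rule sym)
  qed
next
  case False
  show ?thesis
    by (rule that[of "\<lambda>c. 0"]) (use False in \<open>simp_all add: rumin_null_def linear_zero\<close>)
qed

text \<open>Off its support the form has values in the null space but need not vanish. Subtracting
  its null part \<eta> leaves \<zeta>, which does vanish near \<open>p\<close>; locality handles
  \<zeta> and \<open>rumin_d_null\<close> handles \<eta>.\<close>

lemma rumin_d_not_in_null:
  fixes \<omega> :: "'n::{finite,linorder} form"
  assumes \<omega>: "\<omega> \<in> rumin_test k U" and p: "p \<notin> rumin_support k \<omega>"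
  shows "rumin_d k \<omega> p \<in> rumin_null (Suc k)"
proof -
  obtain P :: "'n ext \<Rightarrow> 'n ext" where P:
    "linear P" "\<And>c. P c \<in> rumin_null k" "\<And>c. c \<in> rumin_null k \<Longrightarrow> P c = c"
    using null_projection[of k] by metis
  define \<eta> where "\<eta> = (\<lambda>p. P (\<omega> p))"
  have s\<eta>: "smooth \<eta>"
    unfolding \<eta>_def by (rule smooth_linear_image[OF P(1) rumin_test_smooth[OF \<omega>]])
  have n\<eta>: "\<eta> p \<in> rumin_null k" for p unfolding \<eta>_def by (rule P(2))
  have g\<eta>: "\<eta> p \<in> graded k" for p
    using n\<eta>[of p] rumin_null_subset rumin_fibre_graded by blast
  define \<zeta> where "\<zeta> = (\<lambda>p. \<omega> p - \<eta> p)"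
  have s\<zeta>: "smooth \<zeta>"
    unfolding \<zeta>_def by (rule smooth_diff[OF rumin_test_smooth[OF \<omega>] s\<eta>])
  have g\<zeta>: "\<zeta> p \<in> graded k" for p
    unfolding \<zeta>_def by (intro subspace_diff subspace_graded rumin_test_graded[OF \<omega>] g\<eta>)
  have "rumin_d k \<zeta> p = 0"
  proof (rule rumin_d_eq_0[OF s\<zeta> g\<zeta>])
    show "open (- rumin_support k \<omega>)" by (simp add: rumin_support_def open_Compl)
    show "p \<in> - rumin_support k \<omega>" using p by simp
    fix q assume "q \<in> - rumin_support k \<omega>"
    then have "\<omega> q \<in> rumin_null k"
      unfolding rumin_support_def using closure_subset[of "{p. \<omega> p \<notin> rumin_null k}"] by blast
    then show "\<zeta> q = 0" using P(3) by (simp add: \<zeta>_def \<eta>_def)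
  qed
  moreover have "\<omega> = (\<lambda>p. \<zeta> p + \<eta> p)" by (simp add: \<zeta>_def)
  then have "rumin_d k \<omega> = (\<lambda>p. rumin_d k \<zeta> p + rumin_d k \<eta> p)"
    using rumin_d_add[OF s\<zeta> s\<eta> g\<zeta> g\<eta>] by simp
  ultimately show ?thesis
    using rumin_d_null[OF s\<eta> n\<eta>] by simp
qed

lemma rumin_support_rumin_d:
  assumes "\<omega> \<in> rumin_test k U"
  shows "rumin_support (Suc k) (rumin_d k \<omega>) \<subseteq> rumin_support k \<omega>"
proof -
  have "closed (rumin_support k \<omega>)" by (simp add: rumin_support_def)
  then show ?thesis
    unfolding rumin_support_def[of "Suc k"]
    using rumin_d_not_in_null[OF assms] by (intro closure_minimal) blast
qed

section \<open>Comass and the pairing with integrable multivectors\<close>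

lemma left_inv_field_axis: "left_inv_field (axis i 1) p = frame i p"
proof -
  have "left_inv_field (axis i 1) p = (\<Sum>j\<in>UNIV. if j = i then frame i p else 0)"
    unfolding left_inv_field_def by (rule sum.cong) (auto simp: axis_def)
  then show ?thesis by simp
qed

lemma ext_of_lie_axis: "ext_of_lie (axis i 1) = basis_ext {i}"
proof -
  have "ext_of_lie (axis i 1) = (\<Sum>j\<in>UNIV. if j = i then basis_ext {i} else 0)"
    unfolding ext_of_lie_def by (rule sum.cong) (auto simp: axis_def)
  then show ?thesis by simp
qed

text \<open>The fields of x type commute, so any set of them spans an integrable distribution; they
  witness that integrable multivectors exist in every degree up to n.\<close>

definition x_fields :: "'n::finite list \<Rightarrow> 'n lie list" where
  "x_fields js = map (\<lambda>j. axis (Ix j) 1) js"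

lemma wedge_list_x_fields:
  "distinct js \<Longrightarrow> \<exists>s. \<bar>s\<bar> = 1 \<and> wedge_list (x_fields js) = s *\<^sub>R basis_ext (Ix ` set js)"
proof (induction js)
  case Nil
  then show ?case by (intro exI[of _ 1]) (simp add: wedge_list_def x_fields_def)
next
  case (Cons j js)
  then obtain s where s: "\<bar>s\<bar> = 1" "wedge_list (x_fields js) = s *\<^sub>R basis_ext (Ix ` set js)"
    by auto
  have "wedge_list (x_fields (j # js)) = ext_of_lie (axis (Ix j) 1) \<^bold>\<and> wedge_list (x_fields js)"
    by (simp add: wedge_list_def x_fields_def)
  also have "\<dots> = s *\<^sub>R (basis_ext {Ix j} \<^bold>\<and> basis_ext (Ix ` set js))"
    unfolding s(2) ext_of_lie_axis wedge_scaleR_right ..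
  also have "{Ix j} \<inter> Ix ` set js = {}" using Cons.prems by auto
  then have "basis_ext {Ix j} \<^bold>\<and> basis_ext (Ix ` set js) =
      shuffle_sign {Ix j} (Ix ` set js) *\<^sub>R basis_ext (Ix ` set (j # js))"
    by (simp add: basis_wedge_basis)
  finally have "wedge_list (x_fields (j # js)) =
      (s * shuffle_sign {Ix j} (Ix ` set js)) *\<^sub>R basis_ext (Ix ` set (j # js))"
    by simp
  moreover have "\<bar>s * shuffle_sign {Ix j} (Ix ` set js)\<bar> = 1"
    using s(1) shuffle_sign_cases[of "{Ix j}" "Ix ` set js"] by (auto simp: abs_mult)
  ultimately show ?case by blast
qed

text \<open>The span of the \<open>X\<^sub>j\<close> at \<open>p\<close> does not change along the affine plane through \<open>p\<close> that it spans.\<close>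

lemma integrable_x_fields:
  "integrable_distribution (\<lambda>p. span ((\<lambda>v. left_inv_field v p) ` set (x_fields js)))"
proof -
  have D: "(\<lambda>v. left_inv_field v p) ` set (x_fields js) = (\<lambda>j. frame (Ix j) p) ` set js" for p :: "'a hpoint"
    by (simp add: x_fields_def image_image left_inv_field_axis)
  have sub: "subspace {u :: 'a hpoint. fst (snd u) = 0}"
    by (simp add: subspace_def)
  have y0: "fst (snd u) = 0" if "u \<in> span ((\<lambda>j. frame (Ix j) p) ` set js)" for u p :: "'a hpoint"
  proof -
    have "(\<lambda>j. frame (Ix j) p) ` set js \<subseteq> {u. fst (snd u) = 0}"
      by (cases p) auto
    then show ?thesis using span_minimal[OF _ sub] that by blast
  qed
  have frame_shift: "frame (Ix j) (p + u) = frame (Ix j) p" if "fst (snd u) = 0" for j and p u :: "'a hpoint"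
    using that by (cases p; cases u) simp
  show ?thesis
    unfolding integrable_distribution_def D
  proof (intro allI)
    fix p :: "'a hpoint"
    have "smooth (\<lambda>u. p + u)" by (rule smooth_add[OF smooth_const smooth_ident])
    moreover have "frechet_derivative (\<lambda>u. p + u) (at u) = (\<lambda>v. v)" for u
      by (rule frechet_derivative_at[symmetric]) (auto intro!: derivative_eq_intros)
    then have "frechet_derivative (\<lambda>u. p + u) (at u) ` span ((\<lambda>j. frame (Ix j) p) ` set js)
        = span ((\<lambda>j. frame (Ix j) (p + u)) ` set js)" if "u \<in> UNIV \<inter> span ((\<lambda>j. frame (Ix j) p) ` set js)" for u
      using frame_shift[OF y0] that by simp
    ultimately show "\<exists>V \<phi>. open V \<and> 0 \<in> V \<and> smooth_on V \<phi> \<and> \<phi> 0 = p \<and>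
        (\<forall>u\<in>V \<inter> span ((\<lambda>j. frame (Ix j) p) ` set js).
          frechet_derivative \<phi> (at u) ` span ((\<lambda>j. frame (Ix j) p) ` set js)
            = span ((\<lambda>j. frame (Ix j) (\<phi> u)) ` set js))"
      by (intro exI[of _ UNIV] exI[of _ "\<lambda>u. p + u"] conjI ballI) auto
  qed
qed

lemma linear_hodge: "linear hodge"
proof (rule linearI)
  show "hodge (a + b) = hodge a + hodge b" for a b :: "'a ext"
    unfolding hodge_def vector_add_component scaleR_add_left sum.distrib ..
  show "hodge (c *\<^sub>R a) = c *\<^sub>R hodge a" for c and a :: "'a ext"
    unfolding hodge_def vector_scaleR_component scaleR_sum_right real_scaleR_def scaleR_scaleR mult.assoc ..
qed

lemma hodge_basis: "hodge (basis_ext S) = shuffle_sign S (- S) *\<^sub>R basis_ext (- S)"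
proof -
  have "hodge (basis_ext S) = (\<Sum>R\<in>UNIV. if R = S then shuffle_sign S (- S) *\<^sub>R basis_ext (- S) else 0)"
    unfolding hodge_def by (rule sum.cong) (auto simp: basis_ext_nth)
  then show ?thesis by simp
qed

lemma horizontal_simple_integrable_basis:
  assumes "k \<le> CARD('n)"
  obtains s and S :: "'n::{finite,linorder} hidx set"
  where "\<bar>s\<bar> = 1" "s *\<^sub>R basis_ext S \<in> horizontal_simple_integrable k"
proof -
  obtain js :: "'n list" where js: "distinct js" "set js = UNIV"
    using finite_distinct_list[of "UNIV :: 'n set"] by auto
  then have len: "length js = CARD('n)" using distinct_card[of js] by simp
  let ?ks = "take k js"
  obtain s where s: "\<bar>s\<bar> = 1" "wedge_list (x_fields ?ks) = s *\<^sub>R basis_ext (Ix ` set ?ks)"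
    using wedge_list_x_fields[of ?ks] js(1) by auto
  have "length (x_fields ?ks) = k" using len assms by (simp add: x_fields_def)
  moreover have "set (x_fields ?ks) \<subseteq> lie1" by (auto simp: x_fields_def lie1_def axis_def)
  ultimately have "1 *\<^sub>R wedge_list (x_fields ?ks) \<in> horizontal_simple_integrable k"
    unfolding horizontal_simple_integrable_def using integrable_x_fields by blast
  then show ?thesis using that s by simp
qed

text \<open>It keeps the set whose supremum is \<open>comass\<close> nonempty. Degrees above n are
  reached by the Hodge operator, which maps basis elements to basis elements up to sign.\<close>

lemma simple_integrable_unit:
  assumes "k \<le> 2 * CARD('n) + 1"
  obtains v :: "'n::{finite,linorder} ext" where "v \<in> simple_integrable k" "norm v = 1"
proof (cases "k \<le> CARD('n)")
  case True
  obtain s and S :: "'n hidx set" where "\<bar>s\<bar> = 1" "s *\<^sub>R basis_ext S \<in> horizontal_simple_integrable k"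
    using horizontal_simple_integrable_basis[OF True] .
  then show ?thesis
    using True by (intro that[of "s *\<^sub>R basis_ext S"]) (simp_all add: simple_integrable_def)
next
  case False
  then have "2 * CARD('n) + 1 - k \<le> CARD('n)" by linarith
  then obtain s and S :: "'n hidx set" where s: "\<bar>s\<bar> = 1"
    "s *\<^sub>R basis_ext S \<in> horizontal_simple_integrable (2 * CARD('n) + 1 - k)"
    using horizontal_simple_integrable_basis by blast
  have "norm (hodge (s *\<^sub>R basis_ext S)) = 1"
    using s(1) shuffle_sign_cases[of S "- S"] by (auto simp: linear_scale[OF linear_hodge] hodge_basis)
  then show ?thesis
    using False s(2) by (intro that[of "hodge (s *\<^sub>R basis_ext S)"]) (simp_all add: simple_integrable_def)
qed

text \<open>The factor \<open>c\<close> in \<open>horizontal_simple_integrable\<close> provides this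
  in every degree, including 0. Unit rescaling and sign changes rely on it.\<close>

lemma simple_integrable_scale:
  assumes "v \<in> simple_integrable k"
  shows "c *\<^sub>R v \<in> simple_integrable k"
proof -
  have h: "c *\<^sub>R w \<in> horizontal_simple_integrable l"
    if "w \<in> horizontal_simple_integrable l" for w :: "'a ext" and l
    using that unfolding horizontal_simple_integrable_def by (smt (verit) mem_Collect_eq scaleR_scaleR)
  show ?thesis
  proof (cases "k \<le> CARD('a)")
    case True
    then show ?thesis using assms h by (simp add: simple_integrable_def)
  next
    case False
    then obtain w where "w \<in> horizontal_simple_integrable (2 * CARD('a) + 1 - k)" "v = hodge w"
      using assms by (auto simp: simple_integrable_def)
    then show ?thesis
      using False h by (auto simp: simple_integrable_def linear_scale[OF linear_hodge, symmetric])
  qed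
qed

section \<open>Comass and its dual\<close>

lemma comass_least:
  assumes "k \<le> 2 * CARD('n) + 1"
    "\<And>v. v \<in> simple_integrable k \<Longrightarrow> norm v = 1 \<Longrightarrow> a \<bullet> v \<le> c"
  shows "comass k (a :: 'n::{finite,linorder} ext) \<le> c"
  unfolding comass_def using simple_integrable_unit[OF assms(1)] assms(2)
  by (intro cSup_least) auto

lemma comass_le_norm:
  assumes "k \<le> 2 * CARD('n) + 1"
  shows "comass k (a :: 'n::{finite,linorder} ext) \<le> norm a"
  by (rule comass_least[OF assms]) (metis mult.right_neutral norm_cauchy_schwarz)

lemma comass_upper:
  assumes "v \<in> simple_integrable k" "norm v = 1"
  shows "a \<bullet> v \<le> comass k a"
  unfolding comass_def
proof (rule cSup_upper)
  show "bdd_above {a \<bullet> v |v. v \<in> simple_integrable k \<and> norm v = 1}"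
  proof (rule bdd_aboveI[of _ "norm a"])
    fix x assume "x \<in> {a \<bullet> v |v. v \<in> simple_integrable k \<and> norm v = 1}"
    then obtain v where "x = a \<bullet> v" "norm v = 1" by blast
    then show "x \<le> norm a" using norm_cauchy_schwarz[of a v] by simp
  qed
qed (use assms in blast)

text \<open>A bound on the comass controls pairings with simple integrable vectors; for linear
  combinations these bounds add up. This makes the supremum in \<open>dual_comass\<close> finite on
  \<open>H_multivectors k\<close>.\<close>

lemma comass_pairing_bounded:
  assumes "v \<in> H_multivectors k"
  obtains K where "0 \<le> K" "\<And>a. comass k a \<le> 1 \<Longrightarrow> \<bar>a \<bullet> v\<bar> \<le> K"
proof -
  have "\<exists>K. \<forall>a. comass k a \<le> 1 \<longrightarrow> \<bar>a \<bullet> v\<bar> \<le> K"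
    using assms unfolding H_multivectors_def
  proof (induction rule: span_induct_alt)
    case base
    show ?case by (intro exI[of _ 0]) simp
  next
    case (step c x y)
    then obtain K where K: "\<And>a. comass k a \<le> 1 \<Longrightarrow> \<bar>a \<bullet> y\<bar> \<le> K" by blast
    have "\<bar>a \<bullet> x\<bar> \<le> norm x" if a: "comass k a \<le> 1" for a
    proof (cases "x = 0")
      case False
      have "a \<bullet> (s *\<^sub>R x) \<le> 1" if "\<bar>s\<bar> = 1 / norm x" for s
        using comass_upper[OF simple_integrable_scale[OF step(1)], of s a] that False a by simp
      from this[of "1 / norm x"] this[of "- (1 / norm x)"] show ?thesis
        using False by (simp add: abs_le_iff field_simps)
    qed simp
    then have "\<bar>a \<bullet> (c *\<^sub>R x + y)\<bar> \<le> \<bar>c\<bar> * norm x + K" if "comass k a \<le> 1" for a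
      using K[OF that] that
      by (auto simp: inner_add_right abs_mult intro!: abs_triangle_ineq[THEN order_trans] add_mono mult_left_mono)
    then show ?case by blast
  qed
  then obtain K where "\<And>a. comass k a \<le> 1 \<Longrightarrow> \<bar>a \<bullet> v\<bar> \<le> K" by blast
  then show ?thesis
    using that[of "max K 0"] by (meson max.cobounded1 max.cobounded2 order_trans)
qed

context
  fixes k :: nat
  assumes k: "k \<le> 2 * CARD('n::{finite,linorder}) + 1"
begin

lemma comass_zero: "comass k (0 :: 'n ext) \<le> 1"
  using comass_le_norm[OF k, of 0] by simp

lemma dual_comass_upper:
  fixes v :: "'n ext"
  assumes "v \<in> H_multivectors k" "a \<in> rumin_fibre k" "comass k a \<le> 1"
  shows "a \<bullet> v \<le> dual_comass k v"
  unfolding dual_comass_def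
proof (rule cSup_upper)
  obtain K where K: "\<And>a. comass k a \<le> 1 \<Longrightarrow> \<bar>a \<bullet> v\<bar> \<le> K"
    using comass_pairing_bounded[OF assms(1)] by metis
  show "bdd_above {a \<bullet> v |a. a \<in> rumin_fibre k \<and> comass k a \<le> 1}"
    by (rule bdd_aboveI[of _ K]) (use K in force)
qed (use assms in blast)

lemma dual_comass_least:
  fixes v :: "'n ext"
  assumes "\<And>a. a \<in> rumin_fibre k \<Longrightarrow> comass k a \<le> 1 \<Longrightarrow> a \<bullet> v \<le> c"
  shows "dual_comass k v \<le> c"
  unfolding dual_comass_def
  using comass_zero subspace_0[OF subspace_rumin_fibre, of k] assms by (intro cSup_least) auto

lemma dual_comass_nonneg:
  fixes v :: "'n ext"
  assumes "v \<in> H_multivectors k"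
  shows "0 \<le> dual_comass k v"
  using dual_comass_upper[OF assms subspace_0[OF subspace_rumin_fibre] comass_zero] by simp

text \<open>The Euclidean norm dominates the comass, so \<open>a\<close> divided by its norm is
  admissible in the dual comass. In particular a vector of dual comass 0 pairs to 0 with the whole
  fibre.\<close>

lemma pairing_le:
  fixes v :: "'n ext"
  assumes v: "v \<in> H_multivectors k" and a: "a \<in> rumin_fibre k"
  shows "\<bar>a \<bullet> v\<bar> \<le> dual_comass k v * norm a"
proof (cases "a = 0")
  case False
  have "(s *\<^sub>R a) \<bullet> v \<le> dual_comass k v" if "\<bar>s\<bar> = 1 / norm a" for s
  proof (rule dual_comass_upper[OF v])
    show "s *\<^sub>R a \<in> rumin_fibre k" by (rule subspace_scale[OF subspace_rumin_fibre a])
    show "comass k (s *\<^sub>R a) \<le> 1"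
      using comass_le_norm[OF k, of "s *\<^sub>R a"] that False by simp
  qed
  from this[of "1 / norm a"] this[of "- (1 / norm a)"] show ?thesis
    using False by (simp add: abs_le_iff field_simps)
qed simp

lemma dual_comass_normalise:
  fixes v :: "'n ext"
  assumes v: "v \<in> H_multivectors k" and pos: "0 < dual_comass k v"
  shows "dual_comass k ((1 / dual_comass k v) *\<^sub>R v) = 1"
proof (rule antisym)
  let ?d = "dual_comass k v"
  show "dual_comass k ((1 / ?d) *\<^sub>R v) \<le> 1"
    by (rule dual_comass_least) (use dual_comass_upper[OF v] pos in \<open>simp add: field_simps\<close>)
  have H: "(1 / ?d) *\<^sub>R v \<in> H_multivectors k"
    using v by (simp add: H_multivectors_def span_scale)
  have "?d \<le> ?d * dual_comass k ((1 / ?d) *\<^sub>R v)"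
  proof (rule dual_comass_least)
    fix a :: "'n ext" assume "a \<in> rumin_fibre k" "comass k a \<le> 1"
    from dual_comass_upper[OF H this] show "a \<bullet> v \<le> ?d * dual_comass k ((1 / ?d) *\<^sub>R v)"
      using pos by (simp add: field_simps)
  qed
  then show "1 \<le> dual_comass k ((1 / ?d) *\<^sub>R v)" using pos by simp
qed

text \<open>The pairing is continuous in the covector, so the supremum may be taken over a countable
  dense set of admissible covectors.\<close>

lemma borel_measurable_dual_comass:
  fixes \<tau> :: "'a \<Rightarrow> 'n ext"
  assumes [measurable]: "\<tau> \<in> borel_measurable M" and H: "\<And>p. \<tau> p \<in> H_multivectors k"
  shows "(\<lambda>p. dual_comass k (\<tau> p)) \<in> borel_measurable M"
  unfolding borel_measurable_iff_greater
proof (intro allI)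
  fix c :: real
  let ?A = "{a :: 'n ext. a \<in> rumin_fibre k \<and> comass k a \<le> 1}"
  obtain D where D: "countable D" "D \<subseteq> ?A" "?A \<subseteq> closure D"
    by (rule separable[of ?A])
  have "c < dual_comass k (\<tau> p) \<longleftrightarrow> (\<exists>a\<in>D. c < a \<bullet> \<tau> p)" for p
  proof
    assume "c < dual_comass k (\<tau> p)"
    then have "\<not> (\<forall>a. a \<in> ?A \<longrightarrow> a \<bullet> \<tau> p \<le> c)"
      using dual_comass_least[of "\<tau> p" c] by fastforce
    then obtain a where a: "a \<in> ?A" "c < a \<bullet> \<tau> p"
      by (auto simp: not_le)
    have "open {a. c < a \<bullet> \<tau> p}"
      by (intro open_Collect_less continuous_intros)
    then have "{a. c < a \<bullet> \<tau> p} \<inter> D \<noteq> {}"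
      using a D(3) open_Int_closure_eq_empty[of "{a. c < a \<bullet> \<tau> p}" D] by blast
    then show "\<exists>a\<in>D. c < a \<bullet> \<tau> p" by blast
  next
    assume "\<exists>a\<in>D. c < a \<bullet> \<tau> p"
    then obtain a where a: "a \<in> D" "c < a \<bullet> \<tau> p" by blast
    then have "a \<bullet> \<tau> p \<le> dual_comass k (\<tau> p)"
      using D(2) by (intro dual_comass_upper[OF H]) auto
    then show "c < dual_comass k (\<tau> p)" using a(2) by linarith
  qed
  then have "{p \<in> space M. c < dual_comass k (\<tau> p)} = (\<Union>a\<in>D. {p \<in> space M. c < a \<bullet> \<tau> p})"
    by blast
  also have "\<dots> \<in> sets M"
  proof (rule sets.countable_UN'[OF D(1)], rule image_subsetI)
    fix a assume "a \<in> D"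
    have "(\<lambda>p. a \<bullet> \<tau> p) \<in> borel_measurable M" by measurable
    then show "{p \<in> space M. c < a \<bullet> \<tau> p} \<in> sets M"
      by (simp add: borel_measurable_iff_greater)
  qed
  finally show "{p \<in> space M. c < dual_comass k (\<tau> p)} \<in> sets M" .
qed

end

section \<open>Linear algebra of the pairing of two subspaces\<close>

lemma orthonormal_expansion:
  fixes x :: "'a::euclidean_space"
  assumes "finite B" "pairwise orthogonal B" "\<And>b. b \<in> B \<Longrightarrow> norm b = 1" "x \<in> span B"
  shows "x = (\<Sum>b\<in>B. (x \<bullet> b) *\<^sub>R b)"
proof -
  define y where "y = x - (\<Sum>b\<in>B. (x \<bullet> b) *\<^sub>R b)"
  have "y \<bullet> c = 0" if "c \<in> B" for c
  proof -
    have "(\<Sum>b\<in>B. (x \<bullet> b) * (b \<bullet> c)) = (\<Sum>b\<in>B. if b = c then x \<bullet> c else 0)"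
      using assms(2,3) that by (intro sum.cong) (auto simp: pairwise_def orthogonal_def norm_eq_1)
    then show ?thesis
      using assms(1) that by (simp add: y_def inner_diff_left inner_sum_left)
  qed
  then have "orthogonal y z" if "z \<in> span B" for z
    using orthogonal_to_span[OF that, of y] by (simp add: orthogonal_def)
  moreover have "y \<in> span B"
    unfolding y_def by (intro span_diff assms(4) span_sum span_scale span_base)
  ultimately have "y = 0" by (metis orthogonal_self)
  then show ?thesis by (simp add: y_def)
qed

lemma orthogonal_projection_exists:
  fixes H :: "'a::euclidean_space set"
  assumes "subspace H"
  obtains P where "linear P" "\<And>x. P x \<in> H" "\<And>x v. v \<in> H \<Longrightarrow> P x \<bullet> v = x \<bullet> v"
proof -
  obtain B where B: "B \<subseteq> H" "pairwise orthogonal B" "\<And>b. b \<in> B \<Longrightarrow> norm b = 1" "finite B" "span B = H"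
    using orthonormal_basis_subspace[OF assms] independent_imp_finite by metis
  show ?thesis
  proof (rule that[of "\<lambda>x. \<Sum>b\<in>B. (x \<bullet> b) *\<^sub>R b"])
    show "linear (\<lambda>x. \<Sum>b\<in>B. (x \<bullet> b) *\<^sub>R b)"
      by (auto intro!: linearI simp: inner_add_left scaleR_add_left sum.distrib scaleR_sum_right)
    show "(\<Sum>b\<in>B. (x \<bullet> b) *\<^sub>R b) \<in> H" for x
      by (intro subspace_sum subspace_scale assms) (use B(1) in auto)
    show "(\<Sum>b\<in>B. (x \<bullet> b) *\<^sub>R b) \<bullet> v = x \<bullet> v" if "v \<in> H" for x v
    proof -
      have "v = (\<Sum>b\<in>B. (v \<bullet> b) *\<^sub>R b)"
        by (rule orthonormal_expansion) (use B that in auto)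
      then have "x \<bullet> v = x \<bullet> (\<Sum>b\<in>B. (v \<bullet> b) *\<^sub>R b)" by simp
      then show ?thesis
        by (simp add: inner_sum_left inner_sum_right inner_commute mult.commute)
    qed
  qed
qed

text \<open>A basis of the pairing between \<open>F\<close> and \<open>H\<close>, modulo its kernel in \<open>F\<close>.\<close>

lemma dual_system_exists:
  fixes F H :: "'a::euclidean_space set"
  assumes F: "subspace F" and H: "subspace H"
  obtains B \<alpha> where "finite B" "B \<subseteq> H" "\<And>h. h \<in> B \<Longrightarrow> \<alpha> h \<in> F"
    "\<And>a v. a \<in> F \<Longrightarrow> v \<in> H \<Longrightarrow> (a - (\<Sum>h\<in>B. (a \<bullet> h) *\<^sub>R \<alpha> h)) \<bullet> v = 0"
proof -
  obtain P where P: "linear P" "\<And>x. P x \<in> H" "\<And>x v. v \<in> H \<Longrightarrow> P x \<bullet> v = x \<bullet> v"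
    using orthogonal_projection_exists[OF H] by metis
  have "subspace (P ` F)" by (rule linear_subspace_image[OF P(1) F])
  then obtain B where B: "B \<subseteq> P ` F" "pairwise orthogonal B" "\<And>b. b \<in> B \<Longrightarrow> norm b = 1" "finite B" "span B = P ` F"
    using orthonormal_basis_subspace independent_imp_finite by metis
  \<comment> \<open>Covectors with the same projection pair equally with \<open>H\<close>; \<alpha>
    chooses preimages in \<open>F\<close> of an orthonormal basis of the projected space.\<close>
  then obtain \<alpha> where \<alpha>: "\<And>h. h \<in> B \<Longrightarrow> \<alpha> h \<in> F \<and> P (\<alpha> h) = h"
    by (metis image_iff subsetD)
  show ?thesis
  proof (rule that[OF B(4)])
    show BH: "B \<subseteq> H" using B(1) P(2) by blast
    show "\<alpha> h \<in> F" if "h \<in> B" for h using \<alpha>[OF that] by simp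
    fix a v assume a: "a \<in> F" and v: "v \<in> H"
    have "P a = (\<Sum>h\<in>B. (P a \<bullet> h) *\<^sub>R h)"
      by (rule orthonormal_expansion) (use B a in auto)
    also have "\<dots> = (\<Sum>h\<in>B. (a \<bullet> h) *\<^sub>R P (\<alpha> h))"
      by (rule sum.cong) (use P(3) BH \<alpha> in auto)
    also have "\<dots> = P (\<Sum>h\<in>B. (a \<bullet> h) *\<^sub>R \<alpha> h)"
      by (simp add: linear_sum[OF P(1)] linear_scale[OF P(1)])
    finally have "P (a - (\<Sum>h\<in>B. (a \<bullet> h) *\<^sub>R \<alpha> h)) = 0"
      by (simp add: linear_diff[OF P(1)])
    then show "(a - (\<Sum>h\<in>B. (a \<bullet> h) *\<^sub>R \<alpha> h)) \<bullet> v = 0"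
      using P(3)[OF v] by (metis inner_zero_left)
  qed
qed

section \<open>Representability of functionals of finite mass\<close>

text \<open>The sum of the measures is taken. A common reference measure turns all coefficient
  measures into densities, which can be combined into one vector field.\<close>

lemma dominating_measure:
  fixes N :: "'i \<Rightarrow> 'a::topological_space measure"
  assumes I: "finite I" and N: "\<And>i. i \<in> I \<Longrightarrow> sets (N i) = sets borel" "\<And>i. i \<in> I \<Longrightarrow> finite_measure (N i)"
  obtains M where "sets M = sets borel" "finite_measure M"
    "\<And>i. i \<in> I \<Longrightarrow> absolutely_continuous M (N i)"
proof -
  define e where "e A = (\<Sum>i\<in>I. emeasure (N i) A)" for A
  define M where "M = measure_of UNIV (sets borel) e"
  have s: "sets M = sets borel"
    unfolding M_def by (metis sets.sets_measure_of_eq space_borel)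
  have pos: "positive (sets borel) e"
    by (simp add: positive_def e_def)
  have ca: "countably_additive (sets borel) e"
    unfolding countably_additive_def
  proof (intro allI impI)
    fix A :: "nat \<Rightarrow> 'a set"
    assume A: "range A \<subseteq> sets borel" "disjoint_family A" "\<Union> (range A) \<in> sets borel"
    have "(\<Sum>n. e (A n)) = (\<Sum>i\<in>I. \<Sum>n. emeasure (N i) (A n))"
      unfolding e_def by (rule suminf_sum) (rule summableI)
    also have "\<dots> = (\<Sum>i\<in>I. emeasure (N i) (\<Union> (range A)))"
      by (rule sum.cong[OF refl], rule suminf_emeasure) (use A N(1) in simp_all)
    finally show "(\<Sum>n. e (A n)) = e (\<Union> (range A))" by (simp add: e_def)
  qed
  have em: "emeasure M A = e A" if "A \<in> sets borel" for A
    unfolding M_def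
    by (rule emeasure_measure_of_sigma[OF _ pos ca that]) (metis sets.sigma_algebra_axioms space_borel)
  have space_N: "space (N i) = UNIV" if "i \<in> I" for i
    using sets_eq_imp_space_eq[OF N(1)[OF that]] by simp
  have space_M: "space M = UNIV"
    using sets_eq_imp_space_eq[OF s] by simp
  show ?thesis
  proof (rule that[OF s])
    show "finite_measure M"
    proof (rule finite_measureI)
      have "emeasure (N i) UNIV \<noteq> \<infinity>" if "i \<in> I" for i
        using finite_measure.finite_emeasure_space[OF N(2)[OF that]] space_N[OF that] by simp
      then show "emeasure M (space M) \<noteq> \<infinity>"
        using I by (simp add: space_M em e_def)
    qed
    fix i assume i: "i \<in> I"
    show "absolutely_continuous M (N i)"
      unfolding absolutely_continuous_def
    proof
      fix A assume A: "A \<in> null_sets M"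
      then have "A \<in> sets borel" "e A = 0" using s em by (auto simp: null_sets_def)
      then show "A \<in> null_sets (N i)"
        using i I N(1)[OF i] by (auto simp: e_def null_sets_def)
    qed
  qed
qed

text \<open>Finiteness of \<open>N\<close> makes the Radon-Nikodym derivative finite almost
  everywhere, so it has a real nonnegative version.\<close>

lemma real_density_exists:
  assumes "finite_measure M" "finite_measure N" "absolutely_continuous M N" "sets N = sets M"
  obtains D where "D \<in> borel_measurable M" "\<And>x. 0 \<le> D x" "integrable M D" "N = density M (\<lambda>x. ennreal (D x))"
proof -
  interpret M: finite_measure M by (rule assms(1))
  interpret N: finite_measure N by (rule assms(2))
  obtain D where D: "D \<in> borel_measurable M" "AE x in M. RN_deriv M N x = ennreal (D x)" "\<And>x. 0 \<le> D x"
    using M.real_RN_deriv[OF assms(2,3,4)] by metis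
  have "density M (RN_deriv M N) = density M (\<lambda>x. ennreal (D x))"
    using D(1,2) by (intro density_cong) auto
  then have N: "N = density M (\<lambda>x. ennreal (D x))"
    using M.density_RN_deriv[OF assms(3,4)] by simp
  have "integrable N (\<lambda>x. 1 :: real)" by simp
  then have "integrable (density M (\<lambda>x. ennreal (D x))) (\<lambda>x. 1 :: real)"
    by (rule subst[OF N])
  then have "integrable M (\<lambda>x. D x *\<^sub>R (1::real))"
    using D(1,3) by (subst (asm) integrable_density) auto
  then show ?thesis using that[OF D(1,3) _ N] by simp
qed

text \<open>Formulated for linear functionals of finite mass because it is instantiated with a
  current, with its boundary and with the boundary of that.\<close>

locale finite_mass =
  fixes k :: nat and U :: "'n::{finite,linorder} hpoint set" and T :: "'n functional"
  assumes open_U: "open U"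
    and k: "k \<le> 2 * CARD('n) + 1"
    and T_add: "\<omega> \<in> rumin_test k U \<Longrightarrow> \<eta> \<in> rumin_test k U \<Longrightarrow> T (\<lambda>p. \<omega> p + \<eta> p) = T \<omega> + T \<eta>"
    and T_scale: "\<omega> \<in> rumin_test k U \<Longrightarrow> T (\<lambda>p. c *\<^sub>R \<omega> p) = c * T \<omega>"
    and mass_fin: "mass k U T < \<infinity>"
begin

lemma T_zero: "T (\<lambda>p. 0) = 0"
  using T_scale[OF rumin_test_zero, of 0] by simp

lemma T_sum: "finite I \<Longrightarrow> (\<And>i. i \<in> I \<Longrightarrow> f i \<in> rumin_test k U) \<Longrightarrow> T (\<lambda>p. \<Sum>i\<in>I. f i p) = (\<Sum>i\<in>I. T (f i))"
proof (induction I rule: finite_induct)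
  case (insert i I)
  then show ?case using T_add[of "f i" "\<lambda>p. \<Sum>i\<in>I. f i p"] by (simp add: rumin_test_sum)
qed (simp add: T_zero)

lemma mass_bound:
  obtains M where "0 \<le> M"
    "\<And>\<omega>. \<omega> \<in> rumin_test k U \<Longrightarrow> (\<And>p. comass k (\<omega> p) \<le> 1) \<Longrightarrow> T \<omega> \<le> M"
proof -
  have le: "ereal (T \<omega>) \<le> mass k U T" if "\<omega> \<in> rumin_test k U" "\<And>p. comass k (\<omega> p) \<le> 1" for \<omega>
    unfolding mass_def by (rule SUP_upper) (use that in simp)
  have "ereal (T (\<lambda>p. 0)) \<le> mass k U T"
    by (rule le[OF rumin_test_zero]) (rule comass_zero[OF k])
  then have "0 \<le> mass k U T" by (simp add: T_zero zero_ereal_def)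
  then obtain M where M: "mass k U T = ereal M" "0 \<le> M"
    using mass_fin by (cases "mass k U T") auto
  show ?thesis
    by (rule that[OF M(2)]) (use le M(1) in simp)
qed

text \<open>Every multiple of such a form has comass at most 1, so the mass bounds all multiples of
  \<open>T \<omega>\<close>.\<close>

lemma T_eq_0:
  assumes \<omega>: "\<omega> \<in> rumin_test k U" and 0: "\<And>p v. v \<in> simple_integrable k \<Longrightarrow> \<omega> p \<bullet> v = 0"
  shows "T \<omega> = 0"
proof (rule ccontr)
  assume nz: "T \<omega> \<noteq> 0"
  obtain M where M: "\<And>\<omega>. \<omega> \<in> rumin_test k U \<Longrightarrow> (\<And>p. comass k (\<omega> p) \<le> 1) \<Longrightarrow> T \<omega> \<le> M"
    using mass_bound by metis
  \<comment> \<open>With this factor the value of \<open>T\<close> would be M + 1.\<close>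
  let ?c = "(M + 1) / T \<omega>"
  have "T (\<lambda>p. ?c *\<^sub>R \<omega> p) \<le> M"
    by (rule M[OF rumin_test_scale[OF \<omega>]], rule comass_least[OF k]) (simp add: 0)
  then show False using nz by (simp add: T_scale[OF \<omega>])
qed

lemma coefficient_functional:
  assumes a: "a \<in> rumin_fibre k"
  obtains \<mu> \<nu> where "sets \<mu> = sets borel" "finite_measure \<mu>" "sets \<nu> = sets borel" "finite_measure \<nu>"
    "\<And>\<phi>. \<phi> \<in> test_fun U \<Longrightarrow> T (\<lambda>p. \<phi> p *\<^sub>R a) = (\<integral>p. \<phi> p \<partial>\<mu>) - (\<integral>p. \<phi> p \<partial>\<nu>)"
proof -
  obtain M where M: "0 \<le> M" "\<And>\<omega>. \<omega> \<in> rumin_test k U \<Longrightarrow> (\<And>p. comass k (\<omega> p) \<le> 1) \<Longrightarrow> T \<omega> \<le> M"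
    using mass_bound by metis
  \<comment> \<open>Adding 1 keeps \<open>r\<close> positive for \<open>a = 0\<close>; dividing by
    \<open>r\<close> makes the comass at most 1 when \<phi> is bounded by 1.\<close>
  define r where "r = norm a + 1"
  have r: "0 < r" by (simp add: r_def add_nonneg_pos)
  interpret bounded_functional U "\<lambda>\<phi>. T (\<lambda>p. \<phi> p *\<^sub>R a)" "r * M"
  proof
    fix \<phi> \<psi> :: "'n hpoint \<Rightarrow> real" and c :: real
    assume \<phi>: "\<phi> \<in> test_fun U"
    note \<phi>a = rumin_test_test_fun_scaleR[OF \<phi> a]
    show "T (\<lambda>p. (\<phi> p + \<psi> p) *\<^sub>R a) = T (\<lambda>p. \<phi> p *\<^sub>R a) + T (\<lambda>p. \<psi> p *\<^sub>R a)" if "\<psi> \<in> test_fun U"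
      using T_add[OF \<phi>a rumin_test_test_fun_scaleR[OF that a]] by (simp add: scaleR_add_left)
    show "T (\<lambda>p. (c * \<phi> p) *\<^sub>R a) = c * T (\<lambda>p. \<phi> p *\<^sub>R a)"
      using T_scale[OF \<phi>a, of c] by simp
    assume b: "\<And>p. \<bar>\<phi> p\<bar> \<le> 1"
    have "T (\<lambda>p. (1 / r) *\<^sub>R (\<phi> p *\<^sub>R a)) \<le> M"
    proof (rule M(2)[OF rumin_test_scale[OF \<phi>a]])
      fix p
      have "\<bar>\<phi> p\<bar> * norm a \<le> 1 * norm a" using b by (intro mult_right_mono) auto
      then have "norm ((1 / r) *\<^sub>R (\<phi> p *\<^sub>R a)) \<le> 1"
        using r by (simp add: r_def field_simps)
      then show "comass k ((1 / r) *\<^sub>R (\<phi> p *\<^sub>R a)) \<le> 1"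
        using comass_le_norm[OF k] order_trans by blast
    qed
    then have "(1 / r) * T (\<lambda>p. \<phi> p *\<^sub>R a) \<le> M"
      unfolding T_scale[OF \<phi>a] .
    then show "T (\<lambda>p. \<phi> p *\<^sub>R a) \<le> r * M"
      using r by (simp add: field_simps)
  qed (rule open_U)
  show ?thesis using signed_riesz that by metis
qed

text \<open>With a dual system, \<omega> may be replaced by the combination \<eta> of the finitely
  many \<open>\<alpha> h\<close>, as both pair equally with integrable multivectors. The
  coefficients of \<open>T\<close> along the \<open>\<alpha> h\<close> are signed measures, and
  their densities \<open>g h\<close> are the coordinates of \<tau> along the vectors
  \<open>h\<close>.\<close>

lemma vector_measure_exists:
  obtains M \<tau> where "sets M = sets borel" "finite_measure M" "\<tau> \<in> borel_measurable M"
    "\<And>p. \<tau> p \<in> H_multivectors k"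
    "integrable M (\<lambda>p. dual_comass k (\<tau> p))"
    "\<And>\<omega>. \<omega> \<in> rumin_test k U \<Longrightarrow> T \<omega> = (\<integral>p. \<omega> p \<bullet> \<tau> p \<partial>M)"
proof -
  have sH: "subspace (H_multivectors k :: 'n ext set)" by (simp add: H_multivectors_def)
  obtain B :: "'n ext set" and \<alpha> where B: "finite B" "B \<subseteq> H_multivectors k" "\<And>h. h \<in> B \<Longrightarrow> \<alpha> h \<in> rumin_fibre k"
    "\<And>a v. a \<in> rumin_fibre k \<Longrightarrow> v \<in> H_multivectors k \<Longrightarrow> (a - (\<Sum>h\<in>B. (a \<bullet> h) *\<^sub>R \<alpha> h)) \<bullet> v = 0"
    using dual_system_exists[OF subspace_rumin_fibre sH] by blast
  have "\<forall>h\<in>B. \<exists>\<mu> \<nu>. sets \<mu> = sets borel \<and> finite_measure \<mu> \<and> sets \<nu> = sets borel \<and> finite_measure \<nu> \<and>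
    (\<forall>\<phi>\<in>test_fun U. T (\<lambda>p. \<phi> p *\<^sub>R \<alpha> h) = (\<integral>p. \<phi> p \<partial>\<mu>) - (\<integral>p. \<phi> p \<partial>\<nu>))"
  proof
    fix h assume "h \<in> B"
    then show "\<exists>\<mu> \<nu>. sets \<mu> = sets borel \<and> finite_measure \<mu> \<and> sets \<nu> = sets borel \<and> finite_measure \<nu> \<and>
      (\<forall>\<phi>\<in>test_fun U. T (\<lambda>p. \<phi> p *\<^sub>R \<alpha> h) = (\<integral>p. \<phi> p \<partial>\<mu>) - (\<integral>p. \<phi> p \<partial>\<nu>))"
      using coefficient_functional[OF B(3)] by metis
  qed
  then obtain \<mu> \<nu> where \<mu>\<nu>: "\<forall>h\<in>B. sets (\<mu> h) = sets borel \<and> finite_measure (\<mu> h) \<and>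
      sets (\<nu> h) = sets borel \<and> finite_measure (\<nu> h) \<and>
      (\<forall>\<phi>\<in>test_fun U. T (\<lambda>p. \<phi> p *\<^sub>R \<alpha> h) = (\<integral>p. \<phi> p \<partial>\<mu> h) - (\<integral>p. \<phi> p \<partial>\<nu> h))"
    by metis
  \<comment> \<open>One index set covers the positive (\<open>True\<close>) and negative
    (\<open>False\<close>) measures of all coefficients, so that a single measure dominates them
    all.\<close>
  define N where "N = (\<lambda>(h, b). if b then \<mu> h else \<nu> h)"
  have N: "sets (N i) = sets borel" "finite_measure (N i)" if "i \<in> B \<times> (UNIV :: bool set)" for i
    using that \<mu>\<nu> by (auto simp: N_def split: prod.splits)
  have fin: "finite (B \<times> (UNIV :: bool set))" using B(1) by simp
  obtain M where M: "sets M = sets borel" "finite_measure M"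
    "\<And>i. i \<in> B \<times> (UNIV :: bool set) \<Longrightarrow> absolutely_continuous M (N i)"
    by (rule dominating_measure[OF fin, of N]) (simp_all only: N)
  have meas_M: "borel_measurable M = borel_measurable borel"
    using measurable_cong_sets[OF M(1) refl] .
  have "\<exists>D. D \<in> borel_measurable M \<and> (\<forall>x. 0 \<le> D x) \<and> integrable M D \<and> N i = density M (\<lambda>x. ennreal (D x))"
    if "i \<in> B \<times> (UNIV :: bool set)" for i
  proof -
    have "sets (N i) = sets M" by (simp only: N(1)[OF that] M(1))
    from real_density_exists[OF M(2) N(2)[OF that] M(3)[OF that] this] show ?thesis
      by blast
  qed
  then obtain D where D: "\<And>i. i \<in> B \<times> (UNIV :: bool set) \<Longrightarrow> D i \<in> borel_measurable M"
    "\<And>i x. i \<in> B \<times> (UNIV :: bool set) \<Longrightarrow> 0 \<le> D i x"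
    "\<And>i. i \<in> B \<times> (UNIV :: bool set) \<Longrightarrow> integrable M (D i)"
    "\<And>i. i \<in> B \<times> (UNIV :: bool set) \<Longrightarrow> N i = density M (\<lambda>x. ennreal (D i x))"
    by metis
  define g where "g h p = D (h, True) p - D (h, False) p" for h p
  have g_meas: "g h \<in> borel_measurable M" and g_int: "integrable M (g h)" if "h \<in> B" for h
    using D(1)[of "(h, True)"] D(1)[of "(h, False)"] D(3)[of "(h, True)"] D(3)[of "(h, False)"] that
    unfolding g_def[abs_def] by auto
  have T_coeff: "integrable M (\<lambda>p. g h p * \<phi> p)" "T (\<lambda>p. \<phi> p *\<^sub>R \<alpha> h) = (\<integral>p. g h p * \<phi> p \<partial>M)"
    if h: "h \<in> B" and \<phi>: "\<phi> \<in> test_fun U" for h \<phi>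
  proof -
    have \<phi>m: "\<phi> \<in> borel_measurable M"
      unfolding meas_M by (rule smooth_borel_measurable[OF test_fun_smooth[OF \<phi>]])
    have *: "integrable M (\<lambda>p. D (h, b) p * \<phi> p)" "(\<integral>p. \<phi> p \<partial>N (h, b)) = (\<integral>p. D (h, b) p * \<phi> p \<partial>M)" for b
    proof -
      have hb: "(h, b) \<in> B \<times> UNIV" using h by simp
      have nn: "AE x in M. 0 \<le> D (h, b) x" using D(2)[OF hb] by simp
      have "integrable (N (h, b)) \<phi>"
        by (rule test_fun_integrable[OF \<phi> N[OF hb]])
      then show "integrable M (\<lambda>p. D (h, b) p * \<phi> p)"
        unfolding D(4)[OF hb] integrable_density[OF \<phi>m D(1)[OF hb] nn] by simp
      show "(\<integral>p. \<phi> p \<partial>N (h, b)) = (\<integral>p. D (h, b) p * \<phi> p \<partial>M)"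
        unfolding D(4)[OF hb] integral_density[OF \<phi>m D(1)[OF hb] nn] by simp
    qed
    show "integrable M (\<lambda>p. g h p * \<phi> p)"
      using Bochner_Integration.integrable_diff[OF *(1)[of True] *(1)[of False]]
      by (simp add: g_def left_diff_distrib)
    have "T (\<lambda>p. \<phi> p *\<^sub>R \<alpha> h) = (\<integral>p. \<phi> p \<partial>\<mu> h) - (\<integral>p. \<phi> p \<partial>\<nu> h)"
      using \<mu>\<nu> h \<phi> by blast
    also have "\<dots> = (\<integral>p. D (h, True) p * \<phi> p \<partial>M) - (\<integral>p. D (h, False) p * \<phi> p \<partial>M)"
      using *(2)[of True] *(2)[of False] by (simp add: N_def)
    also have "\<dots> = (\<integral>p. g h p * \<phi> p \<partial>M)"
      using Bochner_Integration.integral_diff[OF *(1)[of True] *(1)[of False]]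
      by (simp add: g_def left_diff_distrib)
    finally show "T (\<lambda>p. \<phi> p *\<^sub>R \<alpha> h) = (\<integral>p. g h p * \<phi> p \<partial>M)" .
  qed
  define \<tau> where "\<tau> p = (\<Sum>h\<in>B. g h p *\<^sub>R h)" for p
  have \<tau>_meas: "\<tau> \<in> borel_measurable M"
    unfolding \<tau>_def[abs_def] using g_meas by (intro borel_measurable_sum borel_measurable_scaleR) auto
  have \<tau>_H: "\<tau> p \<in> H_multivectors k" for p
    unfolding \<tau>_def by (intro subspace_sum subspace_scale sH) (use B(2) in auto)
  have T_eq: "T \<omega> = (\<integral>p. \<omega> p \<bullet> \<tau> p \<partial>M)" if \<omega>: "\<omega> \<in> rumin_test k U" for \<omega>
  proof -
    define \<eta> where "\<eta> p = (\<Sum>h\<in>B. (\<omega> p \<bullet> h) *\<^sub>R \<alpha> h)" for p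
    have \<phi>: "(\<lambda>p. \<omega> p \<bullet> h) \<in> test_fun U" for h by (rule rumin_test_inner_test_fun[OF \<omega>])
    have term_test: "(\<lambda>p. (\<omega> p \<bullet> h) *\<^sub>R \<alpha> h) \<in> rumin_test k U" if "h \<in> B" for h
      by (rule rumin_test_test_fun_scaleR[OF \<phi> B(3)[OF that]])
    have \<eta>: "\<eta> \<in> rumin_test k U"
      unfolding \<eta>_def[abs_def] by (rule rumin_test_sum[OF B(1) term_test])
    have "T (\<lambda>p. \<omega> p - \<eta> p) = 0"
    proof (rule T_eq_0[OF rumin_test_diff[OF \<omega> \<eta>]])
      fix p and v :: "'n ext" assume "v \<in> simple_integrable k"
      then have "v \<in> H_multivectors k" by (simp add: H_multivectors_def span_base)
      then show "(\<omega> p - \<eta> p) \<bullet> v = 0"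
        unfolding \<eta>_def by (rule B(4)[OF rumin_test_fibre[OF \<omega>]])
    qed
    then have "T \<omega> = T \<eta>"
      using T_add[OF rumin_test_diff[OF \<omega> \<eta>] \<eta>] by simp
    also have "\<dots> = (\<Sum>h\<in>B. T (\<lambda>p. (\<omega> p \<bullet> h) *\<^sub>R \<alpha> h))"
      unfolding \<eta>_def[abs_def] by (rule T_sum[OF B(1) term_test])
    also have "\<dots> = (\<Sum>h\<in>B. \<integral>p. g h p * (\<omega> p \<bullet> h) \<partial>M)"
      by (rule sum.cong[OF refl]) (rule T_coeff(2)[OF _ \<phi>])
    also have "\<dots> = (\<integral>p. (\<Sum>h\<in>B. g h p * (\<omega> p \<bullet> h)) \<partial>M)"
      by (rule Bochner_Integration.integral_sum[symmetric]) (rule T_coeff(1)[OF _ \<phi>])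
    also have "\<dots> = (\<integral>p. \<omega> p \<bullet> \<tau> p \<partial>M)"
      by (simp add: \<tau>_def inner_sum_right)
    finally show ?thesis .
  qed
  \<comment> \<open>Pairing bounds for the finitely many \<open>h\<close> majorise the dual comass
    of \<tau> by a combination of the integrable functions \<open>g h\<close>.\<close>
  have "\<exists>K. \<forall>a. comass k a \<le> 1 \<longrightarrow> \<bar>a \<bullet> h\<bar> \<le> K" if "h \<in> B" for h
    using comass_pairing_bounded[of h k] B(2) that by blast
  then obtain K where K: "\<And>h a. h \<in> B \<Longrightarrow> comass k a \<le> 1 \<Longrightarrow> \<bar>a \<bullet> h\<bar> \<le> K h"
    by metis
  have d_le: "dual_comass k (\<tau> p) \<le> (\<Sum>h\<in>B. \<bar>g h p\<bar> * K h)" for p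
  proof (rule dual_comass_least[OF k])
    fix a :: "'n ext" assume "comass k a \<le> 1"
    have "a \<bullet> \<tau> p = (\<Sum>h\<in>B. g h p * (a \<bullet> h))"
      by (simp add: \<tau>_def inner_sum_right)
    also have "\<dots> \<le> (\<Sum>h\<in>B. \<bar>g h p\<bar> * K h)"
    proof (rule sum_mono)
      fix h assume "h \<in> B"
      have "g h p * (a \<bullet> h) \<le> \<bar>g h p\<bar> * \<bar>a \<bullet> h\<bar>" by (metis abs_ge_self abs_mult)
      also have "\<dots> \<le> \<bar>g h p\<bar> * K h"
        by (rule mult_left_mono[OF K[OF \<open>h \<in> B\<close> \<open>comass k a \<le> 1\<close>]]) simp
      finally show "g h p * (a \<bullet> h) \<le> \<bar>g h p\<bar> * K h" .
    qed
    finally show "a \<bullet> \<tau> p \<le> (\<Sum>h\<in>B. \<bar>g h p\<bar> * K h)" .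
  qed
  have "integrable M (\<lambda>p. dual_comass k (\<tau> p))"
  proof (rule Bochner_Integration.integrable_bound)
    show "integrable M (\<lambda>p. \<Sum>h\<in>B. \<bar>g h p\<bar> * K h)"
      using g_int by (intro Bochner_Integration.integrable_sum integrable_mult_left integrable_abs)
    show "(\<lambda>p. dual_comass k (\<tau> p)) \<in> borel_measurable M"
      by (rule borel_measurable_dual_comass[OF k \<tau>_meas \<tau>_H])
    show "AE p in M. norm (dual_comass k (\<tau> p)) \<le> norm (\<Sum>h\<in>B. \<bar>g h p\<bar> * K h)"
    proof (rule AE_I2)
      fix p
      show "norm (dual_comass k (\<tau> p)) \<le> norm (\<Sum>h\<in>B. \<bar>g h p\<bar> * K h)"
        using d_le[of p] dual_comass_nonneg[OF k \<tau>_H[of p]] by simp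
    qed
  qed
  then show ?thesis
    by (rule that[OF M(1,2) \<tau>_meas \<tau>_H _ T_eq])
qed

text \<open>A polar decomposition with respect to the dual comass: its value \<open>d\<close> goes
  into the measure, and the normalised vector \<sigma> becomes the orienting field.\<close>

theorem representation_exists: "\<exists>r. represented_by k U T r"
proof -
  obtain M \<tau> where M: "sets M = sets borel" "finite_measure M" "\<tau> \<in> borel_measurable M"
    "\<And>p. \<tau> p \<in> H_multivectors k" "integrable M (\<lambda>p. dual_comass k (\<tau> p))"
    "\<And>\<omega>. \<omega> \<in> rumin_test k U \<Longrightarrow> T \<omega> = (\<integral>p. \<omega> p \<bullet> \<tau> p \<partial>M)"
    using vector_measure_exists by blast
  have space_M: "space M = UNIV" using sets_eq_imp_space_eq[OF M(1)] by simp
  have U_M: "U \<in> sets M" using open_U M(1) by simp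
  define d where "d p = dual_comass k (\<tau> p)" for p
  \<comment> \<open>Where \<open>d p = 0\<close> this is 0, since division by 0 gives 0; the measure
    \<open>M1\<close> does not charge that set.\<close>
  define \<sigma> where "\<sigma> p = (1 / d p) *\<^sub>R \<tau> p" for p
  define M1 where "M1 = density M (\<lambda>p. ennreal (d p))"
  define \<mu> where "\<mu> = restrict_space M1 U"
  have d0: "0 \<le> d p" for p unfolding d_def by (rule dual_comass_nonneg[OF k M(4)])
  have d_meas: "d \<in> borel_measurable M"
    unfolding d_def[abs_def] by (rule borel_measurable_dual_comass[OF k M(3,4)])
  have sets_M1: "sets M1 = sets M" and space_M1: "space M1 = UNIV"
    by (simp_all add: M1_def space_M)
  have U_M1: "U \<inter> space M1 \<in> sets M1" using U_M by (simp add: sets_M1 space_M1)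
  have \<sigma>_meas: "\<sigma> \<in> borel_measurable M"
    unfolding \<sigma>_def[abs_def] using d_meas M(3) by measurable
  then have \<sigma>_meas1: "\<sigma> \<in> borel_measurable M1"
    using measurable_cong_sets[OF sets_M1 refl] by blast
  have fin: "emeasure M1 A \<noteq> \<infinity>" for A
  proof -
    have "emeasure M1 A \<le> emeasure M1 (space M1)"
      by (rule emeasure_space)
    also have "\<dots> = (\<integral>\<^sup>+ p. ennreal (d p) \<partial>M)"
      unfolding M1_def using d_meas by (simp add: emeasure_density cong: nn_integral_cong)
    also have "\<dots> < \<infinity>"
      using M(5) d0 by (simp add: d_def[symmetric] nn_integral_eq_integral)
    finally show ?thesis by simp
  qed
  have "represented_by k U T (\<mu>, \<sigma>)"
    unfolding represented_by_def prod.case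
  proof (intro conjI ballI)
    show "radon_measure_on U \<mu>"
      unfolding radon_measure_on_def
    proof (intro conjI allI impI)
      show "sets \<mu> = sets (restrict_space borel U)"
        unfolding \<mu>_def by (rule sets_restrict_space_cong) (simp add: sets_M1 M(1))
      fix K assume "compact K \<and> K \<subseteq> U"
      then show "emeasure \<mu> K < \<infinity>"
        unfolding \<mu>_def using fin[of K] by (subst emeasure_restrict_space[OF U_M1]) (auto simp: less_top)
    qed
    show "\<sigma> \<in> borel_measurable \<mu>"
      unfolding \<mu>_def by (rule measurable_restrict_space1[OF \<sigma>_meas1])
    show "\<sigma> p \<in> H_multivectors k" for p
      using M(4)[of p] by (simp add: \<sigma>_def H_multivectors_def span_scale)
    have "AE p in M1. dual_comass k (\<sigma> p) = 1"
      unfolding M1_def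
    proof (subst AE_density)
      show "(\<lambda>p. ennreal (d p)) \<in> borel_measurable M" using d_meas by measurable
      show "AE p in M. 0 < ennreal (d p) \<longrightarrow> dual_comass k (\<sigma> p) = 1"
        using dual_comass_normalise[OF k M(4)] by (auto simp: \<sigma>_def d_def ennreal_less_zero_iff)
    qed
    then show "AE p in \<mu>. dual_comass k (\<sigma> p) = 1"
      unfolding \<mu>_def by (subst AE_restrict_space_iff[OF U_M1]) auto
    fix \<omega> assume \<omega>: "\<omega> \<in> rumin_test k U"
    have s\<omega>: "smooth \<omega>" by (rule rumin_test_smooth[OF \<omega>])
    have \<omega>_meas: "\<omega> \<in> borel_measurable M"
      using borel_measurable_continuous_onI[OF smooth_continuous_on[OF s\<omega>]]
        measurable_cong_sets[OF M(1) refl] by blast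
    have \<omega>\<sigma>: "(\<lambda>p. \<omega> p \<bullet> \<sigma> p) \<in> borel_measurable M"
      using \<omega>_meas \<sigma>_meas by measurable
    \<comment> \<open>If \<open>d p = 0\<close>, the vector \<open>\<tau> p\<close> may still be
      nonzero, but by \<open>pairing_le\<close> it pairs to 0 with every Rumin covector.\<close>
    have "d p * (\<omega> p \<bullet> \<sigma> p) = \<omega> p \<bullet> \<tau> p" for p
    proof (cases "d p = 0")
      case True
      then show ?thesis
        using pairing_le[OF k M(4) rumin_test_fibre[OF \<omega>], of p p] by (simp add: d_def)
    qed (simp add: \<sigma>_def)
    then have "T \<omega> = (\<integral>p. d p *\<^sub>R (\<omega> p \<bullet> \<sigma> p) \<partial>M)"
      using M(6)[OF \<omega>] by simp
    also have "\<dots> = (\<integral>p. \<omega> p \<bullet> \<sigma> p \<partial>M1)"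
      unfolding M1_def by (rule integral_density[symmetric]) (use \<omega>\<sigma> d_meas d0 in auto)
    also have "\<dots> = (\<integral>p. indicator U p *\<^sub>R (\<omega> p \<bullet> \<sigma> p) \<partial>M1)"
    proof (rule Bochner_Integration.integral_cong[OF refl])
      fix p
      have "p \<notin> U \<Longrightarrow> \<omega> p = 0"
        using rumin_test_support[OF \<omega>] not_in_form_support by blast
      then show "\<omega> p \<bullet> \<sigma> p = indicator U p *\<^sub>R (\<omega> p \<bullet> \<sigma> p)"
        by (cases "p \<in> U") simp_all
    qed
    also have "\<dots> = (\<integral>p. \<omega> p \<bullet> \<sigma> p \<partial>\<mu>)"
      unfolding \<mu>_def by (rule integral_restrict_space[OF U_M1, symmetric])
    finally show "T \<omega> = (\<integral>p. \<omega> p \<bullet> \<sigma> p \<partial>\<mu>)" .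
  qed
  then show ?thesis by blast
qed

lemma represented_by_current:
  "represented_by k U T (current_measure k U T, current_vector k U T)"
  unfolding current_measure_def current_vector_def
  using someI_ex[OF representation_exists] by simp

end

section \<open>Consequences for an arbitrary representing pair\<close>

locale represented =
  fixes k :: nat and U :: "'n::{finite,linorder} hpoint set" and T :: "'n functional"
    and \<mu> :: "'n hpoint measure" and \<tau> :: "'n hpoint \<Rightarrow> 'n ext"
  assumes open_U: "open U"
    and k: "k \<le> 2 * CARD('n) + 1"
    and rep: "represented_by k U T (\<mu>, \<tau>)"
begin

lemma sets_mu: "sets \<mu> = sets (restrict_space borel U)"
  and finite_compact: "compact K \<Longrightarrow> K \<subseteq> U \<Longrightarrow> emeasure \<mu> K < \<infinity>"
  and tau_meas: "\<tau> \<in> borel_measurable \<mu>"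
  and tau_H: "p \<in> U \<Longrightarrow> \<tau> p \<in> H_multivectors k"
  and tau_norm: "AE p in \<mu>. dual_comass k (\<tau> p) = 1"
  and T_eq: "\<omega> \<in> rumin_test k U \<Longrightarrow> T \<omega> = (\<integral>p. \<omega> p \<bullet> \<tau> p \<partial>\<mu>)"
  using rep unfolding represented_by_def radon_measure_on_def by blast+

lemma space_mu: "space \<mu> = U"
  using sets_eq_imp_space_eq[OF sets_mu] by (simp add: space_restrict_space)

lemma borel_Int_sets: "B \<in> sets borel \<Longrightarrow> U \<inter> B \<in> sets \<mu>"
  unfolding sets_mu by (auto simp: sets_restrict_space)

lemma borel_sets: "B \<in> sets borel \<Longrightarrow> B \<subseteq> U \<Longrightarrow> B \<in> sets \<mu>"
  using borel_Int_sets[of B] by (simp add: Int_absorb1)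

lemma measurable_borel: "f \<in> measurable borel M \<Longrightarrow> f \<in> measurable \<mu> M"
  using measurable_restrict_space1[of f borel M U] measurable_cong_sets[OF sets_mu refl] by blast

text \<open>One null set works for all covectors, because the dual comass already incorporates the
  supremum over them.\<close>

lemma AE_pairing_le: "AE p in \<mu>. \<forall>a\<in>rumin_fibre k. \<bar>a \<bullet> \<tau> p\<bar> \<le> norm a"
  using tau_norm AE_space
proof eventually_elim
  case (elim p)
  then show ?case
    using pairing_le[OF k tau_H, of p] by (simp add: space_mu)
qed

text \<open>Stated for Borel forms, as it is applied to a constant covector times an indicator. The
  measure is finite on compact subsets of \<open>U\<close>, so the compact carrier supplies an
  integrable bound.\<close>

lemma integrable_dominated:
  assumes \<omega>: "\<omega> \<in> borel_measurable borel" "\<And>p. \<omega> p \<in> rumin_fibre k"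
    and K: "compact K" "K \<subseteq> U" "\<And>p. p \<notin> K \<Longrightarrow> \<omega> p = 0" and c: "\<And>p. norm (\<omega> p) \<le> c"
  shows "integrable \<mu> (\<lambda>p. \<omega> p \<bullet> \<tau> p)" "AE p in \<mu>. norm (\<omega> p \<bullet> \<tau> p) \<le> c * indicator K p"
    "integrable \<mu> (\<lambda>p. c * indicator K p)"
proof -
  have K_sets: "K \<in> sets \<mu>" by (rule borel_sets[OF borel_compact[OF K(1)] K(2)])
  show 1: "integrable \<mu> (\<lambda>p. c * indicator K p)"
    using K_sets finite_compact[OF K(1,2)] by simp
  show 2: "AE p in \<mu>. norm (\<omega> p \<bullet> \<tau> p) \<le> c * indicator K p"
    using AE_pairing_le
  proof eventually_elim
    case (elim p)
    show ?case
    proof (cases "p \<in> K")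
      case True
      have "\<bar>\<omega> p \<bullet> \<tau> p\<bar> \<le> norm (\<omega> p)" using elim \<omega>(2) by blast
      then show ?thesis using c[of p] True by simp
    qed (simp add: K(3))
  qed
  have m: "(\<lambda>p. \<omega> p \<bullet> \<tau> p) \<in> borel_measurable \<mu>"
    using measurable_borel[OF \<omega>(1)] tau_meas by measurable
  have "0 \<le> c" using c[of undefined] norm_ge_zero order_trans by blast
  then have "AE p in \<mu>. norm (\<omega> p \<bullet> \<tau> p) \<le> norm (c * indicator K p)"
    using 2 by (simp add: abs_mult)
  then show "integrable \<mu> (\<lambda>p. \<omega> p \<bullet> \<tau> p)"
    by (rule Bochner_Integration.integrable_bound[OF 1 m])
qed

lemma integrable_test:
  assumes \<omega>: "\<omega> \<in> rumin_test k U"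
  shows "integrable \<mu> (\<lambda>p. \<omega> p \<bullet> \<tau> p)"
proof -
  have c: "continuous_on UNIV \<omega>"
    by (rule smooth_continuous_on[OF rumin_test_smooth[OF \<omega>]])
  have "bounded (\<omega> ` form_support \<omega>)"
    by (intro compact_imp_bounded compact_continuous_image continuous_on_subset[OF c] rumin_test_compact[OF \<omega>]) simp
  then obtain b where b: "\<And>p. p \<in> form_support \<omega> \<Longrightarrow> norm (\<omega> p) \<le> b"
    by (auto simp: bounded_iff)
  have "norm (\<omega> p) \<le> max b 0" for p
    using b[of p] not_in_form_support[of p \<omega>] by (cases "p \<in> form_support \<omega>") auto
  then show ?thesis
    by (intro integrable_dominated(1)[where K = "form_support \<omega>"] borel_measurable_continuous_onI[OF c]
        rumin_test_fibre[OF \<omega>] rumin_test_compact[OF \<omega>] rumin_test_support[OF \<omega>] not_in_form_support)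
qed

text \<open>Cutoffs that are 1 on a compact exhaustion of \<open>G\<close> converge to its
  indicator; the compact set \<open>C\<close> around \<open>G\<close> provides the integrable
  majorant for dominated convergence.\<close>

lemma integral_zero_open:
  assumes G: "open G" "C \<subseteq> U" "compact C" "G \<subseteq> C" and a: "a \<in> rumin_fibre k"
    and 0: "\<And>\<phi>. \<phi> \<in> test_fun G \<Longrightarrow> T (\<lambda>p. \<phi> p *\<^sub>R a) = 0"
  shows "(\<integral>p. indicator G p * (a \<bullet> \<tau> p) \<partial>\<mu>) = 0"
proof -
  obtain K :: "nat \<Rightarrow> 'n hpoint set" where K: "\<And>n. compact (K n)" "\<And>n. K n \<subseteq> G" "\<And>n. K n \<subseteq> interior (K (Suc n))"
      "\<Union> (range K) = G" "\<And>L. compact L \<Longrightarrow> L \<subseteq> G \<Longrightarrow> \<exists>N. \<forall>n\<ge>N. L \<subseteq> K n"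
    using open_Union_compact_subsets[OF G(1)] by metis
  have "\<exists>b. b \<in> test_fun G \<and> (\<forall>p. 0 \<le> b p \<and> b p \<le> 1) \<and> (\<forall>p\<in>K n. b p = 1)" for n
  proof -
    obtain b N where "b \<in> test_fun G" "\<And>p. 0 \<le> b p" "\<And>p. b p \<le> 1" "open N" "K n \<subseteq> N" "\<And>p. p \<in> N \<Longrightarrow> b p = 1"
      using test_fun_urysohn[OF K(1) G(1) K(2)] by metis
    then show ?thesis by blast
  qed
  then obtain b where b: "\<And>n. b n \<in> test_fun G" "\<And>n p. 0 \<le> b n p \<and> b n p \<le> 1" "\<And>n p. p \<in> K n \<Longrightarrow> b n p = 1"
    by metis
  have GU: "G \<subseteq> U" using G by blast
  have b_G: "b n p = 0" if "p \<notin> G" for n p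
    using b(1)[of n] that unfolding test_fun_def by blast
  have lim: "(\<lambda>n. b n p) \<longlonglongrightarrow> indicator G p" for p
  proof (cases "p \<in> G")
    case True
    obtain N where "\<forall>n\<ge>N. {p} \<subseteq> K n" using K(5)[of "{p}"] True by auto
    then have "b n p = indicator G p" if "n \<ge> N" for n
      using b(3)[of p n] that True by simp
    then have "eventually (\<lambda>n. b n p = indicator G p) sequentially"
      by (rule eventually_sequentiallyI)
    then show ?thesis by (rule tendsto_eventually)
  qed (simp add: b_G)
  have am: "(\<lambda>p. a \<bullet> \<tau> p) \<in> borel_measurable \<mu>" using tau_meas by measurable
  have bm: "b n \<in> borel_measurable \<mu>" for n
    by (rule measurable_borel[OF smooth_borel_measurable[OF test_fun_smooth[OF b(1)]]])
  have C_sets: "C \<in> sets \<mu>" by (rule borel_sets[OF borel_compact[OF G(3)] G(2)])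
  have G_sets: "G \<in> sets \<mu>" by (rule borel_sets[OF borel_open[OF G(1)] GU])
  have "(\<lambda>n. \<integral>p. b n p * (a \<bullet> \<tau> p) \<partial>\<mu>) \<longlonglongrightarrow> (\<integral>p. indicator G p * (a \<bullet> \<tau> p) \<partial>\<mu>)"
  proof (rule integral_dominated_convergence[where w = "\<lambda>p. norm a * indicator C p"])
    show "integrable \<mu> (\<lambda>p. norm a * indicator C p)"
      using C_sets finite_compact[OF G(3,2)] by simp
    show "(\<lambda>p. indicator G p * (a \<bullet> \<tau> p)) \<in> borel_measurable \<mu>"
      using am G_sets by measurable
    show "(\<lambda>p. b n p * (a \<bullet> \<tau> p)) \<in> borel_measurable \<mu>" for n
      using am bm by measurable
    show "AE p in \<mu>. (\<lambda>n. b n p * (a \<bullet> \<tau> p)) \<longlonglongrightarrow> indicator G p * (a \<bullet> \<tau> p)"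
      by (intro AE_I2 tendsto_mult lim tendsto_const)
    show "AE p in \<mu>. norm (b n p * (a \<bullet> \<tau> p)) \<le> norm a * indicator C p" for n
      using AE_pairing_le
    proof eventually_elim
      case (elim p)
      show ?case
      proof (cases "p \<in> C")
        case True
        have "\<bar>b n p\<bar> * \<bar>a \<bullet> \<tau> p\<bar> \<le> 1 * norm a"
          using elim a b(2)[of n p] by (intro mult_mono) auto
        then show ?thesis using True by (simp add: abs_mult)
      next
        case False
        then have "b n p = 0" using b_G G(4) by blast
        then show ?thesis by simp
      qed
    qed
  qed
  moreover have "(\<integral>p. b n p * (a \<bullet> \<tau> p) \<partial>\<mu>) = 0" for n
  proof -
    have "T (\<lambda>p. b n p *\<^sub>R a) = (\<integral>p. b n p * (a \<bullet> \<tau> p) \<partial>\<mu>)"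
      using T_eq[OF rumin_test_test_fun_scaleR[OF test_fun_mono[OF b(1) GU] a]] by simp
    then show ?thesis using 0[OF b(1)] by simp
  qed
  ultimately show ?thesis
    by (simp add: LIMSEQ_const_iff)
qed

text \<open>Dynkin's argument: open sets are stable under intersection and generate the Borel sets,
  and the property passes to complements and disjoint countable unions.\<close>

lemma integral_zero_borel:
  assumes g: "integrable \<mu> g" and 0: "\<And>W. open W \<Longrightarrow> (\<integral>p. indicator W p * g p \<partial>\<mu>) = (0::real)"
    and B: "B \<in> sets borel"
  shows "(\<integral>p. indicator B p * g p \<partial>\<mu>) = 0"
proof -
  have B': "B \<in> sigma_sets UNIV {S. open S}" using B by (simp add: borel_def)
  have int: "integrable \<mu> (\<lambda>p. indicator A p * g p)" if "A \<in> sigma_sets UNIV {S. open S}" for A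
  proof -
    have "U \<inter> A \<in> sets \<mu>" by (rule borel_Int_sets) (use that in \<open>simp add: borel_def\<close>)
    from integrable_mult_indicator[OF this g] show ?thesis
      by (rule Bochner_Integration.integrable_cong[THEN iffD1, rotated 2]) (auto simp: space_mu indicator_def)
  qed
  \<comment> \<open>Complements require the integral over the whole space, which is the case of the
    open set \<open>UNIV\<close>.\<close>
  have total: "(\<integral>p. g p \<partial>\<mu>) = 0" using 0[of UNIV] by simp
  show ?thesis
  proof (rule sigma_sets_induct_disjoint[of "{S. open S}" UNIV B, OF _ _ B'])
    show "Int_stable {S :: 'n hpoint set. open S}" by (auto simp: Int_stable_def)
    show "(\<integral>p. indicator A p * g p \<partial>\<mu>) = 0" if "A \<in> {S. open S}" for A using 0 that by simp
    show "(\<integral>p. indicator (UNIV - A) p * g p \<partial>\<mu>) = 0"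
      if A: "A \<in> sigma_sets UNIV {S. open S}" "(\<integral>p. indicator A p * g p \<partial>\<mu>) = 0" for A
    proof -
      have "(\<integral>p. indicator (UNIV - A) p * g p \<partial>\<mu>) = (\<integral>p. g p - indicator A p * g p \<partial>\<mu>)"
        by (rule Bochner_Integration.integral_cong) (auto simp: indicator_def)
      then show ?thesis using int[OF A(1)] g A(2) total by simp
    qed
    fix A :: "nat \<Rightarrow> 'n hpoint set"
    assume A: "disjoint_family A" "range A \<subseteq> sigma_sets UNIV {S. open S}"
      "\<And>i. (\<integral>p. indicator (A i) p * g p \<partial>\<mu>) = 0"
    have UA: "U \<inter> A i \<in> sets \<mu>" for i
      by (rule borel_Int_sets) (use A(2) in \<open>auto simp: borel_def\<close>)
    have eq: "(LINT p:U \<inter> X|\<mu>. g p) = (\<integral>p. indicator X p * g p \<partial>\<mu>)" for X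
      unfolding set_lebesgue_integral_def
      by (rule Bochner_Integration.integral_cong) (auto simp: space_mu indicator_def)
    have "(LINT p:(\<Union>i. U \<inter> A i)|\<mu>. g p) = (\<Sum>i. (LINT p:U \<inter> A i|\<mu>. g p))"
    proof (rule lebesgue_integral_countable_add[OF UA])
      show "(U \<inter> A i) \<inter> (U \<inter> A j) = {}" if "i \<noteq> j" for i j
        using A(1) that by (auto simp: disjoint_family_on_def)
      have "(\<Union>i. U \<inter> A i) \<in> sets \<mu>"
        by (rule sets.countable_UN) (use UA in blast)
      then show "set_integrable \<mu> (\<Union>i. U \<inter> A i) g"
        unfolding set_integrable_def by (rule integrable_mult_indicator[OF _ g])
    qed
    also have "\<dots> = 0"
      unfolding eq A(3) by simp
    also have "(\<Union>i. U \<inter> A i) = U \<inter> (\<Union>i. A i)" by blast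
    finally show "(\<integral>p. indicator (\<Union>i. A i) p * g p \<partial>\<mu>) = 0"
      unfolding eq .
  qed auto
qed

text \<open>The fundamental lemma of the calculus of variations for a fixed covector, localised to
  the interiors of compact sets exhausting \<open>V\<close>, on which the pairing is
  integrable.\<close>

lemma AE_pairing_eq_0:
  assumes V: "open V" "V \<subseteq> U" and a: "a \<in> rumin_fibre k"
    and 0: "\<And>\<phi>. \<phi> \<in> test_fun V \<Longrightarrow> T (\<lambda>p. \<phi> p *\<^sub>R a) = 0"
  shows "AE p in \<mu>. p \<in> V \<longrightarrow> a \<bullet> \<tau> p = 0"
proof -
  obtain K :: "nat \<Rightarrow> 'n hpoint set" where K: "\<And>n. compact (K n)" "\<And>n. K n \<subseteq> V" "\<And>n. K n \<subseteq> interior (K (Suc n))"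
      "\<Union> (range K) = V" "\<And>L. compact L \<Longrightarrow> L \<subseteq> V \<Longrightarrow> \<exists>N. \<forall>n\<ge>N. L \<subseteq> K n"
    using open_Union_compact_subsets[OF V(1)] by metis
  have "AE p in \<mu>. p \<in> interior (K n) \<longrightarrow> a \<bullet> \<tau> p = 0" for n
  proof -
    let ?G = "interior (K n)"
    have KU: "K n \<subseteq> U" using K(2) V(2) by blast
    define g where "g p = indicator ?G p * (a \<bullet> \<tau> p)" for p
    have GU: "?G \<subseteq> U" using KU interior_subset by blast
    have g_int: "integrable \<mu> g"
    proof -
      have "integrable \<mu> (\<lambda>p. (indicator ?G p *\<^sub>R a) \<bullet> \<tau> p)"
      proof (rule integrable_dominated(1)[OF _ _ K(1) KU, of _ "norm a"])
        show "(\<lambda>p. indicator ?G p *\<^sub>R a) \<in> borel_measurable borel" by measurable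
        show "indicator ?G p *\<^sub>R a \<in> rumin_fibre k" for p
          by (rule subspace_scale[OF subspace_rumin_fibre a])
        show "indicator ?G p *\<^sub>R a = 0" if "p \<notin> K n" for p
          using that interior_subset by (auto simp: indicator_def)
        show "norm (indicator ?G p *\<^sub>R a) \<le> norm a" for p
          by (simp add: indicator_def)
      qed
      then show ?thesis by (simp add: g_def[abs_def])
    qed
    have "(\<integral>p. indicator W p * g p \<partial>\<mu>) = 0" if W: "open W" for W
    proof -
      have "(\<integral>p. indicator (W \<inter> ?G) p * (a \<bullet> \<tau> p) \<partial>\<mu>) = 0"
      proof (rule integral_zero_open[OF _ KU K(1) _ a])
        show "open (W \<inter> ?G)" by (rule open_Int[OF W open_interior])
        show "W \<inter> ?G \<subseteq> K n" using interior_subset by blast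
        fix \<phi> assume "\<phi> \<in> test_fun (W \<inter> ?G)"
        moreover have "W \<inter> ?G \<subseteq> V" using interior_subset K(2) by blast
        ultimately show "T (\<lambda>p. \<phi> p *\<^sub>R a) = 0" using 0 test_fun_mono by blast
      qed
      then show ?thesis by (simp add: g_def indicator_inter_arith mult.assoc)
    qed
    then have B: "(\<integral>p. indicator B p * g p \<partial>\<mu>) = 0" if "B \<in> sets borel" for B
      using integral_zero_borel[OF g_int _ that] by blast
    have "AE p in \<mu>. g p = 0"
    proof (rule density_unique_real[OF g_int])
      fix A assume "A \<in> sets \<mu>"
      then obtain B where "B \<in> sets borel" "A = U \<inter> B"
        unfolding sets_mu by (auto simp: sets_restrict_space)
      then have "(LINT p:A|\<mu>. g p) = (\<integral>p. indicator B p * g p \<partial>\<mu>)"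
        unfolding set_lebesgue_integral_def
        by (intro Bochner_Integration.integral_cong) (auto simp: space_mu indicator_def)
      then show "(LINT p:A|\<mu>. g p) = (LINT p:A|\<mu>. 0)"
        using B[OF \<open>B \<in> sets borel\<close>] by simp
    qed simp
    then show ?thesis
      by eventually_elim (auto simp: g_def)
  qed
  then have "AE p in \<mu>. \<forall>n. p \<in> interior (K n) \<longrightarrow> a \<bullet> \<tau> p = 0"
    by (subst AE_all_countable) (rule allI)
  then show ?thesis
  proof eventually_elim
    case (elim p)
    show ?case
    proof
      assume "p \<in> V"
      then obtain n where "p \<in> K n" using K(4) by blast
      then have "p \<in> interior (K (Suc n))" using K(3) by blast
      then show "a \<bullet> \<tau> p = 0" using elim by blast
    qed
  qed
qed

text \<open>A finite basis of \<open>X\<close> gives one exceptional null set for all its covectors;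
  only then can the conclusion be applied to the values of a form, which vary with the
  point.\<close>

lemma AE_pairing_eq_0_subspace:
  assumes V: "open V" "V \<subseteq> U" and X: "subspace X" "X \<subseteq> rumin_fibre k"
    and 0: "\<And>\<phi> a. \<phi> \<in> test_fun V \<Longrightarrow> a \<in> X \<Longrightarrow> T (\<lambda>p. \<phi> p *\<^sub>R a) = 0"
  shows "AE p in \<mu>. p \<in> V \<longrightarrow> (\<forall>a\<in>X. a \<bullet> \<tau> p = 0)"
proof -
  obtain B where B: "B \<subseteq> X" "independent B" "X \<subseteq> span B" by (rule basis_exists)
  then have "finite B" using independent_imp_finite by blast
  have "AE p in \<mu>. p \<in> V \<longrightarrow> a \<bullet> \<tau> p = 0" if "a \<in> B" for a
    using that B(1) X(2) 0 by (intro AE_pairing_eq_0[OF V]) auto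
  then have "AE p in \<mu>. \<forall>a\<in>B. p \<in> V \<longrightarrow> a \<bullet> \<tau> p = 0"
    by (rule AE_finite_allI[OF \<open>finite B\<close>])
  then show ?thesis
  proof eventually_elim
    case (elim p)
    show ?case
    proof (intro impI ballI)
      fix a assume "p \<in> V" "a \<in> X"
      have "subspace {a. a \<bullet> \<tau> p = 0}"
        by (simp add: subspace_def inner_add_left)
      moreover have "B \<subseteq> {a. a \<bullet> \<tau> p = 0}" using elim \<open>p \<in> V\<close> by blast
      ultimately have "span B \<subseteq> {a. a \<bullet> \<tau> p = 0}" by (rule span_minimal[rotated])
      then show "a \<bullet> \<tau> p = 0" using B(3) \<open>a \<in> X\<close> by blast
    qed
  qed
qed

end

text \<open>The image under \<open>f\<close> of the measure restricted to a compact set is a finite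
  measure on the line, which has countably many atoms. Countably many compact sets exhaust
  \<open>U\<close>.\<close>

lemma countable_positive_levels:
  fixes f :: "'a::euclidean_space \<Rightarrow> real"
  assumes U: "open U" and \<mu>: "radon_measure_on U \<mu>" and f: "continuous_on U f"
  shows "countable {s. emeasure \<mu> {p \<in> U. f p = s} \<noteq> 0}"
proof -
  have s\<mu>: "sets \<mu> = sets (restrict_space borel U)"
    and fin: "\<And>K. compact K \<Longrightarrow> K \<subseteq> U \<Longrightarrow> emeasure \<mu> K < \<infinity>"
    using \<mu> unfolding radon_measure_on_def by blast+
  have sp: "space \<mu> = U"
    using sets_eq_imp_space_eq[OF s\<mu>] by (simp add: space_restrict_space)
  have fm: "f \<in> borel_measurable \<mu>"
    using borel_measurable_continuous_on_restrict[OF f] measurable_cong_sets[OF s\<mu> refl] by blast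
  obtain K :: "nat \<Rightarrow> 'a set" where K: "\<And>n. compact (K n)" "\<And>n. K n \<subseteq> U" "\<Union> (range K) = U"
    using open_Union_compact_subsets[OF U] by metis
  have Ks: "K n \<in> sets \<mu>" for n
  proof -
    have "K n = U \<inter> K n" using K(2) by blast
    then show ?thesis
      unfolding s\<mu> sets_restrict_space using borel_compact[OF K(1)] by (metis image_eqI)
  qed
  have lev: "{p \<in> U. f p = s} \<in> sets \<mu>" for s
    using measurable_sets[OF fm, of "{s}"] by (simp add: sp vimage_def Int_def conj_commute)
  have "countable {s. emeasure \<mu> ({p \<in> U. f p = s} \<inter> K n) \<noteq> 0}" for n
  proof -
    have Kn: "K n \<inter> space \<mu> \<in> sets \<mu>" using Ks Int_absorb2[OF K(2)] by (simp only: sp)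
    let ?R = "restrict_space \<mu> (K n)"
    have fR: "f \<in> borel_measurable ?R" by (rule measurable_restrict_space1[OF fm])
    have spR: "space ?R = K n" by (simp only: space_restrict_space sp Int_absorb2[OF K(2)])
    interpret D: finite_measure "distr ?R borel f"
    proof (rule finite_measureI)
      have "emeasure (distr ?R borel f) (space (distr ?R borel f)) = emeasure ?R (K n)"
        using fR spR by (simp add: emeasure_distr vimage_def)
      also have "\<dots> = emeasure \<mu> (K n)" by (rule emeasure_restrict_space[OF Kn]) simp
      finally show "emeasure (distr ?R borel f) (space (distr ?R borel f)) \<noteq> \<infinity>"
        using fin[OF K(1,2)] by (simp add: less_top)
    qed
    have "emeasure (distr ?R borel f) {s} = emeasure \<mu> ({p \<in> U. f p = s} \<inter> K n)" for s
    proof -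
      have "f -` {s} \<inter> K n = {p \<in> U. f p = s} \<inter> K n" using K(2) by blast
      then have "emeasure (distr ?R borel f) {s} = emeasure ?R ({p \<in> U. f p = s} \<inter> K n)"
        using fR spR by (simp add: emeasure_distr)
      also have "\<dots> = emeasure \<mu> ({p \<in> U. f p = s} \<inter> K n)"
        by (rule emeasure_restrict_space[OF Kn]) simp
      finally show ?thesis .
    qed
    then have eq: "emeasure \<mu> ({p \<in> U. f p = s} \<inter> K n) = ennreal (measure (distr ?R borel f) {s})" for s
      by (simp only: D.emeasure_eq_measure)
    have "{s. emeasure \<mu> ({p \<in> U. f p = s} \<inter> K n) \<noteq> 0} \<subseteq> {s. measure (distr ?R borel f) {s} \<noteq> 0}"
      unfolding eq by auto
    then show ?thesis
      using D.countable_support by (rule countable_subset)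
  qed
  then have "countable (\<Union>n. {s. emeasure \<mu> ({p \<in> U. f p = s} \<inter> K n) \<noteq> 0})" by simp
  moreover have "{s. emeasure \<mu> {p \<in> U. f p = s} \<noteq> 0} \<subseteq> (\<Union>n. {s. emeasure \<mu> ({p \<in> U. f p = s} \<inter> K n) \<noteq> 0})"
  proof
    fix s assume s: "s \<in> {s. emeasure \<mu> {p \<in> U. f p = s} \<noteq> 0}"
    have "{p \<in> U. f p = s} = (\<Union>n. {p \<in> U. f p = s} \<inter> K n)" using K(3) by blast
    moreover have "emeasure \<mu> (\<Union>n. {p \<in> U. f p = s} \<inter> K n) = 0"
      if "\<And>n. emeasure \<mu> ({p \<in> U. f p = s} \<inter> K n) = 0"
      using that lev Ks by (intro emeasure_UN_eq_0) auto
    ultimately show "s \<in> (\<Union>n. {s. emeasure \<mu> ({p \<in> U. f p = s} \<inter> K n) \<noteq> 0})"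
      using s by auto
  qed
  ultimately show ?thesis by (rule countable_subset[rotated])
qed

section \<open>Slices\<close>

lemma heis_dist_continuous: "continuous_on UNIV (\<lambda>p. heis_dist p q)"
proof -
  have "continuous_on UNIV (\<lambda>p. root 4 (norm (- fst q + fst p, - fst (snd q) + fst (snd p)) ^ 4 +
    16 * (- snd (snd q) + snd (snd p) +
      (1/2) * (\<Sum>j\<in>UNIV. (- fst q) $ j * fst (snd p) $ j - (- fst (snd q)) $ j * fst p $ j))\<^sup>2))"
    by (intro continuous_intros)
  then show ?thesis
    by (simp add: heis_dist_def heis_norm_def heis_mult_def heis_inv_def case_prod_beta cong: sum.cong)
qed

lemma heis_dist_self: "heis_dist q q = 0"
  by (simp add: heis_dist_def heis_norm_def heis_mult_def heis_inv_def case_prod_beta algebra_simps)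

text \<open>The Heisenberg distance to \<open>q\<close> is continuous in the product topology and is
  0 at \<open>q\<close>, so the Lipschitz estimate squeezes \<open>f p - f q\<close> to 0.\<close>

lemma heis_Lip_continuous_on:
  assumes "f \<in> heis_Lip U"
  shows "continuous_on U f"
proof -
  obtain L where L: "\<And>p q. p \<in> U \<Longrightarrow> q \<in> U \<Longrightarrow> \<bar>f p - f q\<bar> \<le> L * heis_dist p q"
    using assms by (auto simp: heis_Lip_def)
  have "(f \<longlongrightarrow> f q) (at q within U)" if q: "q \<in> U" for q
  proof -
    have "((\<lambda>p. heis_dist p q) \<longlongrightarrow> heis_dist q q) (at q within U)"
      using continuous_on_subset[OF heis_dist_continuous, of U] q by (simp add: continuous_on_def)
    then have "((\<lambda>p. L * heis_dist p q) \<longlongrightarrow> L * 0) (at q within U)"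
      unfolding heis_dist_self by (rule tendsto_mult_left)
    then have "((\<lambda>p. L * heis_dist p q) \<longlongrightarrow> 0) (at q within U)"
      by simp
    moreover have "eventually (\<lambda>p. norm (f p - f q) \<le> L * heis_dist p q) (at q within U)"
      using L q by (auto simp: eventually_at_filter)
    ultimately have "((\<lambda>p. f p - f q) \<longlongrightarrow> 0) (at q within U)"
      by (rule Lim_null_comparison[rotated])
    then show ?thesis by (simp add: LIM_zero_iff)
  qed
  then show ?thesis by (simp add: continuous_on_def)
qed

lemma open_level_sets:
  fixes f :: "'a::topological_space \<Rightarrow> real"
  assumes "continuous_on U f" "open U"
  shows "open {p \<in> U. f p > s}" "open {p \<in> U. f p < s}"
proof -
  have "{p \<in> U. f p > s} = U \<inter> f -` {s<..}" "{p \<in> U. f p < s} = U \<inter> f -` {..<s}"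
    by auto
  then show "open {p \<in> U. f p > s}" "open {p \<in> U. f p < s}"
    using continuous_open_preimage[OF assms, of "{s<..}"] continuous_open_preimage[OF assms, of "{..<s}"]
    by simp_all
qed

text \<open>The zero form competes in the supremum. Nonnegativity lets finiteness of a sum of two
  masses imply finiteness of each.\<close>

lemma mass_nonneg:
  assumes "k \<le> 2 * CARD('n) + 1" "T (\<lambda>p. 0) = 0"
  shows "0 \<le> mass k U (T :: 'n::{finite,linorder} functional)"
proof -
  have "ereal (T (\<lambda>p. 0)) \<le> mass k U T"
    unfolding mass_def by (rule SUP_upper) (simp add: rumin_test_zero comass_zero[OF assms(1)])
  then show ?thesis using assms(2) by (simp add: zero_ereal_def)
qed

section \<open>Restriction of represented functionals\<close>

context represented
begin

abbreviation restricted :: "'n hpoint set \<Rightarrow> 'n form \<Rightarrow> real" where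
  "restricted A \<omega> \<equiv> (LINT p : U \<inter> A | \<mu>. \<omega> p \<bullet> \<tau> p)"

lemma restricted_eq_0:
  assumes "AE p in \<mu>. p \<in> A \<longrightarrow> \<omega> p \<bullet> \<tau> p = 0"
  shows "restricted A \<omega> = 0"
  unfolding set_lebesgue_integral_def
  by (rule integral_eq_zero_AE) (use assms in \<open>eventually_elim, auto simp: indicator_def\<close>)

lemma restricted_eq_T:
  assumes \<omega>: "\<omega> \<in> rumin_test k U" and "AE p in \<mu>. p \<notin> A \<longrightarrow> \<omega> p \<bullet> \<tau> p = 0" and A: "U \<inter> A \<in> sets \<mu>"
  shows "restricted A \<omega> = T \<omega>"
  unfolding set_lebesgue_integral_def T_eq[OF \<omega>]
proof (rule integral_cong_AE)
  have m: "(\<lambda>p. \<omega> p \<bullet> \<tau> p) \<in> borel_measurable \<mu>"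
    using integrable_test[OF \<omega>] by (rule borel_measurable_integrable)
  then show "(\<lambda>p. \<omega> p \<bullet> \<tau> p) \<in> borel_measurable \<mu>" .
  show "(\<lambda>p. indicator (U \<inter> A) p *\<^sub>R (\<omega> p \<bullet> \<tau> p)) \<in> borel_measurable \<mu>"
    using m A by measurable
  show "AE p in \<mu>. indicator (U \<inter> A) p *\<^sub>R (\<omega> p \<bullet> \<tau> p) = \<omega> p \<bullet> \<tau> p"
    using assms(2) AE_space
  proof eventually_elim
    case (elim p)
    then show ?case by (cases "p \<in> A") (simp_all add: space_mu)
  qed
qed

lemma open_Int_sets: "open G \<Longrightarrow> U \<inter> G \<in> sets \<mu>"
  by (rule borel_Int_sets) simp

text \<open>In the application \<open>N\<close> is a level set of measure 0, off which the sets
  above and below the level partition \<open>U\<close>.\<close>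

lemma restricted_add_complement:
  assumes \<omega>: "\<omega> \<in> rumin_test k U" and A: "U \<inter> A \<in> sets \<mu>" and B: "U \<inter> B \<in> sets \<mu>"
    and N: "N \<in> sets \<mu>" "emeasure \<mu> N = 0" and disj: "A \<inter> B = {}" and cov: "U \<subseteq> A \<union> B \<union> N"
  shows "restricted A \<omega> + restricted B \<omega> = T \<omega>"
proof -
  have int: "set_integrable \<mu> (U \<inter> A) (\<lambda>p. \<omega> p \<bullet> \<tau> p)" "set_integrable \<mu> (U \<inter> B) (\<lambda>p. \<omega> p \<bullet> \<tau> p)"
    unfolding set_integrable_def using integrable_mult_indicator[OF _ integrable_test[OF \<omega>]] A B by blast+
  have "restricted A \<omega> + restricted B \<omega> = (LINT p : (U \<inter> A) \<union> (U \<inter> B) | \<mu>. \<omega> p \<bullet> \<tau> p)"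
    by (rule set_integral_Un[symmetric]) (use disj int in auto)
  also have "(U \<inter> A) \<union> (U \<inter> B) = U \<inter> (A \<union> B)" by blast
  also have "restricted (A \<union> B) \<omega> = T \<omega>"
  proof (rule restricted_eq_T[OF \<omega>])
    have "N \<in> null_sets \<mu>" using N by auto
    then have "AE p in \<mu>. p \<notin> N" by (rule AE_not_in)
    then show "AE p in \<mu>. p \<notin> A \<union> B \<longrightarrow> \<omega> p \<bullet> \<tau> p = 0"
      using AE_space
    proof eventually_elim
      case (elim p)
      then have "p \<in> A \<union> B" using cov space_mu by blast
      then show ?case by simp
    qed
    show "U \<inter> (A \<union> B) \<in> sets \<mu>" using A B by (simp add: Int_Un_distrib sets.Un)
  qed
  finally show ?thesis .
qed

end

lemma test_fun_rumin_support:
  assumes \<phi>: "\<phi> \<in> test_fun V"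
  shows "rumin_support k (\<lambda>p. \<phi> p *\<^sub>R a) \<subseteq> V"
proof -
  obtain C where C: "compact C" "C \<subseteq> V" "\<And>p. p \<notin> C \<Longrightarrow> \<phi> p = 0"
    using \<phi> unfolding test_fun_def by blast
  have "rumin_support k (\<lambda>p. \<phi> p *\<^sub>R a) \<subseteq> C"
    unfolding rumin_support_def
  proof (rule closure_minimal[OF _ compact_imp_closed[OF C(1)]])
    show "{p. \<phi> p *\<^sub>R a \<notin> rumin_null k} \<subseteq> C"
      using C(3) subspace_0[OF subspace_rumin_null, of k] by force
  qed
  then show ?thesis using C(2) by blast
qed

lemma not_in_rumin_support: "p \<notin> rumin_support k \<omega> \<Longrightarrow> \<omega> p \<in> rumin_null k"
  unfolding rumin_support_def using closure_subset[of "{p. \<omega> p \<notin> rumin_null k}"] by blast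

text \<open>For a linear functional, respecting classes amounts to vanishing on forms with values in
  the null space.\<close>

locale finite_mass_quotient = finite_mass +
  assumes T_null: "\<omega> \<in> rumin_test k U \<Longrightarrow> (\<And>p. \<omega> p \<in> rumin_null k) \<Longrightarrow> T \<omega> = 0"
begin

abbreviation "\<mu> \<equiv> current_measure k U T"
abbreviation "\<tau> \<equiv> current_vector k U T"

sublocale represented k U T \<mu> \<tau>
  by unfold_locales (rule open_U, rule k, rule represented_by_current)

lemma current_restrict_eq: "current_restrict k U T A \<omega> = restricted A \<omega>"
  by (simp add: current_restrict_def)

lemma AE_null: "AE p in \<mu>. \<forall>a\<in>rumin_null k. a \<bullet> \<tau> p = 0"
proof -
  have "AE p in \<mu>. p \<in> U \<longrightarrow> (\<forall>a\<in>rumin_null k. a \<bullet> \<tau> p = 0)"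
  proof (rule AE_pairing_eq_0_subspace[OF open_U order_refl subspace_rumin_null rumin_null_subset])
    fix \<phi> and a :: "'a ext" assume "\<phi> \<in> test_fun U" "a \<in> rumin_null k"
    then show "T (\<lambda>p. \<phi> p *\<^sub>R a) = 0"
      using rumin_null_subset by (intro T_null rumin_test_test_fun_scaleR)
        (auto intro: subspace_scale[OF subspace_rumin_null])
  qed
  then show ?thesis
    using AE_space by eventually_elim (simp add: space_mu)
qed

lemma AE_outside_support:
  "AE p in \<mu>. p \<notin> rumin_support k \<omega> \<longrightarrow> \<omega> p \<bullet> \<tau> p = 0"
  using AE_null by eventually_elim (use not_in_rumin_support in blast)

lemma restrict_eq_0_of_disjoint:
  assumes "rumin_support k \<omega> \<inter> A = {}"
  shows "current_restrict k U T A \<omega> = 0"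
  unfolding current_restrict_eq
  by (rule restricted_eq_0) (use AE_outside_support[of \<omega>] assms in \<open>eventually_elim, blast\<close>)

lemma restrict_eq_T_of_subset:
  assumes "\<omega> \<in> rumin_test k U" "rumin_support k \<omega> \<subseteq> A" "U \<inter> A \<in> sets \<mu>"
  shows "current_restrict k U T A \<omega> = T \<omega>"
  unfolding current_restrict_eq
  by (rule restricted_eq_T[OF assms(1) _ assms(3)])
    (use AE_outside_support[of \<omega>] assms(2) in \<open>eventually_elim, blast\<close>)

text \<open>Where \<open>T\<close> vanishes, its orienting field pairs to 0 with the whole fibre
  almost everywhere; off \<open>V\<close> the class of the form is zero, so its pairing is 0 there
  too.\<close>

lemma restrict_eq_0_of_vanishing:
  assumes V: "open V" "V \<subseteq> U" and 0: "\<And>\<omega>. \<omega> \<in> rumin_test k U \<Longrightarrow> rumin_support k \<omega> \<subseteq> V \<Longrightarrow> T \<omega> = 0"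
    and \<omega>: "\<omega> \<in> rumin_test k U" "rumin_support k \<omega> \<subseteq> V"
  shows "current_restrict k U T A \<omega> = 0"
proof -
  have "AE p in \<mu>. p \<in> V \<longrightarrow> (\<forall>a\<in>rumin_fibre k. a \<bullet> \<tau> p = 0)"
  proof (rule AE_pairing_eq_0_subspace[OF V subspace_rumin_fibre order_refl])
    fix \<phi> and a :: "'a ext" assume "\<phi> \<in> test_fun V" "a \<in> rumin_fibre k"
    then show "T (\<lambda>p. \<phi> p *\<^sub>R a) = 0"
      by (intro 0 test_fun_rumin_support rumin_test_test_fun_scaleR) (rule test_fun_mono[OF _ V(2)])
  qed
  then have "AE p in \<mu>. p \<in> A \<longrightarrow> \<omega> p \<bullet> \<tau> p = 0"
    using AE_outside_support[of \<omega>]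
    by eventually_elim (use \<omega>(2) rumin_test_fibre[OF \<omega>(1)] in blast)
  then show ?thesis
    unfolding current_restrict_eq by (rule restricted_eq_0)
qed

text \<open>Nothing is prescribed about the pair chosen for a zero functional, so its restrictions
  must be shown to vanish: the orienting field pairs to 0 with the fibre almost everywhere.\<close>

lemma restrict_zero_functional:
  assumes "\<And>\<omega>. \<omega> \<in> rumin_test k U \<Longrightarrow> T \<omega> = 0" "\<omega> \<in> rumin_test k U"
  shows "current_restrict k U T A \<omega> = 0"
proof -
  have "AE p in \<mu>. p \<in> U \<longrightarrow> (\<forall>a\<in>rumin_fibre k. a \<bullet> \<tau> p = 0)"
    by (rule AE_pairing_eq_0_subspace[OF open_U order_refl subspace_rumin_fibre order_refl])
      (rule assms(1), rule rumin_test_test_fun_scaleR)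
  then have "AE p in \<mu>. p \<in> A \<longrightarrow> \<omega> p \<bullet> \<tau> p = 0"
    using AE_space by eventually_elim (use rumin_test_fibre[OF assms(2)] in \<open>simp add: space_mu\<close>)
  then show ?thesis
    unfolding current_restrict_eq by (rule restricted_eq_0)
qed

lemma restrict_zero_form: "current_restrict k U T A (\<lambda>p. 0) = 0"
  by (simp add: current_restrict_def set_lebesgue_integral_def)

lemma restrict_levels:
  fixes f :: "_ \<Rightarrow> real"
  assumes f: "continuous_on U f" and s: "emeasure \<mu> {p \<in> U. f p = s} = 0" and \<omega>: "\<omega> \<in> rumin_test k U"
  shows "current_restrict k U T {p \<in> U. f p > s} \<omega> + current_restrict k U T {p \<in> U. f p < s} \<omega> = T \<omega>"
  unfolding current_restrict_eq
proof (rule restricted_add_complement[OF \<omega> _ _ _ s])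
  note o = open_level_sets[OF f open_U, of s]
  show "U \<inter> {p \<in> U. f p > s} \<in> sets \<mu>" "U \<inter> {p \<in> U. f p < s} \<in> sets \<mu>"
    by (rule open_Int_sets[OF o(1)], rule open_Int_sets[OF o(2)])
  have "{p \<in> U. f p = s} = U \<inter> (UNIV - ({p \<in> U. f p > s} \<union> {p \<in> U. f p < s}))" by auto
  also have "\<dots> \<in> sets \<mu>"
    by (rule borel_Int_sets) (use o in auto)
  finally show "{p \<in> U. f p = s} \<in> sets \<mu>" .
qed auto

end

section \<open>Normal currents and their slices\<close>

lemma boundary_Suc: "boundary (Suc k) T = (\<lambda>\<omega>. T (rumin_d k \<omega>))"
  by (simp add: boundary_def fun_eq_iff)

lemma boundary_0: "boundary 0 T = (\<lambda>\<omega>. 0)"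
  by (simp add: boundary_def fun_eq_iff)

text \<open>The slice of the boundary \<open>S\<close> restricts \<open>R\<close>, so
  \<open>T\<close>, \<open>S\<close> and \<open>R\<close> are all represented below, although
  \<open>R\<close> is 0 on test forms. For k = 0 and k = 1 the truncated degrees repeat 0, where
  \<open>boundary 0\<close> makes \<open>R\<close> zero.\<close>

locale normal_current =
  fixes k :: nat and U :: "'n::{finite,linorder} hpoint set" and T :: "'n functional"
  assumes open_U: "open U" and k: "k \<le> 2 * CARD('n) + 1" and normal: "T \<in> normal_currents k U"
begin

abbreviation "S \<equiv> boundary k T"
abbreviation "R \<equiv> boundary (k - 1) S"

lemma T_add: "\<omega> \<in> rumin_test k U \<Longrightarrow> \<eta> \<in> rumin_test k U \<Longrightarrow> T (\<lambda>p. \<omega> p + \<eta> p) = T \<omega> + T \<eta>"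
  and T_scale: "\<omega> \<in> rumin_test k U \<Longrightarrow> T (\<lambda>p. c *\<^sub>R \<omega> p) = c * T \<omega>"
  and T_equiv: "\<omega> \<in> rumin_test k U \<Longrightarrow> \<eta> \<in> rumin_test k U \<Longrightarrow> rumin_equiv k \<omega> \<eta> \<Longrightarrow> T \<omega> = T \<eta>"
  using normal unfolding normal_currents_def currents_def by blast+

lemma T_zero: "T (\<lambda>p. 0) = 0"
  using T_scale[OF rumin_test_zero, of 0] by simp

lemma T_null: "\<omega> \<in> rumin_test k U \<Longrightarrow> (\<And>p. \<omega> p \<in> rumin_null k) \<Longrightarrow> T \<omega> = 0"
  using T_equiv[OF _ rumin_test_zero, of \<omega>] T_zero by (simp add: rumin_equiv_def)

lemma S_eq: "k = Suc l \<Longrightarrow> S \<omega> = T (rumin_d l \<omega>)"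
  by (simp add: boundary_Suc)

lemma rumin_d_test': "k = Suc l \<Longrightarrow> \<omega> \<in> rumin_test (k - 1) U \<Longrightarrow> rumin_d l \<omega> \<in> rumin_test k U"
  using rumin_d_test[of \<omega> l U] by simp

lemma S_add:
  assumes "\<omega> \<in> rumin_test (k - 1) U" "\<eta> \<in> rumin_test (k - 1) U"
  shows "S (\<lambda>p. \<omega> p + \<eta> p) = S \<omega> + S \<eta>"
proof (cases k)
  case (Suc l)
  then have "rumin_d l (\<lambda>p. \<omega> p + \<eta> p) = (\<lambda>p. rumin_d l \<omega> p + rumin_d l \<eta> p)"
    using assms by (intro rumin_d_add rumin_test_smooth[OF assms(1)] rumin_test_smooth[OF assms(2)])
      (auto dest: rumin_test_graded)
  then show ?thesis
    unfolding S_eq[OF Suc] using T_add[OF rumin_d_test'[OF Suc assms(1)] rumin_d_test'[OF Suc assms(2)]] by simp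
qed (simp add: boundary_0)

lemma S_scale:
  assumes "\<omega> \<in> rumin_test (k - 1) U"
  shows "S (\<lambda>p. c *\<^sub>R \<omega> p) = c * S \<omega>"
proof (cases k)
  case (Suc l)
  then have "rumin_d l (\<lambda>p. c *\<^sub>R \<omega> p) = (\<lambda>p. c *\<^sub>R rumin_d l \<omega> p)"
    using assms by (intro rumin_d_scale rumin_test_smooth[OF assms(1)]) (auto dest: rumin_test_graded)
  then show ?thesis
    unfolding S_eq[OF Suc] using T_scale[OF rumin_d_test'[OF Suc assms]] by simp
qed (simp add: boundary_0)

lemma S_null:
  assumes "\<omega> \<in> rumin_test (k - 1) U" "\<And>p. \<omega> p \<in> rumin_null (k - 1)"
  shows "S \<omega> = 0"
proof (cases k)
  case (Suc l)
  have "rumin_d l \<omega> p \<in> rumin_null (Suc l)" for p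
    by (rule rumin_d_null[OF rumin_test_smooth[OF assms(1)]]) (use assms(2) Suc in simp)
  then show ?thesis
    unfolding S_eq[OF Suc] by (intro T_null rumin_d_test'[OF Suc assms(1)]) (simp add: Suc)
qed (simp add: boundary_0)

lemma R_eq_0:
  assumes "\<omega> \<in> rumin_test (k - 1 - 1) U"
  shows "R \<omega> = 0"
proof (cases "k - 1")
  case (Suc l)
  then have k2: "k = Suc (Suc l)" by simp
  have \<omega>: "\<omega> \<in> rumin_test l U" using assms k2 by simp
  have "R \<omega> = T (rumin_d (Suc l) (rumin_d l \<omega>))"
    using k2 by (simp add: boundary_Suc)
  also have "\<dots> = 0"
    using rumin_d_rumin_d[OF rumin_test_smooth[OF \<omega>] rumin_test_graded[OF \<omega>]] T_zero by simp
  finally show ?thesis .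
qed (simp add: boundary_0)

lemma masses_finite: "mass k U T < \<infinity>" "mass (k - 1) U S < \<infinity>"
proof -
  have sum: "mass k U T + mass (k - 1) U S < \<infinity>"
    using normal by (simp add: normal_currents_def)
  have "0 \<le> mass k U T" by (rule mass_nonneg[of k T U, OF k T_zero])
  moreover have "S (\<lambda>p. 0) = 0"
    using S_scale[OF rumin_test_zero, of 0] by simp
  then have "0 \<le> mass (k - 1) U S"
    by (rule mass_nonneg[rotated]) (use k in simp)
  ultimately show "mass k U T < \<infinity>" "mass (k - 1) U S < \<infinity>"
    using sum by auto
qed

sublocale T: finite_mass_quotient k U T
proof
  show "k \<le> 2 * CARD('n) + 1" by (rule k)
  show "mass k U T < \<infinity>" by (rule masses_finite(1))
qed (simp_all add: open_U T_add T_scale T_null)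

sublocale S: finite_mass_quotient "k - 1" U S
proof
  show "k - 1 \<le> 2 * CARD('n) + 1" using k by simp
  show "mass (k - 1) U S < \<infinity>" by (rule masses_finite(2))
qed (simp_all add: open_U S_add S_scale S_null)

sublocale R: finite_mass_quotient "k - 1 - 1" U R
proof
  show "k - 1 - 1 \<le> 2 * CARD('n) + 1" using k by simp
  have "mass (k - 1 - 1) U R \<le> 0"
    unfolding mass_def by (rule SUP_least) (use R_eq_0 in auto)
  then show "mass (k - 1 - 1) U R < \<infinity>" by (rule order_le_less_trans) simp
  fix \<omega> assume \<omega>: "\<omega> \<in> rumin_test (k - 1 - 1) U"
  show "R (\<lambda>p. \<omega> p + \<eta> p) = R \<omega> + R \<eta>" if \<eta>: "\<eta> \<in> rumin_test (k - 1 - 1) U" for \<eta>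
    by (simp only: R_eq_0[OF \<omega>] R_eq_0[OF \<eta>] R_eq_0[OF rumin_test_add[OF \<omega> \<eta>]])
  show "R (\<lambda>p. c *\<^sub>R \<omega> p) = c * R \<omega>" for c
    by (simp only: R_eq_0[OF \<omega>] R_eq_0[OF rumin_test_scale[OF \<omega>]])
  show "R \<omega> = 0" by (rule R_eq_0[OF \<omega>])
qed (rule open_U)

text \<open>Degree 0 is treated apart because \<open>boundary 0\<close> discards the restricted
  current instead of evaluating it on a differential.\<close>

lemma slice_plus_0: "k = 0 \<Longrightarrow> slice_plus k U T f t \<omega> = current_restrict (k - 1) U S {p \<in> U. f p > t} \<omega>"
  and slice_minus_0: "k = 0 \<Longrightarrow> slice_minus k U T f t \<omega> = - current_restrict (k - 1) U S {p \<in> U. f p < t} \<omega>"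
  by (simp_all add: slice_plus_def slice_minus_def boundary_0)

lemma slice_plus_Suc: "k = Suc l \<Longrightarrow> slice_plus k U T f t \<omega> =
    current_restrict (k - 1) U S {p \<in> U. f p > t} \<omega> - current_restrict k U T {p \<in> U. f p > t} (rumin_d l \<omega>)"
  and slice_minus_Suc: "k = Suc l \<Longrightarrow> slice_minus k U T f t \<omega> =
    current_restrict k U T {p \<in> U. f p < t} (rumin_d l \<omega>) - current_restrict (k - 1) U S {p \<in> U. f p < t} \<omega>"
  by (simp_all add: slice_plus_def slice_minus_def boundary_Suc)

text \<open>If the level is not charged, restrictions to its two sides add up to the whole, for
  \<open>S\<close> on \<omega> and for \<open>T\<close> on the differential of \<omega>. The
  difference of the slices is then \<open>S \<omega>\<close> minus
  \<open>T (rumin_d l \<omega>)\<close>, which is 0 by the definition of the boundary.\<close>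

lemma slices_agree:
  assumes f: "continuous_on U f"
    and s: "emeasure (current_measure k U T) {p \<in> U. f p = s} = 0"
      "emeasure (current_measure (k - 1) U S) {p \<in> U. f p = s} = 0"
  shows "current_eq (k - 1) U (slice_plus k U T f s) (slice_minus k U T f s)"
  unfolding current_eq_def
proof
  fix \<omega> assume \<omega>: "\<omega> \<in> rumin_test (k - 1) U"
  note SS = S.restrict_levels[OF f s(2) \<omega>]
  show "slice_plus k U T f s \<omega> = slice_minus k U T f s \<omega>"
  proof (cases k)
    case 0
    have "S \<omega> = 0" using 0 by (simp add: boundary_0)
    then show ?thesis
      unfolding slice_plus_0[OF 0] slice_minus_0[OF 0] using SS by linarith
  next
    case (Suc l)
    show ?thesis
      unfolding slice_plus_Suc[OF Suc] slice_minus_Suc[OF Suc]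
      using SS T.restrict_levels[OF f s(1) rumin_d_test'[OF Suc \<omega>]] S_eq[OF Suc, of \<omega>] by linarith
  qed
qed

lemma slice_plus_eq_0:
  assumes S0: "current_restrict (k - 1) U S {p \<in> U. f p > t} \<omega> = 0"
    and T0: "\<And>l. k = Suc l \<Longrightarrow> current_restrict k U T {p \<in> U. f p > t} (rumin_d l \<omega>) = 0"
  shows "slice_plus k U T f t \<omega> = 0"
proof (cases k)
  case 0
  show ?thesis unfolding slice_plus_0[OF 0] by (rule S0)
next
  case (Suc l)
  show ?thesis unfolding slice_plus_Suc[OF Suc] S0 T0[OF Suc] by simp
qed

lemma rumin_support_d:
  "k = Suc l \<Longrightarrow> \<omega> \<in> rumin_test (k - 1) U \<Longrightarrow> rumin_support k (rumin_d l \<omega>) \<subseteq> rumin_support (k - 1) \<omega>"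
  using rumin_support_rumin_d[of \<omega> l U] by simp

text \<open>The boundary vanishes on \<open>V\<close> as well, since the Rumin differential does not
  enlarge supports; both restricted terms are then 0 separately.\<close>

lemma slice_vanishes_off_support:
  assumes V: "open V" "V \<subseteq> U" "\<And>\<omega>. \<omega> \<in> rumin_test k U \<Longrightarrow> rumin_support k \<omega> \<subseteq> V \<Longrightarrow> T \<omega> = 0"
    and \<omega>: "\<omega> \<in> rumin_test (k - 1) U" "rumin_support (k - 1) \<omega> \<subseteq> V"
  shows "slice_plus k U T f t \<omega> = 0"
proof (rule slice_plus_eq_0)
  have S_V: "S \<eta> = 0" if "\<eta> \<in> rumin_test (k - 1) U" "rumin_support (k - 1) \<eta> \<subseteq> V" for \<eta>
  proof (cases k)
    case (Suc l)
    show ?thesis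
      unfolding S_eq[OF Suc] using rumin_support_d[OF Suc that(1)] that(2)
      by (intro V(3) rumin_d_test'[OF Suc that(1)]) (rule order_trans)
  qed (simp add: boundary_0)
  show "current_restrict (k - 1) U S {p \<in> U. f p > t} \<omega> = 0"
    by (rule S.restrict_eq_0_of_vanishing[OF V(1,2) S_V \<omega>])
  show "current_restrict k U T {p \<in> U. f p > t} (rumin_d l \<omega>) = 0" if "k = Suc l" for l
    by (rule T.restrict_eq_0_of_vanishing[OF V(1,2) _ rumin_d_test'[OF that \<omega>(1)]
          order_trans[OF rumin_support_d[OF that \<omega>(1)] \<omega>(2)]]) (rule V(3))
qed

text \<open>The support of the form, and hence that of its differential, misses the set to which
  both currents are restricted.\<close>

lemma slice_vanishes_below:
  assumes \<omega>: "\<omega> \<in> rumin_test (k - 1) U" "rumin_support (k - 1) \<omega> \<subseteq> {p \<in> U. f p < t}"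
  shows "slice_plus k U T f t \<omega> = 0"
proof (rule slice_plus_eq_0)
  show "current_restrict (k - 1) U S {p \<in> U. f p > t} \<omega> = 0"
    by (rule S.restrict_eq_0_of_disjoint) (use \<omega>(2) in force)
  show "current_restrict k U T {p \<in> U. f p > t} (rumin_d l \<omega>) = 0" if "k = Suc l" for l
    by (rule T.restrict_eq_0_of_disjoint) (use \<omega>(2) rumin_support_d[OF that \<omega>(1)] in force)
qed

text \<open>Restriction to a set that contains the support has no effect, and the definition of the
  boundary makes the two terms cancel.\<close>

lemma slice_vanishes_above:
  assumes f: "continuous_on U f"
    and \<omega>: "\<omega> \<in> rumin_test (k - 1) U" "rumin_support (k - 1) \<omega> \<subseteq> {p \<in> U. f p > t}"
  shows "slice_plus k U T f t \<omega> = 0"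
proof -
  note o = open_level_sets(1)[OF f open_U, of t]
  have SS: "current_restrict (k - 1) U S {p \<in> U. f p > t} \<omega> = S \<omega>"
    by (rule S.restrict_eq_T_of_subset[OF \<omega> S.open_Int_sets[OF o]])
  show ?thesis
  proof (cases k)
    case 0
    then show ?thesis unfolding slice_plus_0[OF 0] SS by (simp add: boundary_0)
  next
    case (Suc l)
    have "current_restrict k U T {p \<in> U. f p > t} (rumin_d l \<omega>) = T (rumin_d l \<omega>)"
      by (rule T.restrict_eq_T_of_subset[OF rumin_d_test'[OF Suc \<omega>(1)] _ T.open_Int_sets[OF o]])
        (rule order_trans[OF rumin_support_d[OF Suc \<omega>(1)] \<omega>(2)])
    then show ?thesis unfolding slice_plus_Suc[OF Suc] SS S_eq[OF Suc] by simp
  qed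
qed

text \<open>A point of \<open>U\<close> outside the right side has an open neighbourhood on which
  the slice vanishes for one of three reasons: \<open>T\<close> vanishes there, or it lies below the
  level, or above it. Continuity of \<open>f\<close> makes the last two kinds open.\<close>

lemma slice_support:
  assumes f: "continuous_on U f"
  shows "current_support (k - 1) U (slice_plus k U T f t) \<subseteq> {p \<in> U. f p = t} \<inter> current_support k U T"
proof
  fix p assume p: "p \<in> current_support (k - 1) U (slice_plus k U T f t)"
  then have pU: "p \<in> U" by (simp add: current_support_def)
  have no_V: "\<not> (open V \<and> V \<subseteq> U \<and> p \<in> V \<and>
      (\<forall>\<omega>\<in>rumin_test (k - 1) U. rumin_support (k - 1) \<omega> \<subseteq> V \<longrightarrow> slice_plus k U T f t \<omega> = 0))" for V
    using p unfolding current_support_def by blast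
  have "p \<in> current_support k U T"
  proof (rule ccontr)
    assume "p \<notin> current_support k U T"
    then obtain V where V: "open V" "V \<subseteq> U" "p \<in> V"
      "\<forall>\<omega>\<in>rumin_test k U. rumin_support k \<omega> \<subseteq> V \<longrightarrow> T \<omega> = 0"
      using pU unfolding current_support_def by blast
    have "slice_plus k U T f t \<omega> = 0"
      if "\<omega> \<in> rumin_test (k - 1) U" "rumin_support (k - 1) \<omega> \<subseteq> V" for \<omega>
      by (rule slice_vanishes_off_support[OF V(1,2) _ that]) (use V(4) in blast)
    then show False using no_V[of V] V(1-3) by blast
  qed
  moreover have "\<not> f p < t"
  proof
    assume "f p < t"
    moreover have "open {p \<in> U. f p < t}"
      by (rule open_level_sets(2)[OF f open_U])
    ultimately show False
      using no_V[of "{p \<in> U. f p < t}"] slice_vanishes_below[of _ f t] pU by blast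
  qed
  moreover have "\<not> f p > t"
  proof
    assume "f p > t"
    moreover have "open {p \<in> U. f p > t}"
      by (rule open_level_sets(1)[OF f open_U])
    ultimately show False
      using no_V[of "{p \<in> U. f p > t}"] slice_vanishes_above[OF f, of _ t] pU by blast
  qed
  ultimately show "p \<in> {p \<in> U. f p = t} \<inter> current_support k U T" using pU by simp
qed

text \<open>The restriction of \<open>T\<close> contributes nothing, as it is evaluated on a form
  differentiated twice, which is the zero form. On the right the restriction of \<open>R\<close>
  vanishes, and both sides reduce to the boundary of the restriction of \<open>S\<close>.\<close>

lemma boundary_slice:
  "current_eq (k - 1 - 1) U (boundary (k - 1) (slice_plus k U T f t)) (\<lambda>\<omega>. - slice_plus (k - 1) U S f t \<omega>)"
  unfolding current_eq_def
proof
  fix \<omega> assume \<omega>: "\<omega> \<in> rumin_test (k - 1 - 1) U"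
  let ?A = "{p \<in> U. f p > t}"
  have R0: "current_restrict (k - 1 - 1) U R ?A \<omega> = 0"
    by (rule R.restrict_zero_functional[OF R_eq_0 \<omega>])
  then have rhs: "- slice_plus (k - 1) U S f t \<omega> = boundary (k - 1) (current_restrict (k - 1) U S ?A) \<omega>"
    by (simp add: slice_plus_def)
  show "boundary (k - 1) (slice_plus k U T f t) \<omega> = - slice_plus (k - 1) U S f t \<omega>"
    unfolding rhs
  proof (cases "k - 1")
    case (Suc l)
    then have k2: "k = Suc (Suc l)" by simp
    have \<omega>': "\<omega> \<in> rumin_test l U" using \<omega> k2 by simp
    have "current_restrict k U T ?A (rumin_d (Suc l) (rumin_d l \<omega>)) = 0"
      unfolding rumin_d_rumin_d[OF rumin_test_smooth[OF \<omega>'] rumin_test_graded[OF \<omega>']]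
      by (rule T.restrict_zero_form)
    then have "slice_plus k U T f t (rumin_d l \<omega>) = current_restrict (k - 1) U S ?A (rumin_d l \<omega>)"
      unfolding slice_plus_Suc[OF k2] by simp
    then show "boundary (k - 1) (slice_plus k U T f t) \<omega> = boundary (k - 1) (current_restrict (k - 1) U S ?A) \<omega>"
      unfolding boundary_def using Suc by simp
  qed (simp add: boundary_def)
qed

end

theorem proposition3p5:
  fixes U :: "'n::{finite,linorder} hpoint set"
    and T :: "'n functional" and f :: "'n hpoint \<Rightarrow> real" and t :: real and k :: nat
  assumes "k \<le> 2 * CARD('n) + 1"
    and "open U"
    and "T \<in> normal_currents k U"
    and "f \<in> heis_Lip U"
  shows "countable {s. emeasure (current_measure k U T) {p \<in> U. f p = s}
           + emeasure (current_measure (k - 1) U (boundary k T)) {p \<in> U. f p = s} \<noteq> 0} \<and>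
    countable {s. \<not> current_eq (k - 1) U (slice_plus k U T f s) (slice_minus k U T f s)} \<and>
    current_support (k - 1) U (slice_plus k U T f t)
      \<subseteq> {p \<in> U. f p = t} \<inter> current_support k U T \<and>
    current_eq (k - 1 - 1) U (boundary (k - 1) (slice_plus k U T f t))
      (\<lambda>\<omega>. - slice_plus (k - 1) U (boundary k T) f t \<omega>)"
proof -
  interpret normal_current k U T by unfold_locales (use assms in auto)
  have f: "continuous_on U f" by (rule heis_Lip_continuous_on[OF assms(4)])
  let ?E = "{s. emeasure (current_measure k U T) {p \<in> U. f p = s}
           + emeasure (current_measure (k - 1) U S) {p \<in> U. f p = s} \<noteq> 0}"
  have "radon_measure_on U (current_measure k U T)"
    using T.rep unfolding represented_by_def by blast
  moreover have "radon_measure_on U (current_measure (k - 1) U S)"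
    using S.rep unfolding represented_by_def by blast
  ultimately have "countable ({s. emeasure (current_measure k U T) {p \<in> U. f p = s} \<noteq> 0} \<union>
      {s. emeasure (current_measure (k - 1) U S) {p \<in> U. f p = s} \<noteq> 0})"
    using countable_positive_levels[OF assms(2) _ f] by (intro countable_Un)
  then have E: "countable ?E"
    by (rule countable_subset[rotated]) auto
  \<comment> \<open>Off \<open>?E\<close> both measures of the level set are 0, which is the
    hypothesis of \<open>slices_agree\<close>.\<close>
  have "{s. \<not> current_eq (k - 1) U (slice_plus k U T f s) (slice_minus k U T f s)} \<subseteq> ?E"
    using slices_agree[OF f] by auto
  then have "countable {s. \<not> current_eq (k - 1) U (slice_plus k U T f s) (slice_minus k U T f s)}"
    using E by (rule countable_subset)
  then show ?thesis
    using E slice_support[OF f] boundary_slice by blast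
qed

end
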